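(* Let $\mathscr{V}$ be a topological category over $\mathsf{Set}$, with topological functor $|-| : \mathscr{V} \to \mathsf{Set}$, equipped with a symmetric monoidal closed structure $(\otimes, I, [-,-])$ such that $|-|$ is strict symmetric monoidal with respect to the cartesian structure on $\mathsf{Set}$ and is represented by $I$, and let $\mathcal{S}$ be a set. 1. For each $\mathscr{V}$-enriched $\mathcal{S}$-sorted signature $\Sigma$, there is a free-form $\mathbb{N}_{\mathcal{S}}$-signature $\mathscr{S}_\Sigma$ such that $\Sigma\text{-}\mathsf{Alg} \cong \mathscr{S}_\Sigma\text{-}\mathsf{Alg}$ in $\mathscr{V}\text{-}\mathsf{CAT}/\mathscr{V}^{\mathcal{S}}$. 2. For each algebraic $\Sigma$-equation $\omega \doteq \nu$, there is a diagrammatic $\mathscr{S}_\Sigma$-equation $\bar{\omega} \doteq \bar{\nu}$ such that a $\Sigma$-algebra $A$ satisfies $\omega \doteq \nu$ iff the corresponding $\mathscr{S}_\Sigma$-algebra (under the isomorphism of (1)) satisfies $\bar{\omega} \doteq \bar{\nu}$. 3. For each $\mathscr{V}$-enriched $\mathcal{S}$-sorted equational theory $\mathcal{T}$, there is a diagrammatic $\mathbb{N}_{\mathcal{S}}$-presentation $\mathscr{T}_{\mathcal{T}}$ such that $\mathcal{T}\text{-}\mathsf{Alg} \cong \mathscr{T}_{\mathcal{T}}\text{-}\mathsf{Alg}$ in $\mathscr{V}\text{-}\mathsf{CAT}/\mathscr{V}^{\mathcal{S}}$.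
   Context: Topological categories. A concrete category over $\mathsf{Set}$ is a category $\mathscr{V}$ with a faithful functor $|-| : \mathscr{V} \to \mathsf{Set}$; a function $f : |V| \to |W|$ is admissible if it lifts (uniquely) to a morphism $V \to W$. It is amnestic if, whenever $|V| = |V'|$ and the identity function is admissible both $V \to V'$ and $V' \to V$, then $V = V'$. A (possibly large) source $(f_i : V \to V_i)_{i}$ is initial if for all $W$ and $f : |W| \to |V|$, $f$ is admissible iff all $f_i \circ f$ are. $\mathscr{V}$ is topological over $\mathsf{Set}$ if it is amnestic and every (possibly large) structured source $(f_i : Y \to |V_i|)_i$ has an initial lift: an object $V$ with $|V| = Y$, each $f_i$ admissible, and $(f_i : V \to V_i)_i$ initial. Such $\mathscr{V}$ is complete and cocomplete, and $|-|$ strictly preserves limits and colimits. Enrichment. $\mathscr{V}$ is regarded as a $\mathscr{V}$-category, and $\mathscr{V}^{\mathcal{S}}$ as a $\mathscr{V}$-category with $\mathscr{V}^{\mathcal{S}}(X, Y) = \prod_{S \in \mathcal{S}} [X_S, Y_S]$; it is tensored with $V \otimes X = X \otimes V = (V \otimes X_S)_S$ for $V \in \mathscr{V}$, $X \in \mathscr{V}^{\mathcal{S}}$ (up to symmetry). $\mathscr{V}\text{-}\mathsf{CAT}/\mathscr{V}^{\mathcal{S}}$ is the strict slice category: objects are $\mathscr{V}$-categories equipped with a $\mathscr{V}$-functor to $\mathscr{V}^{\mathcal{S}}$, morphisms are $\mathscr{V}$-functors strictly commuting with these. Enriched multi-sorted theories. $\mathcal{S}^*$ is the set of finite sequences of elements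 of $\mathcal{S}$. A $\mathscr{V}$-enriched $\mathcal{S}$-sorted signature is a set $\Sigma$ of operation symbols, each with a type $((S_1, \ldots, S_n), S, P)$, where $(S_1, \ldots, S_n) \in \mathcal{S}^*$, $S \in \mathcal{S}$, $P \in \mathrm{ob}\,\mathscr{V}$. A $\Sigma$-algebra is an object $A$ of $\mathscr{V}^{\mathcal{S}}$ with a $\mathscr{V}$-morphism $\sigma^A : P \otimes (A_{S_1} \times \cdots \times A_{S_n}) \to A_S$ for each such $\sigma$; morphisms are morphisms $f$ of $\mathscr{V}^{\mathcal{S}}$ with $f_S \circ \sigma^A = \sigma^B \circ (1_P \otimes (f_{S_1} \times \cdots \times f_{S_n}))$. $\Sigma\text{-}\mathsf{Alg}$ is a $\mathscr{V}$-category over $\mathscr{V}^{\mathcal{S}}$ (via a faithful $\mathscr{V}$-functor $U^\Sigma$) with $\Sigma\text{-}\mathsf{Alg}(A, B) \rightarrowtail \mathscr{V}^{\mathcal{S}}(A, B)$ the joint equalizer, over all $\sigma \in \Sigma$ (of type $((S_1, \ldots, S_n), S, P)$), of the two morphisms $\mathscr{V}^{\mathcal{S}}(A, B) \rightrightarrows [P \otimes (A_{S_1} \times \cdots \times A_{S_n}), B_S]$ given by applying the $\mathscr{V}$-functor $A \mapsto P \otimes (A_{S_1} \times \cdots \times A_{S_n})$ followed by composition with $\sigma^B$, respectively by the $S$-component followed by precomposition with $\sigma^A$. An algebraic $\Sigma$-operation of type $((S_1, \ldots, S_n), S, P)$ is a natural transformation (of ordinary functors $\Sigma\text{-}\mathsf{Alg}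 \to \mathscr{V}$) with components $\omega_A : P \otimes (A_{S_1} \times \cdots \times A_{S_n}) \to A_S$. An algebraic $\Sigma$-equation $\omega \doteq \nu$ is a pair of algebraic $\Sigma$-operations of the same type; $A$ satisfies it if $\omega_A = \nu_A$. A $\mathscr{V}$-enriched $\mathcal{S}$-sorted equational theory is a pair $\mathcal{T} = (\Sigma, \mathcal{E})$ with $\mathcal{E}$ a set of algebraic $\Sigma$-equations; $\mathcal{T}\text{-}\mathsf{Alg}$ is the full sub-$\mathscr{V}$-category of $\Sigma\text{-}\mathsf{Alg}$ on the algebras satisfying all equations in $\mathcal{E}$. Arities. For $n \in \mathbb{N}$, $n \cdot I = \coprod_n I$ in $\mathscr{V}$. $\mathbb{N}_{\mathcal{S}}$ is the full sub-$\mathscr{V}$-category of $\mathscr{V}^{\mathcal{S}}$ on the objects $(n_S \cdot I)_{S \in \mathcal{S}}$ with $n_S \in \mathbb{N}$ and $n_S = 0$ for all but finitely many $S$. Diagrammatic presentations. A free-form $\mathbb{N}_{\mathcal{S}}$-signature is a set $\mathscr{S}$ of operation symbols, each equipped with an arity $J \in \mathrm{ob}\,\mathbb{N}_{\mathcal{S}}$ and a parameter $P \in \mathrm{ob}\,\mathscr{V}^{\mathcal{S}}$. An $\mathscr{S}$-algebra is an object $A$ of $\mathscr{V}^{\mathcal{S}}$ with, for each $\sigma \in \mathscr{S}$ of arity $J$ and parameter $P$, a morphism $\sigma^A : \mathscr{V}^{\mathcal{S}}(J, A) \otimes P \to A$ of $\mathscr{V}^{\mathcal{S}}$; a morphism $f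 : A \to B$ of $\mathscr{S}$-algebras is a morphism of $\mathscr{V}^{\mathcal{S}}$ with $f \circ \sigma^A = \sigma^B \circ (\mathscr{V}^{\mathcal{S}}(J, f) \otimes 1_P)$ for all $\sigma$. $\mathscr{S}\text{-}\mathsf{Alg}$ is a $\mathscr{V}$-category over $\mathscr{V}^{\mathcal{S}}$ (via a faithful $\mathscr{V}$-functor $U^{\mathscr{S}}$) with $\mathscr{S}\text{-}\mathsf{Alg}(A, B) \rightarrowtail \mathscr{V}^{\mathcal{S}}(A, B)$ the joint equalizer over $\sigma \in \mathscr{S}$ of the two morphisms $\mathscr{V}^{\mathcal{S}}(A, B) \rightrightarrows \mathscr{V}^{\mathcal{S}}(\mathscr{V}^{\mathcal{S}}(J, A) \otimes P, B)$ given by applying the $\mathscr{V}$-functor $\mathscr{V}^{\mathcal{S}}(J, -) \otimes P$ followed by composition with $\sigma^B$, respectively by precomposition with $\sigma^A$. A natural $\mathscr{S}$-operation of arity $J$ and parameter $P$ is a natural transformation $\omega : \mathscr{V}^{\mathcal{S}}(J, U^{\mathscr{S}}-) \otimes P \Rightarrow U^{\mathscr{S}}$. A diagrammatic $\mathscr{S}$-equation $\omega \doteq \nu$ is a pair of natural $\mathscr{S}$-operations with the same arity and parameter; $A$ satisfies it if $\omega_A = \nu_A$. A diagrammatic $\mathbb{N}_{\mathcal{S}}$-presentation is a pair $\mathscr{T} = (\mathscr{S}, \mathscr{E})$ with $\mathscr{S}$ a free-form $\mathbb{N}_{\mathcal{S}}$-signature and $\mathscr{E}$ a set of diagrammatic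 $\mathscr{S}$-equations; $\mathscr{T}\text{-}\mathsf{Alg}$ is the full sub-$\mathscr{V}$-category of $\mathscr{S}\text{-}\mathsf{Alg}$ on the algebras satisfying all equations in $\mathscr{E}$, regarded over $\mathscr{V}^{\mathcal{S}}$ by restricting $U^{\mathscr{S}}$. *)

theory Defs
  imports "HOL-Library.FuncSet"
begin

section \<open>Sets\<close>

text \<open>A HOL type is not closed under products and function spaces, so the category of sets is
  built over a model of set theory: a type whose elements are the sets of ZFC, with
  \<open>elts x\<close> the collection of members of \<open>x\<close>, so that arbitrary HOL sets over it play the
  role of classes.\<close>

class set_universe =
  fixes elts :: "'a \<Rightarrow> 'a set"
  assumes elts_ext: "elts x = elts y \<Longrightarrow> x = y"
    and elts_wf: "wf {(x, y). x \<in> elts y}"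
    and elts_subset: "A \<subseteq> elts x \<Longrightarrow> A \<in> range elts"
    and elts_Union: "A \<in> range elts \<Longrightarrow> \<Union> (elts ` A) \<in> range elts"
    and elts_Pow: "{y. elts y \<subseteq> elts x} \<in> range elts"
    and elts_replacement: "A \<in> range elts \<Longrightarrow> f ` A \<in> range elts"
    and elts_infinity: "range (g :: nat \<Rightarrow> 'a) \<in> range elts"

definition small :: "'u::set_universe set \<Rightarrow> bool" where
  "small A \<longleftrightarrow> A \<in> range elts"

text \<open>Smallness of a collection whose members are not themselves elements of the universe.\<close>

definition small_collection :: "'u::set_universe itself \<Rightarrow> 'a set \<Rightarrow> bool" where
  "small_collection _ E \<longleftrightarrow> (\<exists>(K :: 'u set) f. small K \<and> E = f ` K)"

definition as_element :: "'u::set_universe set \<Rightarrow> 'u" where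
  "as_element A = (THE x. elts x = A)"

definition kpair :: "'u::set_universe \<Rightarrow> 'u \<Rightarrow> 'u" where
  "kpair a b = as_element {as_element {a}, as_element {a, b}}"

definition kfst :: "'u::set_universe \<Rightarrow> 'u" where
  "kfst p = (THE a. \<exists>b. p = kpair a b)"

definition ksnd :: "'u::set_universe \<Rightarrow> 'u" where
  "ksnd p = (THE b. \<exists>a. p = kpair a b)"

definition cartesian :: "'u::set_universe set \<Rightarrow> 'u set \<Rightarrow> 'u set" where
  "cartesian A B = {kpair a b | a b. a \<in> A \<and> b \<in> B}"

section \<open>Categories\<close>

record ('o, 'm) cat =
  Obj :: "'o set"
  Arr :: "'m set"
  Dom :: "'m \<Rightarrow> 'o"
  Cod :: "'m \<Rightarrow> 'o"
  Ident :: "'o \<Rightarrow> 'm"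
  Comp :: "'m \<Rightarrow> 'm \<Rightarrow> 'm"  (infixl \<open>\<cdot>\<index>\<close> 65)

definition hom :: "('o, 'm, 'z) cat_scheme \<Rightarrow> 'o \<Rightarrow> 'o \<Rightarrow> 'm set" where
  "hom C X Y = {f \<in> Arr C. Dom C f = X \<and> Cod C f = Y}"

definition category :: "('o, 'm, 'z) cat_scheme \<Rightarrow> bool" where
  "category C \<longleftrightarrow>
     (\<forall>f\<in>Arr C. Dom C f \<in> Obj C \<and> Cod C f \<in> Obj C) \<and>
     (\<forall>X\<in>Obj C. Ident C X \<in> hom C X X) \<and>
     (\<forall>X\<in>Obj C. \<forall>Y\<in>Obj C. \<forall>Z\<in>Obj C. \<forall>f\<in>hom C X Y. \<forall>g\<in>hom C Y Z. g \<cdot>\<^bsub>C\<^esub> f \<in> hom C X Z) \<and>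
     (\<forall>X\<in>Obj C. \<forall>Y\<in>Obj C. \<forall>f\<in>hom C X Y. f \<cdot>\<^bsub>C\<^esub> Ident C X = f \<and> Ident C Y \<cdot>\<^bsub>C\<^esub> f = f) \<and>
     (\<forall>W\<in>Obj C. \<forall>X\<in>Obj C. \<forall>Y\<in>Obj C. \<forall>Z\<in>Obj C.
        \<forall>f\<in>hom C W X. \<forall>g\<in>hom C X Y. \<forall>h\<in>hom C Y Z.
          h \<cdot>\<^bsub>C\<^esub> g \<cdot>\<^bsub>C\<^esub> f = h \<cdot>\<^bsub>C\<^esub> (g \<cdot>\<^bsub>C\<^esub> f))"

definition inverse_arrows :: "('o, 'm, 'z) cat_scheme \<Rightarrow> 'm \<Rightarrow> 'm \<Rightarrow> bool" where
  "inverse_arrows C f g \<longleftrightarrow> f \<in> Arr C \<and> g \<in> hom C (Cod C f) (Dom C f) \<and>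
     g \<cdot>\<^bsub>C\<^esub> f = Ident C (Dom C f) \<and> f \<cdot>\<^bsub>C\<^esub> g = Ident C (Cod C f)"

definition is_iso :: "('o, 'm, 'z) cat_scheme \<Rightarrow> 'm \<Rightarrow> bool" where
  "is_iso C f \<longleftrightarrow> (\<exists>g. inverse_arrows C f g)"

definition inv_arr :: "('o, 'm, 'z) cat_scheme \<Rightarrow> 'm \<Rightarrow> 'm" where
  "inv_arr C f = (THE g. inverse_arrows C f g)"

record ('o, 'm, 'p, 'n) ofunctor =
  Fob :: "'o \<Rightarrow> 'p"
  Far :: "'m \<Rightarrow> 'n"

definition is_functor ::
  "('o, 'm, 'z) cat_scheme \<Rightarrow> ('p, 'n, 'y) cat_scheme \<Rightarrow> ('o, 'm, 'p, 'n) ofunctor \<Rightarrow> bool" where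
  "is_functor C D F \<longleftrightarrow>
     (\<forall>X\<in>Obj C. Fob F X \<in> Obj D \<and> Far F (Ident C X) = Ident D (Fob F X)) \<and>
     (\<forall>X\<in>Obj C. \<forall>Y\<in>Obj C. \<forall>f\<in>hom C X Y. Far F f \<in> hom D (Fob F X) (Fob F Y)) \<and>
     (\<forall>X\<in>Obj C. \<forall>Y\<in>Obj C. \<forall>Z\<in>Obj C. \<forall>f\<in>hom C X Y. \<forall>g\<in>hom C Y Z.
        Far F (g \<cdot>\<^bsub>C\<^esub> f) = Far F g \<cdot>\<^bsub>D\<^esub> Far F f)"

definition faithful :: "('o, 'm, 'z) cat_scheme \<Rightarrow> ('o, 'm, 'p, 'n) ofunctor \<Rightarrow> bool" where
  "faithful C F \<longleftrightarrow> (\<forall>X\<in>Obj C. \<forall>Y\<in>Obj C. inj_on (Far F) (hom C X Y))"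

subsection \<open>Limits and coproducts\<close>

definition is_product ::
  "('o, 'm, 'z) cat_scheme \<Rightarrow> 'k set \<Rightarrow> ('k \<Rightarrow> 'o) \<Rightarrow> 'o \<Rightarrow> ('k \<Rightarrow> 'm) \<Rightarrow> bool" where
  "is_product C K X P p \<longleftrightarrow> P \<in> Obj C \<and> (\<forall>k\<in>K. p k \<in> hom C P (X k)) \<and>
     (\<forall>Z\<in>Obj C. \<forall>f. (\<forall>k\<in>K. f k \<in> hom C Z (X k)) \<longrightarrow>
        (\<exists>!h. h \<in> hom C Z P \<and> (\<forall>k\<in>K. p k \<cdot>\<^bsub>C\<^esub> h = f k)))"

definition is_coproduct ::
  "('o, 'm, 'z) cat_scheme \<Rightarrow> 'k set \<Rightarrow> ('k \<Rightarrow> 'o) \<Rightarrow> 'o \<Rightarrow> ('k \<Rightarrow> 'm) \<Rightarrow> bool" where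
  "is_coproduct C K X Q q \<longleftrightarrow> Q \<in> Obj C \<and> (\<forall>k\<in>K. q k \<in> hom C (X k) Q) \<and>
     (\<forall>Z\<in>Obj C. \<forall>f. (\<forall>k\<in>K. f k \<in> hom C (X k) Z) \<longrightarrow>
        (\<exists>!h. h \<in> hom C Q Z \<and> (\<forall>k\<in>K. h \<cdot>\<^bsub>C\<^esub> q k = f k)))"

definition is_joint_equalizer ::
  "('o, 'm, 'z) cat_scheme \<Rightarrow> 'o \<Rightarrow> 'k set \<Rightarrow> ('k \<Rightarrow> 'm) \<Rightarrow> ('k \<Rightarrow> 'm) \<Rightarrow> 'o \<Rightarrow> 'm \<Rightarrow> bool" where
  "is_joint_equalizer C X K f g E e \<longleftrightarrow> E \<in> Obj C \<and> e \<in> hom C E X \<and>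
     (\<forall>k\<in>K. f k \<cdot>\<^bsub>C\<^esub> e = g k \<cdot>\<^bsub>C\<^esub> e) \<and>
     (\<forall>Z\<in>Obj C. \<forall>h\<in>hom C Z X. (\<forall>k\<in>K. f k \<cdot>\<^bsub>C\<^esub> h = g k \<cdot>\<^bsub>C\<^esub> h) \<longrightarrow>
        (\<exists>!u. u \<in> hom C Z E \<and> e \<cdot>\<^bsub>C\<^esub> u = h))"

text \<open>Chosen limits and colimits; the choice is immaterial, as all of them exist in the categories
  considered below.\<close>

definition product_cone ::
  "('o, 'm, 'z) cat_scheme \<Rightarrow> 'k set \<Rightarrow> ('k \<Rightarrow> 'o) \<Rightarrow> 'o \<times> ('k \<Rightarrow> 'm)" where
  "product_cone C K X = (SOME (P, p). is_product C K X P p)"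

definition prod_obj :: "('o, 'm, 'z) cat_scheme \<Rightarrow> 'k set \<Rightarrow> ('k \<Rightarrow> 'o) \<Rightarrow> 'o" where
  "prod_obj C K X = fst (product_cone C K X)"

definition prod_proj :: "('o, 'm, 'z) cat_scheme \<Rightarrow> 'k set \<Rightarrow> ('k \<Rightarrow> 'o) \<Rightarrow> 'k \<Rightarrow> 'm" where
  "prod_proj C K X = snd (product_cone C K X)"

definition tuple ::
  "('o, 'm, 'z) cat_scheme \<Rightarrow> 'k set \<Rightarrow> ('k \<Rightarrow> 'o) \<Rightarrow> 'o \<Rightarrow> ('k \<Rightarrow> 'm) \<Rightarrow> 'm" where
  "tuple C K X Z f =
     (THE h. h \<in> hom C Z (prod_obj C K X) \<and> (\<forall>k\<in>K. prod_proj C K X k \<cdot>\<^bsub>C\<^esub> h = f k))"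

definition copower :: "('o, 'm, 'z) cat_scheme \<Rightarrow> nat \<Rightarrow> 'o \<Rightarrow> 'o" where
  "copower C n X = fst (SOME (Q, q). is_coproduct C {..<n} (\<lambda>_. X) Q q)"

definition joint_equalizer ::
  "('o, 'm, 'z) cat_scheme \<Rightarrow> 'o \<Rightarrow> 'k set \<Rightarrow> ('k \<Rightarrow> 'm) \<Rightarrow> ('k \<Rightarrow> 'm) \<Rightarrow> 'o \<times> 'm" where
  "joint_equalizer C X K f g = (SOME (E, e). is_joint_equalizer C X K f g E e)"

section \<open>Symmetric monoidal closed categories\<close>

record ('o, 'm) smcat = "('o, 'm) cat" +
  Tob :: "'o \<Rightarrow> 'o \<Rightarrow> 'o"  (infixr \<open>\<otimes>\<index>\<close> 75)
  Tar :: "'m \<Rightarrow> 'm \<Rightarrow> 'm"  (infixr \<open>\<odot>\<index>\<close> 75)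
  Unit :: 'o
  Assoc :: "'o \<Rightarrow> 'o \<Rightarrow> 'o \<Rightarrow> 'm"
  Lunit :: "'o \<Rightarrow> 'm"
  Runit :: "'o \<Rightarrow> 'm"
  Swap :: "'o \<Rightarrow> 'o \<Rightarrow> 'm"

record ('o, 'm) smccat = "('o, 'm) smcat" +
  Ihom :: "'o \<Rightarrow> 'o \<Rightarrow> 'o"
  Eval :: "'o \<Rightarrow> 'o \<Rightarrow> 'm"

definition symmetric_monoidal :: "('o, 'm, 'z) smcat_scheme \<Rightarrow> bool" where
  "symmetric_monoidal C \<longleftrightarrow> category C \<and>
     \<comment> \<open>the tensor product is a bifunctor\<close>
     (\<forall>X\<in>Obj C. \<forall>Y\<in>Obj C. X \<otimes>\<^bsub>C\<^esub> Y \<in> Obj C \<and> Ident C X \<odot>\<^bsub>C\<^esub> Ident C Y = Ident C (X \<otimes>\<^bsub>C\<^esub> Y)) \<and>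
     (\<forall>f\<in>Arr C. \<forall>g\<in>Arr C. f \<odot>\<^bsub>C\<^esub> g \<in> hom C (Dom C f \<otimes>\<^bsub>C\<^esub> Dom C g) (Cod C f \<otimes>\<^bsub>C\<^esub> Cod C g)) \<and>
     (\<forall>f\<in>Arr C. \<forall>g\<in>Arr C. \<forall>f'\<in>Arr C. \<forall>g'\<in>Arr C. Dom C f' = Cod C f \<longrightarrow> Dom C g' = Cod C g \<longrightarrow>
        (f' \<cdot>\<^bsub>C\<^esub> f) \<odot>\<^bsub>C\<^esub> (g' \<cdot>\<^bsub>C\<^esub> g) = (f' \<odot>\<^bsub>C\<^esub> g') \<cdot>\<^bsub>C\<^esub> (f \<odot>\<^bsub>C\<^esub> g)) \<and>
     Unit C \<in> Obj C \<and>
     \<comment> \<open>structural isomorphisms\<close>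
     (\<forall>X\<in>Obj C. \<forall>Y\<in>Obj C. \<forall>Z\<in>Obj C. is_iso C (Assoc C X Y Z) \<and>
        Assoc C X Y Z \<in> hom C ((X \<otimes>\<^bsub>C\<^esub> Y) \<otimes>\<^bsub>C\<^esub> Z) (X \<otimes>\<^bsub>C\<^esub> (Y \<otimes>\<^bsub>C\<^esub> Z))) \<and>
     (\<forall>X\<in>Obj C. is_iso C (Lunit C X) \<and> Lunit C X \<in> hom C (Unit C \<otimes>\<^bsub>C\<^esub> X) X) \<and>
     (\<forall>X\<in>Obj C. is_iso C (Runit C X) \<and> Runit C X \<in> hom C (X \<otimes>\<^bsub>C\<^esub> Unit C) X) \<and>
     (\<forall>X\<in>Obj C. \<forall>Y\<in>Obj C. Swap C X Y \<in> hom C (X \<otimes>\<^bsub>C\<^esub> Y) (Y \<otimes>\<^bsub>C\<^esub> X) \<and>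
        Swap C Y X \<cdot>\<^bsub>C\<^esub> Swap C X Y = Ident C (X \<otimes>\<^bsub>C\<^esub> Y)) \<and>
     \<comment> \<open>naturality\<close>
     (\<forall>f\<in>Arr C. \<forall>g\<in>Arr C. \<forall>h\<in>Arr C.
        Assoc C (Cod C f) (Cod C g) (Cod C h) \<cdot>\<^bsub>C\<^esub> ((f \<odot>\<^bsub>C\<^esub> g) \<odot>\<^bsub>C\<^esub> h) =
        (f \<odot>\<^bsub>C\<^esub> (g \<odot>\<^bsub>C\<^esub> h)) \<cdot>\<^bsub>C\<^esub> Assoc C (Dom C f) (Dom C g) (Dom C h)) \<and>
     (\<forall>f\<in>Arr C. Lunit C (Cod C f) \<cdot>\<^bsub>C\<^esub> (Ident C (Unit C) \<odot>\<^bsub>C\<^esub> f) = f \<cdot>\<^bsub>C\<^esub> Lunit C (Dom C f)) \<and>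
     (\<forall>f\<in>Arr C. Runit C (Cod C f) \<cdot>\<^bsub>C\<^esub> (f \<odot>\<^bsub>C\<^esub> Ident C (Unit C)) = f \<cdot>\<^bsub>C\<^esub> Runit C (Dom C f)) \<and>
     (\<forall>f\<in>Arr C. \<forall>g\<in>Arr C.
        Swap C (Cod C f) (Cod C g) \<cdot>\<^bsub>C\<^esub> (f \<odot>\<^bsub>C\<^esub> g) = (g \<odot>\<^bsub>C\<^esub> f) \<cdot>\<^bsub>C\<^esub> Swap C (Dom C f) (Dom C g)) \<and>
     \<comment> \<open>pentagon, triangle and hexagon\<close>
     (\<forall>W\<in>Obj C. \<forall>X\<in>Obj C. \<forall>Y\<in>Obj C. \<forall>Z\<in>Obj C.
        Assoc C W X (Y \<otimes>\<^bsub>C\<^esub> Z) \<cdot>\<^bsub>C\<^esub> Assoc C (W \<otimes>\<^bsub>C\<^esub> X) Y Z =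
        (Ident C W \<odot>\<^bsub>C\<^esub> Assoc C X Y Z) \<cdot>\<^bsub>C\<^esub> Assoc C W (X \<otimes>\<^bsub>C\<^esub> Y) Z \<cdot>\<^bsub>C\<^esub> (Assoc C W X Y \<odot>\<^bsub>C\<^esub> Ident C Z)) \<and>
     (\<forall>X\<in>Obj C. \<forall>Y\<in>Obj C.
        (Ident C X \<odot>\<^bsub>C\<^esub> Lunit C Y) \<cdot>\<^bsub>C\<^esub> Assoc C X (Unit C) Y = Runit C X \<odot>\<^bsub>C\<^esub> Ident C Y) \<and>
     (\<forall>X\<in>Obj C. \<forall>Y\<in>Obj C. \<forall>Z\<in>Obj C.
        Assoc C Y Z X \<cdot>\<^bsub>C\<^esub> Swap C X (Y \<otimes>\<^bsub>C\<^esub> Z) \<cdot>\<^bsub>C\<^esub> Assoc C X Y Z =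
        (Ident C Y \<odot>\<^bsub>C\<^esub> Swap C X Z) \<cdot>\<^bsub>C\<^esub> Assoc C Y X Z \<cdot>\<^bsub>C\<^esub> (Swap C X Y \<odot>\<^bsub>C\<^esub> Ident C Z))"

definition symmetric_monoidal_closed :: "('o, 'm, 'z) smccat_scheme \<Rightarrow> bool" where
  "symmetric_monoidal_closed C \<longleftrightarrow> symmetric_monoidal C \<and>
     (\<forall>X\<in>Obj C. \<forall>Y\<in>Obj C. Ihom C X Y \<in> Obj C \<and> Eval C X Y \<in> hom C (Ihom C X Y \<otimes>\<^bsub>C\<^esub> X) Y \<and>
        (\<forall>Z\<in>Obj C. \<forall>f\<in>hom C (Z \<otimes>\<^bsub>C\<^esub> X) Y.
           \<exists>!g. g \<in> hom C Z (Ihom C X Y) \<and> Eval C X Y \<cdot>\<^bsub>C\<^esub> (g \<odot>\<^bsub>C\<^esub> Ident C X) = f))"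

definition adjunct :: "('o, 'm, 'z) smccat_scheme \<Rightarrow> 'o \<Rightarrow> 'o \<Rightarrow> 'o \<Rightarrow> 'm \<Rightarrow> 'm" where
  "adjunct C Z X Y f =
     (THE g. g \<in> hom C Z (Ihom C X Y) \<and> Eval C X Y \<cdot>\<^bsub>C\<^esub> (g \<odot>\<^bsub>C\<^esub> Ident C X) = f)"

text \<open>Composition \<open>[X, g] : [X, Y] \<rightarrow> [X, Z]\<close> with \<open>g : Y \<rightarrow> Z\<close> and precomposition
  \<open>[f, Z] : [Y, Z] \<rightarrow> [X, Z]\<close> with \<open>f : X \<rightarrow> Y\<close>.\<close>

definition post :: "('o, 'm, 'z) smccat_scheme \<Rightarrow> 'o \<Rightarrow> 'm \<Rightarrow> 'm" where
  "post C X g = adjunct C (Ihom C X (Dom C g)) X (Cod C g) (g \<cdot>\<^bsub>C\<^esub> Eval C X (Dom C g))"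

definition pre :: "('o, 'm, 'z) smccat_scheme \<Rightarrow> 'm \<Rightarrow> 'o \<Rightarrow> 'm" where
  "pre C f Z = adjunct C (Ihom C (Cod C f) Z) (Dom C f) Z
     (Eval C (Cod C f) Z \<cdot>\<^bsub>C\<^esub> (Ident C (Ihom C (Cod C f) Z) \<odot>\<^bsub>C\<^esub> f))"

definition strict_symmetric_monoidal ::
  "('o, 'm, 'z) smcat_scheme \<Rightarrow> ('p, 'n, 'y) smcat_scheme \<Rightarrow> ('o, 'm, 'p, 'n) ofunctor \<Rightarrow> bool" where
  "strict_symmetric_monoidal C D F \<longleftrightarrow> is_functor C D F \<and>
     Fob F (Unit C) = Unit D \<and>
     (\<forall>X\<in>Obj C. \<forall>Y\<in>Obj C. Fob F (X \<otimes>\<^bsub>C\<^esub> Y) = Fob F X \<otimes>\<^bsub>D\<^esub> Fob F Y) \<and>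
     (\<forall>f\<in>Arr C. \<forall>g\<in>Arr C. Far F (f \<odot>\<^bsub>C\<^esub> g) = Far F f \<odot>\<^bsub>D\<^esub> Far F g) \<and>
     (\<forall>X\<in>Obj C. \<forall>Y\<in>Obj C. \<forall>Z\<in>Obj C.
        Far F (Assoc C X Y Z) = Assoc D (Fob F X) (Fob F Y) (Fob F Z)) \<and>
     (\<forall>X\<in>Obj C. Far F (Lunit C X) = Lunit D (Fob F X) \<and> Far F (Runit C X) = Runit D (Fob F X)) \<and>
     (\<forall>X\<in>Obj C. \<forall>Y\<in>Obj C. Far F (Swap C X Y) = Swap D (Fob F X) (Fob F Y))"

section \<open>The category of sets and topological categories over it\<close>

text \<open>A function is a triple of its domain, its (extensional) action and its codomain.\<close>

type_synonym 'u setfun = "'u set \<times> ('u \<Rightarrow> 'u) \<times> 'u set"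

definition Set_cat :: "('u::set_universe set, 'u setfun) smcat" where
  "Set_cat = \<lparr>
     Obj = {A. small A},
     Arr = {(A, f, B). small A \<and> small B \<and> f \<in> A \<rightarrow>\<^sub>E B},
     Dom = (\<lambda>(A, f, B). A),
     Cod = (\<lambda>(A, f, B). B),
     Ident = (\<lambda>A. (A, \<lambda>x\<in>A. x, A)),
     Comp = (\<lambda>(B', g, C) (A, f, B). (A, compose A g f, C)),
     Tob = cartesian,
     Tar = (\<lambda>(A, f, B) (A', f', B'). (cartesian A A',
              \<lambda>t\<in>cartesian A A'. kpair (f (kfst t)) (f' (ksnd t)), cartesian B B')),
     Unit = {as_element {}},
     Assoc = (\<lambda>A B C. (cartesian (cartesian A B) C,
              \<lambda>t\<in>cartesian (cartesian A B) C. kpair (kfst (kfst t)) (kpair (ksnd (kfst t)) (ksnd t)),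
              cartesian A (cartesian B C))),
     Lunit = (\<lambda>A. (cartesian {as_element {}} A, \<lambda>t\<in>cartesian {as_element {}} A. ksnd t, A)),
     Runit = (\<lambda>A. (cartesian A {as_element {}}, \<lambda>t\<in>cartesian A {as_element {}}. kfst t, A)),
     Swap = (\<lambda>A B. (cartesian A B, \<lambda>t\<in>cartesian A B. kpair (ksnd t) (kfst t), cartesian B A)) \<rparr>"

type_synonym ('o, 'm, 'u) setfunctor = "('o, 'm, 'u set, 'u setfun) ofunctor"

definition concrete ::
  "('o, 'm, 'z) cat_scheme \<Rightarrow> ('o, 'm, 'u::set_universe) setfunctor \<Rightarrow> bool" where
  "concrete C U \<longleftrightarrow> category C \<and> is_functor C Set_cat U \<and> faithful C U"

definition admissible ::
  "('o, 'm, 'z) cat_scheme \<Rightarrow> ('o, 'm, 'u) setfunctor \<Rightarrow> 'o \<Rightarrow> 'o \<Rightarrow> 'u setfun \<Rightarrow> bool" where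
  "admissible C U X Y f \<longleftrightarrow> (\<exists>m\<in>hom C X Y. Far U m = f)"

definition amnestic ::
  "('o, 'm, 'z) cat_scheme \<Rightarrow> ('o, 'm, 'u::set_universe) setfunctor \<Rightarrow> bool" where
  "amnestic C U \<longleftrightarrow> (\<forall>X\<in>Obj C. \<forall>Y\<in>Obj C. Fob U X = Fob U Y \<longrightarrow>
     admissible C U X Y (Ident Set_cat (Fob U X)) \<longrightarrow> admissible C U Y X (Ident Set_cat (Fob U X)) \<longrightarrow>
     X = Y)"

text \<open>A structured source on a set \<open>A\<close> is an arbitrary class of pairs of an object \<open>Z\<close> and a
  function \<open>A \<rightarrow> |Z|\<close>. No index class is needed: repeated members do not affect initiality.\<close>

definition structured_source ::
  "('o, 'm, 'z) cat_scheme \<Rightarrow> ('o, 'm, 'u::set_universe) setfunctor \<Rightarrow>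
   'u set \<Rightarrow> ('o \<times> 'u setfun) set \<Rightarrow> bool" where
  "structured_source C U A G \<longleftrightarrow> (\<forall>(Z, g)\<in>G. Z \<in> Obj C \<and> g \<in> hom Set_cat A (Fob U Z))"

definition initial_lift ::
  "('o, 'm, 'z) cat_scheme \<Rightarrow> ('o, 'm, 'u::set_universe) setfunctor \<Rightarrow>
   'u set \<Rightarrow> ('o \<times> 'u setfun) set \<Rightarrow> 'o \<Rightarrow> bool" where
  "initial_lift C U A G X \<longleftrightarrow> X \<in> Obj C \<and> Fob U X = A \<and>
     (\<forall>(Z, g)\<in>G. admissible C U X Z g) \<and>
     (\<forall>W\<in>Obj C. \<forall>f\<in>hom Set_cat (Fob U W) A.
        admissible C U W X f \<longleftrightarrow> (\<forall>(Z, g)\<in>G. admissible C U W Z (g \<cdot>\<^bsub>Set_cat\<^esub> f)))"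

definition topological ::
  "('o, 'm, 'z) cat_scheme \<Rightarrow> ('o, 'm, 'u::set_universe) setfunctor \<Rightarrow> bool" where
  "topological C U \<longleftrightarrow> concrete C U \<and> amnestic C U \<and>
     (\<forall>A G. small A \<longrightarrow> structured_source C U A G \<longrightarrow> (\<exists>X. initial_lift C U A G X))"

text \<open>A natural bijection between \<open>C(R, X)\<close> and \<open>|X|\<close>.\<close>

definition represented_by ::
  "('o, 'm, 'z) cat_scheme \<Rightarrow> ('o, 'm, 'u::set_universe) setfunctor \<Rightarrow> 'o \<Rightarrow> bool" where
  "represented_by C U R \<longleftrightarrow> (\<exists>\<phi>.
     (\<forall>X\<in>Obj C. bij_betw (\<phi> X) (hom C R X) (Fob U X)) \<and>
     (\<forall>X\<in>Obj C. \<forall>Y\<in>Obj C. \<forall>h\<in>hom C X Y. \<forall>f\<in>hom C R X.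
        \<phi> Y (h \<cdot>\<^bsub>C\<^esub> f) = fst (snd (Far U h)) (\<phi> X f)))"

section \<open>Enriched categories\<close>

record ('a, 'o, 'm) vcat =
  VObj :: "'a set"
  VHom :: "'a \<Rightarrow> 'a \<Rightarrow> 'o"
  VId :: "'a \<Rightarrow> 'm"
  VComp :: "'a \<Rightarrow> 'a \<Rightarrow> 'a \<Rightarrow> 'm"

definition vcategory :: "('o, 'm, 'z) smcat_scheme \<Rightarrow> ('a, 'o, 'm) vcat \<Rightarrow> bool" where
  "vcategory V A \<longleftrightarrow>
     (\<forall>a\<in>VObj A. \<forall>b\<in>VObj A. VHom A a b \<in> Obj V) \<and>
     (\<forall>a\<in>VObj A. VId A a \<in> hom V (Unit V) (VHom A a a)) \<and>
     (\<forall>a\<in>VObj A. \<forall>b\<in>VObj A. \<forall>c\<in>VObj A.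
        VComp A a b c \<in> hom V (VHom A b c \<otimes>\<^bsub>V\<^esub> VHom A a b) (VHom A a c)) \<and>
     (\<forall>a\<in>VObj A. \<forall>b\<in>VObj A. \<forall>c\<in>VObj A. \<forall>d\<in>VObj A.
        VComp A a b d \<cdot>\<^bsub>V\<^esub> (VComp A b c d \<odot>\<^bsub>V\<^esub> Ident V (VHom A a b)) =
        VComp A a c d \<cdot>\<^bsub>V\<^esub> (Ident V (VHom A c d) \<odot>\<^bsub>V\<^esub> VComp A a b c)
          \<cdot>\<^bsub>V\<^esub> Assoc V (VHom A c d) (VHom A b c) (VHom A a b)) \<and>
     (\<forall>a\<in>VObj A. \<forall>b\<in>VObj A.
        VComp A a b b \<cdot>\<^bsub>V\<^esub> (VId A b \<odot>\<^bsub>V\<^esub> Ident V (VHom A a b)) = Lunit V (VHom A a b) \<and>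
        VComp A a a b \<cdot>\<^bsub>V\<^esub> (Ident V (VHom A a b) \<odot>\<^bsub>V\<^esub> VId A a) = Runit V (VHom A a b))"

record ('a, 'b, 'm) vfunctor =
  VFob :: "'a \<Rightarrow> 'b"
  VFar :: "'a \<Rightarrow> 'a \<Rightarrow> 'm"

definition is_vfunctor ::
  "('o, 'm, 'z) smcat_scheme \<Rightarrow> ('a, 'o, 'm) vcat \<Rightarrow> ('b, 'o, 'm) vcat \<Rightarrow>
   ('a, 'b, 'm) vfunctor \<Rightarrow> bool" where
  "is_vfunctor V A B F \<longleftrightarrow>
     (\<forall>a\<in>VObj A. VFob F a \<in> VObj B) \<and>
     (\<forall>a\<in>VObj A. \<forall>b\<in>VObj A. VFar F a b \<in> hom V (VHom A a b) (VHom B (VFob F a) (VFob F b))) \<and>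
     (\<forall>a\<in>VObj A. VFar F a a \<cdot>\<^bsub>V\<^esub> VId A a = VId B (VFob F a)) \<and>
     (\<forall>a\<in>VObj A. \<forall>b\<in>VObj A. \<forall>c\<in>VObj A.
        VFar F a c \<cdot>\<^bsub>V\<^esub> VComp A a b c =
        VComp B (VFob F a) (VFob F b) (VFob F c) \<cdot>\<^bsub>V\<^esub> (VFar F b c \<odot>\<^bsub>V\<^esub> VFar F a b))"

definition vfun_comp ::
  "('o, 'm, 'z) cat_scheme \<Rightarrow> ('b, 'c, 'm) vfunctor \<Rightarrow> ('a, 'b, 'm) vfunctor \<Rightarrow>
   ('a, 'c, 'm) vfunctor" where
  "vfun_comp V G F = \<lparr>
     VFob = (\<lambda>a. VFob G (VFob F a)),
     VFar = (\<lambda>a b. VFar G (VFob F a) (VFob F b) \<cdot>\<^bsub>V\<^esub> VFar F a b) \<rparr>"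

definition vfun_id ::
  "('o, 'm, 'z) cat_scheme \<Rightarrow> ('a, 'o, 'm) vcat \<Rightarrow> ('a, 'a, 'm) vfunctor" where
  "vfun_id V A = \<lparr> VFob = (\<lambda>a. a), VFar = (\<lambda>a b. Ident V (VHom A a b)) \<rparr>"

definition vfun_eq :: "('a, 'o, 'm) vcat \<Rightarrow> ('a, 'b, 'm) vfunctor \<Rightarrow> ('a, 'b, 'm) vfunctor \<Rightarrow> bool" where
  "vfun_eq A F G \<longleftrightarrow> (\<forall>a\<in>VObj A. VFob F a = VFob G a) \<and>
     (\<forall>a\<in>VObj A. \<forall>b\<in>VObj A. VFar F a b = VFar G a b)"

definition full_on :: "('a, 'o, 'm) vcat \<Rightarrow> 'a set \<Rightarrow> ('a, 'o, 'm) vcat" where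
  "full_on A X = A \<lparr> VObj := X \<rparr>"

subsection \<open>The slice of enriched categories over a base\<close>

definition slice_object ::
  "('o, 'm, 'z) smcat_scheme \<Rightarrow> ('b, 'o, 'm) vcat \<Rightarrow> ('a, 'o, 'm) vcat \<Rightarrow>
   ('a, 'b, 'm) vfunctor \<Rightarrow> bool" where
  "slice_object V B A U \<longleftrightarrow> vcategory V B \<and> vcategory V A \<and> is_vfunctor V A B U"

definition slice_morphism ::
  "('o, 'm, 'z) smcat_scheme \<Rightarrow> ('a, 'o, 'm) vcat \<Rightarrow> ('a, 'b, 'm) vfunctor \<Rightarrow>
   ('c, 'o, 'm) vcat \<Rightarrow> ('c, 'b, 'm) vfunctor \<Rightarrow> ('a, 'c, 'm) vfunctor \<Rightarrow> bool" where
  "slice_morphism V A U A' U' F \<longleftrightarrow> is_vfunctor V A A' F \<and> vfun_eq A (vfun_comp V U' F) U"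

definition slice_iso ::
  "('o, 'm, 'z) smcat_scheme \<Rightarrow> ('b, 'o, 'm) vcat \<Rightarrow>
   ('a, 'o, 'm) vcat \<Rightarrow> ('a, 'b, 'm) vfunctor \<Rightarrow> ('c, 'o, 'm) vcat \<Rightarrow> ('c, 'b, 'm) vfunctor \<Rightarrow>
   ('a, 'c, 'm) vfunctor \<Rightarrow> bool" where
  "slice_iso V B A U A' U' F \<longleftrightarrow> slice_object V B A U \<and> slice_object V B A' U' \<and>
     slice_morphism V A U A' U' F \<and>
     (\<exists>G. slice_morphism V A' U' A U G \<and>
        vfun_eq A (vfun_comp V G F) (vfun_id V A) \<and> vfun_eq A' (vfun_comp V F G) (vfun_id V A'))"

subsection \<open>The enriched categories \<open>V\<close> and \<open>V\<^sup>S\<close>\<close>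

definition self_vcat :: "('o, 'm, 'z) smccat_scheme \<Rightarrow> ('o, 'o, 'm) vcat" where
  "self_vcat V = \<lparr>
     VObj = Obj V,
     VHom = Ihom V,
     VId = (\<lambda>X. adjunct V (Unit V) X X (Lunit V X)),
     VComp = (\<lambda>X Y Z. adjunct V (Ihom V Y Z \<otimes>\<^bsub>V\<^esub> Ihom V X Y) X Z
        (Eval V Y Z \<cdot>\<^bsub>V\<^esub> (Ident V (Ihom V Y Z) \<odot>\<^bsub>V\<^esub> Eval V X Y)
           \<cdot>\<^bsub>V\<^esub> Assoc V (Ihom V Y Z) (Ihom V X Y) X)) \<rparr>"

definition pow_hom :: "('o, 'm, 'z) smccat_scheme \<Rightarrow> 's set \<Rightarrow> ('s \<Rightarrow> 'o) \<Rightarrow> ('s \<Rightarrow> 'o) \<Rightarrow> 'o" where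
  "pow_hom V S X Y = prod_obj V S (\<lambda>s. Ihom V (X s) (Y s))"

definition pow_proj ::
  "('o, 'm, 'z) smccat_scheme \<Rightarrow> 's set \<Rightarrow> ('s \<Rightarrow> 'o) \<Rightarrow> ('s \<Rightarrow> 'o) \<Rightarrow> 's \<Rightarrow> 'm" where
  "pow_proj V S X Y = prod_proj V S (\<lambda>s. Ihom V (X s) (Y s))"

definition into_pow_hom ::
  "('o, 'm, 'z) smccat_scheme \<Rightarrow> 's set \<Rightarrow> ('s \<Rightarrow> 'o) \<Rightarrow> ('s \<Rightarrow> 'o) \<Rightarrow> 'o \<Rightarrow> ('s \<Rightarrow> 'm) \<Rightarrow> 'm" where
  "into_pow_hom V S X Y Z f = tuple V S (\<lambda>s. Ihom V (X s) (Y s)) Z f"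

definition pow_vcat :: "('o, 'm, 'z) smccat_scheme \<Rightarrow> 's set \<Rightarrow> ('s \<Rightarrow> 'o, 'o, 'm) vcat" where
  "pow_vcat V S = \<lparr>
     VObj = S \<rightarrow>\<^sub>E Obj V,
     VHom = pow_hom V S,
     VId = (\<lambda>X. into_pow_hom V S X X (Unit V) (\<lambda>s. VId (self_vcat V) (X s))),
     VComp = (\<lambda>X Y Z. into_pow_hom V S X Z (pow_hom V S Y Z \<otimes>\<^bsub>V\<^esub> pow_hom V S X Y)
        (\<lambda>s. VComp (self_vcat V) (X s) (Y s) (Z s)
               \<cdot>\<^bsub>V\<^esub> (pow_proj V S Y Z s \<odot>\<^bsub>V\<^esub> pow_proj V S X Y s))) \<rparr>"

definition pow_arrows ::
  "('o, 'm, 'z) cat_scheme \<Rightarrow> 's set \<Rightarrow> ('s \<Rightarrow> 'o) \<Rightarrow> ('s \<Rightarrow> 'o) \<Rightarrow> ('s \<Rightarrow> 'm) set" where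
  "pow_arrows V S X Y = (\<Pi>\<^sub>E s\<in>S. hom V (X s) (Y s))"

text \<open>Composition \<open>V\<^sup>S(X, Y) \<rightarrow> V\<^sup>S(X, Z)\<close> with \<open>g : Y \<rightarrow> Z\<close> and precomposition
  \<open>V\<^sup>S(Y, Z) \<rightarrow> V\<^sup>S(X, Z)\<close> with \<open>f : X \<rightarrow> Y\<close>.\<close>

definition pow_post ::
  "('o, 'm, 'z) smccat_scheme \<Rightarrow> 's set \<Rightarrow> ('s \<Rightarrow> 'o) \<Rightarrow> ('s \<Rightarrow> 'o) \<Rightarrow> ('s \<Rightarrow> 'o) \<Rightarrow> ('s \<Rightarrow> 'm) \<Rightarrow> 'm" where
  "pow_post V S X Y Z g =
     into_pow_hom V S X Z (pow_hom V S X Y) (\<lambda>s. post V (X s) (g s) \<cdot>\<^bsub>V\<^esub> pow_proj V S X Y s)"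

definition pow_pre ::
  "('o, 'm, 'z) smccat_scheme \<Rightarrow> 's set \<Rightarrow> ('s \<Rightarrow> 'o) \<Rightarrow> ('s \<Rightarrow> 'o) \<Rightarrow> ('s \<Rightarrow> 'o) \<Rightarrow> ('s \<Rightarrow> 'm) \<Rightarrow> 'm" where
  "pow_pre V S X Y Z f =
     into_pow_hom V S X Z (pow_hom V S Y Z) (\<lambda>s. pre V (f s) (Z s) \<cdot>\<^bsub>V\<^esub> pow_proj V S Y Z s)"

text \<open>Enriched natural transformations between enriched functors \<open>A \<rightarrow> V\<^sup>S\<close>.\<close>

definition pow_vnatural ::
  "('o, 'm, 'z) smccat_scheme \<Rightarrow> 's set \<Rightarrow> ('a, 'o, 'm) vcat \<Rightarrow>
   ('a, 's \<Rightarrow> 'o, 'm) vfunctor \<Rightarrow> ('a, 's \<Rightarrow> 'o, 'm) vfunctor \<Rightarrow> ('a \<Rightarrow> 's \<Rightarrow> 'm) \<Rightarrow> bool" where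
  "pow_vnatural V S A F G \<eta> \<longleftrightarrow>
     \<eta> \<in> (\<Pi>\<^sub>E a\<in>VObj A. pow_arrows V S (VFob F a) (VFob G a)) \<and>
     (\<forall>a\<in>VObj A. \<forall>b\<in>VObj A.
        pow_post V S (VFob F a) (VFob F b) (VFob G b) (\<eta> b) \<cdot>\<^bsub>V\<^esub> VFar F a b =
        pow_pre V S (VFob F a) (VFob G a) (VFob G b) (\<eta> a) \<cdot>\<^bsub>V\<^esub> VFar G a b)"

text \<open>Given objects \<open>E a b\<close> with monomorphisms \<open>e a b\<close> into \<open>B(F a, F b)\<close>, the enriched category
  with hom-objects \<open>E a b\<close> whose identities and composition are inherited from \<open>B\<close>, so that
  \<open>F\<close> and \<open>e\<close> form an enriched functor to \<open>B\<close>.\<close>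

definition induced_vcat ::
  "('o, 'm, 'z) smcat_scheme \<Rightarrow> ('b, 'o, 'm) vcat \<Rightarrow> 'a set \<Rightarrow> ('a \<Rightarrow> 'b) \<Rightarrow>
   ('a \<Rightarrow> 'a \<Rightarrow> 'o) \<Rightarrow> ('a \<Rightarrow> 'a \<Rightarrow> 'm) \<Rightarrow> ('a, 'o, 'm) vcat" where
  "induced_vcat V B A F E e = \<lparr>
     VObj = A,
     VHom = E,
     VId = (\<lambda>a. THE i. i \<in> hom V (Unit V) (E a a) \<and> e a a \<cdot>\<^bsub>V\<^esub> i = VId B (F a)),
     VComp = (\<lambda>a b c. THE h. h \<in> hom V (E b c \<otimes>\<^bsub>V\<^esub> E a b) (E a c) \<and>
        e a c \<cdot>\<^bsub>V\<^esub> h = VComp B (F a) (F b) (F c) \<cdot>\<^bsub>V\<^esub> (e b c \<odot>\<^bsub>V\<^esub> e a b)) \<rparr>"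

subsection \<open>The enriched functors occurring in signatures\<close>

text \<open>\<open>P \<otimes> - : V \<rightarrow> V\<close>.\<close>

definition ltensor_vfun :: "('o, 'm, 'z) smccat_scheme \<Rightarrow> 'o \<Rightarrow> ('o, 'o, 'm) vfunctor" where
  "ltensor_vfun V P = \<lparr>
     VFob = (\<lambda>X. P \<otimes>\<^bsub>V\<^esub> X),
     VFar = (\<lambda>X Y. adjunct V (Ihom V X Y) (P \<otimes>\<^bsub>V\<^esub> X) (P \<otimes>\<^bsub>V\<^esub> Y)
        ((Ident V P \<odot>\<^bsub>V\<^esub> Eval V X Y) \<cdot>\<^bsub>V\<^esub> Assoc V P (Ihom V X Y) X
           \<cdot>\<^bsub>V\<^esub> (Swap V (Ihom V X Y) P \<odot>\<^bsub>V\<^esub> Ident V X)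
           \<cdot>\<^bsub>V\<^esub> inv_arr V (Assoc V (Ihom V X Y) P X))) \<rparr>"

text \<open>\<open>A \<mapsto> A\<^bsub>S1\<^esub> \<times> \<dots> \<times> A\<^bsub>Sn\<^esub> : V\<^sup>S \<rightarrow> V\<close> for a list of sorts.\<close>

definition sorts_power :: "('o, 'm, 'z) cat_scheme \<Rightarrow> 's list \<Rightarrow> ('s \<Rightarrow> 'o) \<Rightarrow> 'o" where
  "sorts_power V ss A = prod_obj V {..<length ss} (\<lambda>i. A (ss ! i))"

definition sorts_proj :: "('o, 'm, 'z) cat_scheme \<Rightarrow> 's list \<Rightarrow> ('s \<Rightarrow> 'o) \<Rightarrow> nat \<Rightarrow> 'm" where
  "sorts_proj V ss A = prod_proj V {..<length ss} (\<lambda>i. A (ss ! i))"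

definition into_sorts_power ::
  "('o, 'm, 'z) cat_scheme \<Rightarrow> 's list \<Rightarrow> ('s \<Rightarrow> 'o) \<Rightarrow> 'o \<Rightarrow> (nat \<Rightarrow> 'm) \<Rightarrow> 'm" where
  "into_sorts_power V ss A Z f = tuple V {..<length ss} (\<lambda>i. A (ss ! i)) Z f"

definition sorts_power_vfun ::
  "('o, 'm, 'z) smccat_scheme \<Rightarrow> 's set \<Rightarrow> 's list \<Rightarrow> ('s \<Rightarrow> 'o, 'o, 'm) vfunctor" where
  "sorts_power_vfun V S ss = \<lparr>
     VFob = sorts_power V ss,
     VFar = (\<lambda>A B. adjunct V (pow_hom V S A B) (sorts_power V ss A) (sorts_power V ss B)
        (into_sorts_power V ss B (pow_hom V S A B \<otimes>\<^bsub>V\<^esub> sorts_power V ss A)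
           (\<lambda>i. Eval V (A (ss ! i)) (B (ss ! i))
                  \<cdot>\<^bsub>V\<^esub> (pow_proj V S A B (ss ! i) \<odot>\<^bsub>V\<^esub> sorts_proj V ss A i)))) \<rparr>"

text \<open>The representable \<open>B(J, -) : B \<rightarrow> V\<close>.\<close>

definition rep_vfun ::
  "('o, 'm, 'z) smccat_scheme \<Rightarrow> ('b, 'o, 'm) vcat \<Rightarrow> 'b \<Rightarrow> ('b, 'o, 'm) vfunctor" where
  "rep_vfun V B J = \<lparr>
     VFob = VHom B J,
     VFar = (\<lambda>X Y. adjunct V (VHom B X Y) (VHom B J X) (VHom B J Y) (VComp B J X Y)) \<rparr>"

text \<open>\<open>- \<otimes> P : V \<rightarrow> V\<^sup>S\<close> for \<open>P\<close> in \<open>V\<^sup>S\<close>.\<close>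

definition rtensor_vfun ::
  "('o, 'm, 'z) smccat_scheme \<Rightarrow> 's set \<Rightarrow> ('s \<Rightarrow> 'o) \<Rightarrow> ('o, 's \<Rightarrow> 'o, 'm) vfunctor" where
  "rtensor_vfun V S P = \<lparr>
     VFob = (\<lambda>X. \<lambda>s\<in>S. X \<otimes>\<^bsub>V\<^esub> P s),
     VFar = (\<lambda>X Y. into_pow_hom V S (\<lambda>s\<in>S. X \<otimes>\<^bsub>V\<^esub> P s) (\<lambda>s\<in>S. Y \<otimes>\<^bsub>V\<^esub> P s) (Ihom V X Y)
        (\<lambda>s. adjunct V (Ihom V X Y) (X \<otimes>\<^bsub>V\<^esub> P s) (Y \<otimes>\<^bsub>V\<^esub> P s)
           ((Eval V X Y \<odot>\<^bsub>V\<^esub> Ident V (P s)) \<cdot>\<^bsub>V\<^esub> inv_arr V (Assoc V (Ihom V X Y) X (P s))))) \<rparr>"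

section \<open>Enriched multi-sorted equational theories\<close>

text \<open>Sorts and operation symbols are elements of the universe.\<close>

record ('u, 'o) signature =
  Syms :: "'u set"
  Ins :: "'u \<Rightarrow> 'u list"
  Out :: "'u \<Rightarrow> 'u"
  Par :: "'u \<Rightarrow> 'o"

definition op_type ::
  "('o, 'm, 'z) cat_scheme \<Rightarrow> 'u set \<Rightarrow> 'u list \<Rightarrow> 'u \<Rightarrow> 'o \<Rightarrow> bool" where
  "op_type V S ss s P \<longleftrightarrow> set ss \<subseteq> S \<and> s \<in> S \<and> P \<in> Obj V"

definition is_signature ::
  "('o, 'm, 'z) cat_scheme \<Rightarrow> 'u::set_universe set \<Rightarrow> ('u, 'o) signature \<Rightarrow> bool" where
  "is_signature V S Sg \<longleftrightarrow> small (Syms Sg) \<and>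
     (\<forall>\<sigma>\<in>Syms Sg. op_type V S (Ins Sg \<sigma>) (Out Sg \<sigma>) (Par Sg \<sigma>))"

text \<open>The enriched functor \<open>A \<mapsto> P \<otimes> (A\<^bsub>S1\<^esub> \<times> \<dots> \<times> A\<^bsub>Sn\<^esub>)\<close>.\<close>

definition arg_vfun ::
  "('o, 'm, 'z) smccat_scheme \<Rightarrow> 's set \<Rightarrow> 's list \<Rightarrow> 'o \<Rightarrow> ('s \<Rightarrow> 'o, 'o, 'm) vfunctor" where
  "arg_vfun V S ss P = vfun_comp V (ltensor_vfun V P) (sorts_power_vfun V S ss)"

text \<open>An algebra is a pair of its carrier and its family of operations.\<close>

type_synonym ('u, 'o, 'm) alg = "('u \<Rightarrow> 'o) \<times> ('u \<Rightarrow> 'm)"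

definition algebras ::
  "('o, 'm, 'z) smccat_scheme \<Rightarrow> 'u set \<Rightarrow> ('u, 'o) signature \<Rightarrow> ('u, 'o, 'm) alg set" where
  "algebras V S Sg = {(A, a). A \<in> S \<rightarrow>\<^sub>E Obj V \<and>
     a \<in> (\<Pi>\<^sub>E \<sigma>\<in>Syms Sg. hom V (Par Sg \<sigma> \<otimes>\<^bsub>V\<^esub> sorts_power V (Ins Sg \<sigma>) A) (A (Out Sg \<sigma>)))}"

text \<open>\<open>1\<^sub>P \<otimes> (f\<^bsub>S1\<^esub> \<times> \<dots> \<times> f\<^bsub>Sn\<^esub>)\<close>.\<close>

definition arg_arrow ::
  "('o, 'm, 'z) smcat_scheme \<Rightarrow> 's list \<Rightarrow> 'o \<Rightarrow> ('s \<Rightarrow> 'o) \<Rightarrow> ('s \<Rightarrow> 'o) \<Rightarrow> ('s \<Rightarrow> 'm) \<Rightarrow> 'm" where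
  "arg_arrow V ss P A B f = Ident V P \<odot>\<^bsub>V\<^esub>
     into_sorts_power V ss B (sorts_power V ss A) (\<lambda>i. f (ss ! i) \<cdot>\<^bsub>V\<^esub> sorts_proj V ss A i)"

definition algebra_arrows ::
  "('o, 'm, 'z) smccat_scheme \<Rightarrow> 'u set \<Rightarrow> ('u, 'o) signature \<Rightarrow>
   ('u, 'o, 'm) alg \<Rightarrow> ('u, 'o, 'm) alg \<Rightarrow> ('u \<Rightarrow> 'm) set" where
  "algebra_arrows V S Sg A B = {f \<in> pow_arrows V S (fst A) (fst B). \<forall>\<sigma>\<in>Syms Sg.
     f (Out Sg \<sigma>) \<cdot>\<^bsub>V\<^esub> snd A \<sigma> =
     snd B \<sigma> \<cdot>\<^bsub>V\<^esub> arg_arrow V (Ins Sg \<sigma>) (Par Sg \<sigma>) (fst A) (fst B) f}"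

definition algebra_equalizer ::
  "('o, 'm, 'z) smccat_scheme \<Rightarrow> 'u set \<Rightarrow> ('u, 'o) signature \<Rightarrow>
   ('u, 'o, 'm) alg \<Rightarrow> ('u, 'o, 'm) alg \<Rightarrow> 'o \<times> 'm" where
  "algebra_equalizer V S Sg A B =
     joint_equalizer V (pow_hom V S (fst A) (fst B)) (Syms Sg)
       (\<lambda>\<sigma>. post V (Par Sg \<sigma> \<otimes>\<^bsub>V\<^esub> sorts_power V (Ins Sg \<sigma>) (fst A)) (snd B \<sigma>)
              \<cdot>\<^bsub>V\<^esub> VFar (arg_vfun V S (Ins Sg \<sigma>) (Par Sg \<sigma>)) (fst A) (fst B))
       (\<lambda>\<sigma>. pre V (snd A \<sigma>) (fst B (Out Sg \<sigma>))
              \<cdot>\<^bsub>V\<^esub> pow_proj V S (fst A) (fst B) (Out Sg \<sigma>))"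

definition Alg_vcat ::
  "('o, 'm, 'z) smccat_scheme \<Rightarrow> 'u set \<Rightarrow> ('u, 'o) signature \<Rightarrow>
   (('u, 'o, 'm) alg, 'o, 'm) vcat" where
  "Alg_vcat V S Sg = induced_vcat V (pow_vcat V S) (algebras V S Sg) fst
     (\<lambda>A B. fst (algebra_equalizer V S Sg A B)) (\<lambda>A B. snd (algebra_equalizer V S Sg A B))"

definition Alg_forget ::
  "('o, 'm, 'z) smccat_scheme \<Rightarrow> 'u set \<Rightarrow> ('u, 'o) signature \<Rightarrow>
   (('u, 'o, 'm) alg, 'u \<Rightarrow> 'o, 'm) vfunctor" where
  "Alg_forget V S Sg = \<lparr> VFob = fst, VFar = (\<lambda>A B. snd (algebra_equalizer V S Sg A B)) \<rparr>"

definition algebraic_operation ::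
  "('o, 'm, 'z) smccat_scheme \<Rightarrow> 'u set \<Rightarrow> ('u, 'o) signature \<Rightarrow>
   'u list \<Rightarrow> 'u \<Rightarrow> 'o \<Rightarrow> (('u, 'o, 'm) alg \<Rightarrow> 'm) \<Rightarrow> bool" where
  "algebraic_operation V S Sg ss s P \<omega> \<longleftrightarrow>
     \<omega> \<in> (\<Pi>\<^sub>E A\<in>algebras V S Sg. hom V (P \<otimes>\<^bsub>V\<^esub> sorts_power V ss (fst A)) (fst A s)) \<and>
     (\<forall>A\<in>algebras V S Sg. \<forall>B\<in>algebras V S Sg. \<forall>f\<in>algebra_arrows V S Sg A B.
        f s \<cdot>\<^bsub>V\<^esub> \<omega> A = \<omega> B \<cdot>\<^bsub>V\<^esub> arg_arrow V ss P (fst A) (fst B) f)"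

text \<open>Equations are pairs of parallel families of arrows indexed by algebras, both for algebraic and
  for diagrammatic equations.\<close>

definition algebraic_equation ::
  "('o, 'm, 'z) smccat_scheme \<Rightarrow> 'u set \<Rightarrow> ('u, 'o) signature \<Rightarrow>
   (('u, 'o, 'm) alg \<Rightarrow> 'm) \<times> (('u, 'o, 'm) alg \<Rightarrow> 'm) \<Rightarrow> bool" where
  "algebraic_equation V S Sg eq \<longleftrightarrow> (\<exists>ss s P. op_type V S ss s P \<and>
     algebraic_operation V S Sg ss s P (fst eq) \<and> algebraic_operation V S Sg ss s P (snd eq))"

definition satisfies :: "'a \<Rightarrow> ('a \<Rightarrow> 'b) \<times> ('a \<Rightarrow> 'b) \<Rightarrow> bool" where
  "satisfies A eq \<longleftrightarrow> fst eq A = snd eq A"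

type_synonym ('u, 'o, 'm) equational_theory =
  "('u, 'o) signature \<times> ((('u, 'o, 'm) alg \<Rightarrow> 'm) \<times> (('u, 'o, 'm) alg \<Rightarrow> 'm)) set"

definition is_equational_theory ::
  "('o, 'm, 'z) smccat_scheme \<Rightarrow> 'u::set_universe set \<Rightarrow> ('u, 'o, 'm) equational_theory \<Rightarrow> bool" where
  "is_equational_theory V S T \<longleftrightarrow> is_signature V S (fst T) \<and>
     small_collection TYPE('u) (snd T) \<and> (\<forall>eq\<in>snd T. algebraic_equation V S (fst T) eq)"

definition Theory_Alg_vcat ::
  "('o, 'm, 'z) smccat_scheme \<Rightarrow> 'u set \<Rightarrow> ('u, 'o, 'm) equational_theory \<Rightarrow>
   (('u, 'o, 'm) alg, 'o, 'm) vcat" where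
  "Theory_Alg_vcat V S T = full_on (Alg_vcat V S (fst T))
     {A \<in> algebras V S (fst T). \<forall>eq\<in>snd T. satisfies A eq}"

section \<open>Diagrammatic presentations\<close>

definition finitary_arities :: "('o, 'm, 'z) smccat_scheme \<Rightarrow> 's set \<Rightarrow> ('s \<Rightarrow> 'o) set" where
  "finitary_arities V S =
     {\<lambda>s\<in>S. copower V (n s) (Unit V) | n :: 's \<Rightarrow> nat. finite {s \<in> S. n s \<noteq> 0}}"

record ('u, 'o) ff_signature =
  FSyms :: "'u set"
  FArity :: "'u \<Rightarrow> 'u \<Rightarrow> 'o"
  FPar :: "'u \<Rightarrow> 'u \<Rightarrow> 'o"

definition is_ff_signature ::
  "('o, 'm, 'z) smccat_scheme \<Rightarrow> 'u::set_universe set \<Rightarrow> ('u, 'o) ff_signature \<Rightarrow> bool" where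
  "is_ff_signature V S Sg \<longleftrightarrow> small (FSyms Sg) \<and>
     (\<forall>\<sigma>\<in>FSyms Sg. FArity Sg \<sigma> \<in> finitary_arities V S \<and> FPar Sg \<sigma> \<in> S \<rightarrow>\<^sub>E Obj V)"

text \<open>The enriched functor \<open>V\<^sup>S(J, -) \<otimes> P : V\<^sup>S \<rightarrow> V\<^sup>S\<close>.\<close>

definition ff_arg_vfun ::
  "('o, 'm, 'z) smccat_scheme \<Rightarrow> 's set \<Rightarrow> ('s \<Rightarrow> 'o) \<Rightarrow> ('s \<Rightarrow> 'o) \<Rightarrow>
   ('s \<Rightarrow> 'o, 's \<Rightarrow> 'o, 'm) vfunctor" where
  "ff_arg_vfun V S J P = vfun_comp V (rtensor_vfun V S P) (rep_vfun V (pow_vcat V S) J)"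

type_synonym ('u, 'o, 'm) ff_alg = "('u \<Rightarrow> 'o) \<times> ('u \<Rightarrow> 'u \<Rightarrow> 'm)"

definition ff_algebras ::
  "('o, 'm, 'z) smccat_scheme \<Rightarrow> 'u set \<Rightarrow> ('u, 'o) ff_signature \<Rightarrow> ('u, 'o, 'm) ff_alg set" where
  "ff_algebras V S Sg = {(A, a). A \<in> S \<rightarrow>\<^sub>E Obj V \<and>
     a \<in> (\<Pi>\<^sub>E \<sigma>\<in>FSyms Sg. pow_arrows V S (VFob (ff_arg_vfun V S (FArity Sg \<sigma>) (FPar Sg \<sigma>)) A) A)}"

definition ff_algebra_equalizer ::
  "('o, 'm, 'z) smccat_scheme \<Rightarrow> 'u set \<Rightarrow> ('u, 'o) ff_signature \<Rightarrow>
   ('u, 'o, 'm) ff_alg \<Rightarrow> ('u, 'o, 'm) ff_alg \<Rightarrow> 'o \<times> 'm" where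
  "ff_algebra_equalizer V S Sg A B =
     joint_equalizer V (pow_hom V S (fst A) (fst B)) (FSyms Sg)
       (\<lambda>\<sigma>. let T = ff_arg_vfun V S (FArity Sg \<sigma>) (FPar Sg \<sigma>) in
          pow_post V S (VFob T (fst A)) (VFob T (fst B)) (fst B) (snd B \<sigma>)
            \<cdot>\<^bsub>V\<^esub> VFar T (fst A) (fst B))
       (\<lambda>\<sigma>. let T = ff_arg_vfun V S (FArity Sg \<sigma>) (FPar Sg \<sigma>) in
          pow_pre V S (VFob T (fst A)) (fst A) (fst B) (snd A \<sigma>))"

definition ff_Alg_vcat ::
  "('o, 'm, 'z) smccat_scheme \<Rightarrow> 'u set \<Rightarrow> ('u, 'o) ff_signature \<Rightarrow>
   (('u, 'o, 'm) ff_alg, 'o, 'm) vcat" where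
  "ff_Alg_vcat V S Sg = induced_vcat V (pow_vcat V S) (ff_algebras V S Sg) fst
     (\<lambda>A B. fst (ff_algebra_equalizer V S Sg A B)) (\<lambda>A B. snd (ff_algebra_equalizer V S Sg A B))"

definition ff_Alg_forget ::
  "('o, 'm, 'z) smccat_scheme \<Rightarrow> 'u set \<Rightarrow> ('u, 'o) ff_signature \<Rightarrow>
   (('u, 'o, 'm) ff_alg, 'u \<Rightarrow> 'o, 'm) vfunctor" where
  "ff_Alg_forget V S Sg = \<lparr> VFob = fst, VFar = (\<lambda>A B. snd (ff_algebra_equalizer V S Sg A B)) \<rparr>"

definition natural_operation ::
  "('o, 'm, 'z) smccat_scheme \<Rightarrow> 'u set \<Rightarrow> ('u, 'o) ff_signature \<Rightarrow>
   ('u \<Rightarrow> 'o) \<Rightarrow> ('u \<Rightarrow> 'o) \<Rightarrow> (('u, 'o, 'm) ff_alg \<Rightarrow> 'u \<Rightarrow> 'm) \<Rightarrow> bool" where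
  "natural_operation V S Sg J P \<omega> \<longleftrightarrow>
     pow_vnatural V S (ff_Alg_vcat V S Sg)
       (vfun_comp V (ff_arg_vfun V S J P) (ff_Alg_forget V S Sg)) (ff_Alg_forget V S Sg) \<omega>"

definition diagrammatic_equation ::
  "('o, 'm, 'z) smccat_scheme \<Rightarrow> 'u set \<Rightarrow> ('u, 'o) ff_signature \<Rightarrow>
   (('u, 'o, 'm) ff_alg \<Rightarrow> 'u \<Rightarrow> 'm) \<times> (('u, 'o, 'm) ff_alg \<Rightarrow> 'u \<Rightarrow> 'm) \<Rightarrow> bool" where
  "diagrammatic_equation V S Sg eq \<longleftrightarrow> (\<exists>J\<in>finitary_arities V S. \<exists>P\<in>S \<rightarrow>\<^sub>E Obj V.
     natural_operation V S Sg J P (fst eq) \<and> natural_operation V S Sg J P (snd eq))"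

type_synonym ('u, 'o, 'm) presentation =
  "('u, 'o) ff_signature \<times>
   ((('u, 'o, 'm) ff_alg \<Rightarrow> 'u \<Rightarrow> 'm) \<times> (('u, 'o, 'm) ff_alg \<Rightarrow> 'u \<Rightarrow> 'm)) set"

definition is_presentation ::
  "('o, 'm, 'z) smccat_scheme \<Rightarrow> 'u::set_universe set \<Rightarrow> ('u, 'o, 'm) presentation \<Rightarrow> bool" where
  "is_presentation V S T \<longleftrightarrow> is_ff_signature V S (fst T) \<and>
     small_collection TYPE('u) (snd T) \<and> (\<forall>eq\<in>snd T. diagrammatic_equation V S (fst T) eq)"

definition Pres_Alg_vcat ::
  "('o, 'm, 'z) smccat_scheme \<Rightarrow> 'u set \<Rightarrow> ('u, 'o, 'm) presentation \<Rightarrow>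
   (('u, 'o, 'm) ff_alg, 'o, 'm) vcat" where
  "Pres_Alg_vcat V S T = full_on (ff_Alg_vcat V S (fst T))
     {A \<in> ff_algebras V S (fst T). \<forall>eq\<in>snd T. satisfies A eq}"

end

theory Submission
  imports Defs
begin

text \<open>Since \<open>|-|\<close> is faithful, strict monoidal and represented by \<open>I\<close>, arrows of \<open>V\<close>, elements of
  internal homs and elements of products are determined by their action on elements, and every
  enriched axiom becomes a pointwise identity. An operation with input sorts \<open>S\<^sub>1, \<dots>, S\<^sub>n\<close>, output
  sort \<open>S\<close> and parameter \<open>P\<close> is turned into a free-form operation whose arity \<open>J\<close> has at each sort as
  many copies of \<open>I\<close> as that sort has occurrences among the inputs, and whose parameter is \<open>P\<close> at \<open>S\<close>
  and initial elsewhere. Then \<open>V\<^sup>S(J, A)\<close> is isomorphic to \<open>A\<^bsub>S1\<^esub> \<times> \<dots> \<times> A\<^bsub>Sn\<^esub>\<close>, naturally in \<open>A\<close>, so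
  structures on \<open>A\<close> of the two kinds correspond. Corresponding hom-objects are joint equalizers that
  consist of the same elements of \<open>V\<^sup>S(A, B)\<close>, hence isomorphic over it.\<close>

section \<open>Small sets\<close>

text \<open>The two notions of operation differ in strength: an algebraic operation is natural for
  ordinary homomorphisms only, while a natural operation satisfies an equation between arrows out of
  the hom-objects. The gap closes because an element of a hom-object of algebras is the same as an
  ordinary homomorphism, so the enriched equation can be tested at one homomorphism at a time.
  Limits and copowers of \<open>I\<close> are arbitrary choices, and nothing is known about their
  underlying sets beyond the universal property; their elements are reached as arrows out of
  \<open>I\<close>. A bijection on elements is not an isomorphism in \<open>V\<close>, so the
  inverse of the comparison with V^S(J, A) has to be built as an arrow, from the closed structure.
  Hom-objects need no such care: equalizers carry the structure induced from V^S(A, B), hence are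
  determined over it, up to isomorphism, by their elements. The initial parameter works because
  tensoring with an object has a right adjoint and so preserves the initial object.\<close>

lemma small_subset: "small B \<Longrightarrow> A \<subseteq> B \<Longrightarrow> small A"
  unfolding small_def using elts_subset by blast

lemma small_image: "small A \<Longrightarrow> small (f ` A)"
  for A :: "'u::set_universe set" and f :: "'u \<Rightarrow> 'u"
  unfolding small_def using elts_replacement by blast

lemma elts_as_element: "small A \<Longrightarrow> elts (as_element A) = A"
  unfolding small_def as_element_def by (metis (mono_tags, lifting) elts_ext rangeE theI)

lemma as_element_inject: "small A \<Longrightarrow> small B \<Longrightarrow> as_element A = as_element B \<longleftrightarrow> A = B"
  by (metis elts_as_element)

lemma small_UN:
  fixes A :: "'u::set_universe set" and B :: "'u \<Rightarrow> 'u set"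
  assumes "small A" "\<And>x. x \<in> A \<Longrightarrow> small (B x)"
  shows "small (\<Union>x\<in>A. B x)"
proof -
  have "small (\<Union> (elts ` (\<lambda>x. as_element (B x)) ` A))"
    using elts_Union[of "(\<lambda>x. as_element (B x)) ` A"]
      small_image[OF assms(1), of "\<lambda>x. as_element (B x)"] unfolding small_def by simp
  then show ?thesis
    using assms(2) by (simp add: image_image elts_as_element)
qed

lemma small_powerset: "small A \<Longrightarrow> small {y. elts y \<subseteq> A}"
  unfolding small_def using elts_Pow by auto

lemma small_empty: "small ({} :: 'u::set_universe set)"
  using small_subset[OF _ empty_subsetI] unfolding small_def by blast

text \<open>Pairing is not an axiom of \<open>set_universe\<close>; the range of a constant sequence
  is small by \<open>elts_infinity\<close>.\<close>

lemma small_singleton: "small {a :: 'u::set_universe}"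
proof -
  have "small (range (\<lambda>n::nat. a))"
    unfolding small_def by (rule elts_infinity)
  then show ?thesis
    by simp
qed

lemma small_doubleton: "small {a, b :: 'u::set_universe}"
proof -
  define z :: "'u \<Rightarrow> 'u" where "z x = (if x = as_element {} then a else b)" for x
  have ne: "as_element {as_element {}} \<noteq> (as_element {} :: 'u)"
    by (simp add: as_element_inject small_empty small_singleton)
  have "small (range (\<lambda>n::nat. if n = 0 then as_element {} else as_element {as_element {}}) :: 'u set)"
    unfolding small_def by (rule elts_infinity)
  then have "small (z ` range (\<lambda>n::nat. if n = 0 then as_element {} else as_element {as_element {}}))"
    by (rule small_image)
  moreover have "z ` range (\<lambda>n::nat. if n = 0 then as_element {} else as_element {as_element {}}) = {a, b}"
    using ne unfolding z_def by (auto simp: image_iff intro: exI[of _ "0::nat"] exI[of _ "1::nat"])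
  ultimately show ?thesis
    by simp
qed

lemma kpair_inject [simp]: "kpair a b = kpair c d \<longleftrightarrow> a = c \<and> b = d"
  unfolding kpair_def
  by (auto simp: as_element_inject small_singleton small_doubleton doubleton_eq_iff)

lemma kfst_kpair [simp]: "kfst (kpair a b) = a" and ksnd_kpair [simp]: "ksnd (kpair a b) = b"
  unfolding kfst_def ksnd_def by auto

lemma kpair_in_cartesian [simp]: "kpair a b \<in> cartesian A B \<longleftrightarrow> a \<in> A \<and> b \<in> B"
  unfolding cartesian_def by auto

lemma cartesianE:
  assumes "t \<in> cartesian A B"
  obtains a b where "t = kpair a b" "a \<in> A" "b \<in> B"
  using assms unfolding cartesian_def by auto

lemma small_cartesian:
  assumes "small A" "small B"
  shows "small (cartesian A B)"
proof -
  have "cartesian A B = (\<Union>a\<in>A. kpair a ` B)"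
    unfolding cartesian_def by auto
  then show ?thesis
    using assms by (simp add: small_UN small_image)
qed

text \<open>Zermelo numerals: iterated singletons of the empty set. They move index sets of natural
  numbers, such as positions in a list, into the universe.\<close>

lemma ex_small_indexing: "\<exists>c :: nat \<Rightarrow> 'u::set_universe. inj c \<and> (\<forall>N. small (c ` N))"
proof -
  define c :: "nat \<Rightarrow> 'u" where "c = rec_nat (as_element {}) (\<lambda>_ x. as_element {x})"
  have c0: "c 0 = as_element {}" and cS: "c (Suc n) = as_element {c n}" for n
    unfolding c_def by simp_all
  have "c m = c n \<longleftrightarrow> m = n" for m n
  proof (induction m arbitrary: n)
    case 0
    show ?case
      by (cases n) (simp_all add: c0 cS as_element_inject small_empty small_singleton)
  next
    case (Suc m)
    show ?case
      by (cases n) (simp_all add: c0 cS as_element_inject small_empty small_singleton Suc)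
  qed
  then have "inj c"
    by (auto intro: injI)
  moreover have "small (c ` N)" for N
    using elts_infinity[of c] small_subset[of "range c" "c ` N"] unfolding small_def by blast
  ultimately show ?thesis
    by blast
qed

section \<open>Arrows of V as functions\<close>

locale topological_smcc =
  fixes V :: "('o, 'm) smccat" (structure)
    and U :: "('o, 'm, 'u::set_universe) setfunctor"
  assumes smcc: "symmetric_monoidal_closed V"
    and top: "topological V U"
    and strict: "strict_symmetric_monoidal V Set_cat U"
    and repr: "represented_by V U (Unit V)"
begin

abbreviation el :: "'o \<Rightarrow> 'u set" where "el \<equiv> Fob U"

definition app :: "'m \<Rightarrow> 'u \<Rightarrow> 'u" where "app f = fst (snd (Far U f))"

abbreviation star :: 'u where "star \<equiv> as_element {}"

lemma sm: "symmetric_monoidal V"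
  using smcc unfolding symmetric_monoidal_closed_def by blast

lemma cat: "category V"
  using sm unfolding symmetric_monoidal_def by blast

lemma func: "is_functor V Set_cat U"
  using strict unfolding strict_symmetric_monoidal_def by blast

lemma hom_Obj: "f \<in> hom V X Y \<Longrightarrow> X \<in> Obj V \<and> Y \<in> Obj V"
  using cat unfolding category_def hom_def by blast

lemma arr_hom: "f \<in> Arr V \<Longrightarrow> f \<in> hom V (Dom V f) (Cod V f)"
  unfolding hom_def by simp

lemma hom_Arr: "f \<in> hom V X Y \<Longrightarrow> f \<in> Arr V \<and> Dom V f = X \<and> Cod V f = Y"
  unfolding hom_def by simp

lemma Ident_hom [intro, simp]: "X \<in> Obj V \<Longrightarrow> Ident V X \<in> hom V X X"
  using cat unfolding category_def by blast

lemma comp_hom [intro]: "g \<in> hom V Y Z \<Longrightarrow> f \<in> hom V X Y \<Longrightarrow> g \<cdot> f \<in> hom V X Z"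
  using cat hom_Obj unfolding category_def by metis

lemma comp_assoc:
  "h \<in> hom V Y Z \<Longrightarrow> g \<in> hom V X Y \<Longrightarrow> f \<in> hom V W X \<Longrightarrow> h \<cdot> g \<cdot> f = h \<cdot> (g \<cdot> f)"
  using cat hom_Obj unfolding category_def by metis

lemma comp_Ident: "f \<in> hom V X Y \<Longrightarrow> f \<cdot> Ident V X = f"
  and Ident_comp: "f \<in> hom V X Y \<Longrightarrow> Ident V Y \<cdot> f = f"
  using cat hom_Obj unfolding category_def by metis+

lemma small_el: "X \<in> Obj V \<Longrightarrow> small (el X)"
  using func unfolding is_functor_def Set_cat_def by simp

lemma Far_hom:
  assumes "f \<in> hom V X Y"
  shows "Far U f = (el X, app f, el Y)" and "app f \<in> el X \<rightarrow>\<^sub>E el Y"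
proof -
  have "Far U f \<in> hom Set_cat (el X) (el Y)"
    using func assms hom_Obj[OF assms] unfolding is_functor_def by blast
  then show "Far U f = (el X, app f, el Y)" "app f \<in> el X \<rightarrow>\<^sub>E el Y"
    unfolding hom_def Set_cat_def app_def by auto
qed

lemma app_in [intro]: "f \<in> hom V X Y \<Longrightarrow> x \<in> el X \<Longrightarrow> app f x \<in> el Y"
  using Far_hom(2) by blast

text \<open>Faithfulness, applied to functions stored extensionally. Equations between arrows are
  reduced to equations between values by this rule.\<close>

lemma arr_eqI:
  assumes "f \<in> hom V X Y" "g \<in> hom V X Y" "\<And>x. x \<in> el X \<Longrightarrow> app f x = app g x"
  shows "f = g"
proof -
  have "app f = app g"
    using Far_hom(2)[OF assms(1)] Far_hom(2)[OF assms(2)] assms(3) by (rule PiE_ext)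
  then have "Far U f = Far U g"
    using Far_hom(1)[OF assms(1)] Far_hom(1)[OF assms(2)] by simp
  moreover have "inj_on (Far U) (hom V X Y)"
    using top hom_Obj[OF assms(1)] unfolding topological_def concrete_def faithful_def by blast
  ultimately show ?thesis
    using assms(1,2) by (auto dest: inj_onD)
qed

lemma app_Ident [simp]: "X \<in> Obj V \<Longrightarrow> x \<in> el X \<Longrightarrow> app (Ident V X) x = x"
  using func unfolding is_functor_def app_def Set_cat_def by simp

lemma app_comp: "g \<in> hom V Y Z \<Longrightarrow> f \<in> hom V X Y \<Longrightarrow> x \<in> el X \<Longrightarrow> app (g \<cdot> f) x = app g (app f x)"
proof -
  assume f: "f \<in> hom V X Y" and g: "g \<in> hom V Y Z" and x: "x \<in> el X"
  have "Far U (g \<cdot> f) = Comp Set_cat (Far U g) (Far U f)"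
    using func f g hom_Obj[OF f] hom_Obj[OF g] unfolding is_functor_def by blast
  then show ?thesis
    using x unfolding app_def[of "g \<cdot> f"] Far_hom(1)[OF f] Far_hom(1)[OF g]
    by (simp add: Set_cat_def compose_def)
qed

text \<open>Initial lifts restated for bare functions and \<open>app\<close>. This keeps the triples
  of \<open>Set_cat\<close> out of the construction of products, equalizers and copowers.\<close>

lemma initial_lift_ex:
  assumes "small A" and G: "\<And>Z g. (Z, g) \<in> G \<Longrightarrow> Z \<in> Obj V \<and> g \<in> A \<rightarrow> el Z"
  obtains X where "X \<in> Obj V" "el X = A"
    "\<And>Z g. (Z, g) \<in> G \<Longrightarrow> \<exists>m\<in>hom V X Z. \<forall>x\<in>A. app m x = g x"
    "\<And>W f. W \<in> Obj V \<Longrightarrow> f \<in> el W \<rightarrow> A \<Longrightarrow>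
       (\<And>Z g. (Z, g) \<in> G \<Longrightarrow> \<exists>m\<in>hom V W Z. \<forall>x\<in>el W. app m x = g (f x)) \<Longrightarrow>
       \<exists>m\<in>hom V W X. \<forall>x\<in>el W. app m x = f x"
proof -
  define G' where "G' = (\<lambda>(Z, g). (Z, (A, restrict g A, el Z))) ` G"
  have "structured_source V U A G'"
    unfolding structured_source_def G'_def using G assms(1) small_el
    by (fastforce simp: hom_def Set_cat_def)
  then obtain X where X: "initial_lift V U A G' X"
    using top assms(1) unfolding topological_def by blast
  have XO: "X \<in> Obj V" and elX: "el X = A"
    and lift': "\<forall>p\<in>G'. admissible V U X (fst p) (snd p)"
    and initial': "\<forall>W\<in>Obj V. \<forall>f\<in>hom Set_cat (el W) A.
      admissible V U W X f \<longleftrightarrow> (\<forall>p\<in>G'. admissible V U W (fst p) (Comp Set_cat (snd p) f))"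
    using X unfolding initial_lift_def split_beta by blast+
  have lift: "admissible V U X Z g" if "(Z, g) \<in> G'" for Z g
    using bspec[OF lift' that] by simp
  have initial: "admissible V U W X f" if "W \<in> Obj V" "f \<in> hom Set_cat (el W) A"
    "\<And>Z g. (Z, g) \<in> G' \<Longrightarrow> admissible V U W Z (Comp Set_cat g f)" for W f
    using bspec[OF bspec[OF initial' that(1)] that(2)] that(3) by (metis prod.collapse)
  have 1: "\<exists>m\<in>hom V X Z. \<forall>x\<in>A. app m x = g x" if "(Z, g) \<in> G" for Z g
  proof -
    have "(Z, (A, restrict g A, el Z)) \<in> G'"
      unfolding G'_def by (rule rev_image_eqI[OF that]) simp
    then obtain m where "m \<in> hom V X Z" "Far U m = (A, restrict g A, el Z)"
      using lift unfolding admissible_def by blast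
    then show ?thesis
      unfolding app_def by (intro bexI[of _ m]) auto
  qed
  have 2: "\<exists>m\<in>hom V W X. \<forall>x\<in>el W. app m x = f x"
    if W: "W \<in> Obj V" and f: "f \<in> el W \<rightarrow> A"
      and c: "\<And>Z g. (Z, g) \<in> G \<Longrightarrow> \<exists>m\<in>hom V W Z. \<forall>x\<in>el W. app m x = g (f x)" for W f
  proof -
    let ?f = "(el W, restrict f (el W), A)"
    have fh: "?f \<in> hom Set_cat (el W) A"
      using f small_el[OF W] assms(1) by (simp add: hom_def Set_cat_def)
    have "admissible V U W Z (Comp Set_cat g ?f)" if g: "(Z, g) \<in> G'" for Z g
    proof -
      obtain g0 where g0: "(Z, g0) \<in> G" "g = (A, restrict g0 A, el Z)"
        using g unfolding G'_def by (elim imageE) (simp split: prod.splits)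
      obtain m where m: "m \<in> hom V W Z" "\<forall>x\<in>el W. app m x = g0 (f x)"
        using c[OF g0(1)] by blast
      \<comment> \<open>Arrows of \<open>Set_cat\<close> are equal only if their functions agree
        everywhere; off \<open>el W\<close> both sides are \<open>undefined\<close>.\<close>
      have "app m x = compose (el W) (restrict g0 A) (restrict f (el W)) x" for x
      proof (cases "x \<in> el W")
        case True
        moreover have "f x \<in> A"
          using f True by blast
        ultimately show ?thesis
          using m(2) by (simp add: compose_def)
      next
        case False
        then show ?thesis
          using PiE_arb[OF Far_hom(2)[OF m(1)]] by (simp add: compose_def)
      qed
      then have "app m = compose (el W) (restrict g0 A) (restrict f (el W))"
        by blast
      then have "Far U m = Comp Set_cat g ?f"
        using Far_hom(1)[OF m(1)] g0(2) by (simp add: Set_cat_def)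
      then show ?thesis
        using m(1) unfolding admissible_def by blast
    qed
    then have "admissible V U W X ?f"
      by (rule initial[OF W fh])
    then show ?thesis
      unfolding admissible_def app_def by (metis fst_conv snd_conv restrict_apply')
  qed
  show ?thesis
    by (rule that[OF XO elX 1 2])
qed

section \<open>The monoidal structure on elements\<close>

lemma el_Unit: "el (Unit V) = {star}"
  using strict unfolding strict_symmetric_monoidal_def Set_cat_def by simp

lemma
  assumes "X \<in> Obj V" "Y \<in> Obj V"
  shows tensor_Obj [simp, intro]: "X \<otimes> Y \<in> Obj V"
    and Swap_hom [intro]: "Swap V X Y \<in> hom V (X \<otimes> Y) (Y \<otimes> X)"
  using sm assms unfolding symmetric_monoidal_def by - (elim conjE, simp)+

lemma
  assumes "X \<in> Obj V"
  shows Lunit_hom [intro]: "Lunit V X \<in> hom V (Unit V \<otimes> X) X"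
    and Runit_hom [intro]: "Runit V X \<in> hom V (X \<otimes> Unit V) X"
  using sm assms unfolding symmetric_monoidal_def by - (elim conjE, simp)+

lemma
  assumes "X \<in> Obj V" "Y \<in> Obj V" "Z \<in> Obj V"
  shows Assoc_hom [intro]: "Assoc V X Y Z \<in> hom V ((X \<otimes> Y) \<otimes> Z) (X \<otimes> (Y \<otimes> Z))"
    and is_iso_Assoc: "is_iso V (Assoc V X Y Z)"
  using sm assms unfolding symmetric_monoidal_def by - (elim conjE, simp)+

lemma Unit_Obj [simp]: "Unit V \<in> Obj V"
  using sm unfolding symmetric_monoidal_def by - (elim conjE, simp)

text \<open>Yoneda: the representing bijection sends \<open>m\<close> to the value of
  \<open>m\<close> at the image of the identity of \<open>I\<close>, and that image is
  \<open>star\<close>, the only element of |I|. Surjectivity of the bijection then gives the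
  arrow.\<close>

lemma pt_ex:
  assumes X: "X \<in> Obj V" and x: "x \<in> el X"
  shows "\<exists>m\<in>hom V (Unit V) X. app m star = x"
proof -
  obtain \<phi> where b: "\<And>X. X \<in> Obj V \<Longrightarrow> bij_betw (\<phi> X) (hom V (Unit V) X) (el X)"
    and n: "\<And>X Y h f. X \<in> Obj V \<Longrightarrow> Y \<in> Obj V \<Longrightarrow> h \<in> hom V X Y \<Longrightarrow> f \<in> hom V (Unit V) X \<Longrightarrow>
      \<phi> Y (h \<cdot> f) = app h (\<phi> X f)"
    using repr unfolding represented_by_def app_def by blast
  have s: "\<phi> (Unit V) (Ident V (Unit V)) = star"
    using b[OF Unit_Obj] el_Unit by (metis Ident_hom Unit_Obj bij_betwE singletonD)
  obtain m where m: "m \<in> hom V (Unit V) X" "\<phi> X m = x"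
    using b[OF X] x by (metis bij_betw_imp_surj_on imageE)
  have "app m star = x"
    using n[OF Unit_Obj X m(1) Ident_hom[OF Unit_Obj]] s m by (simp add: comp_Ident)
  then show ?thesis
    using m(1) by blast
qed

lemma tensor_hom [intro]:
  assumes "f \<in> hom V X Y" "g \<in> hom V X' Y'"
  shows "f \<odot> g \<in> hom V (X \<otimes> X') (Y \<otimes> Y')"
proof -
  have "\<forall>f\<in>Arr V. \<forall>g\<in>Arr V. f \<odot> g \<in> hom V (Dom V f \<otimes> Dom V g) (Cod V f \<otimes> Cod V g)"
    using sm unfolding symmetric_monoidal_def by - (elim conjE)
  then show ?thesis
    using hom_Arr[OF assms(1)] hom_Arr[OF assms(2)] by blast
qed

lemma el_tensor [simp]: "X \<in> Obj V \<Longrightarrow> Y \<in> Obj V \<Longrightarrow> el (X \<otimes> Y) = cartesian (el X) (el Y)"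
  using strict unfolding strict_symmetric_monoidal_def Set_cat_def by simp

lemma app_tensor:
  assumes "f \<in> hom V X Y" "g \<in> hom V X' Y'" "x \<in> el X" "x' \<in> el X'"
  shows "app (f \<odot> g) (kpair x x') = kpair (app f x) (app g x')"
proof -
  have "Far U (f \<odot> g) = Tar Set_cat (Far U f) (Far U g)"
    using strict hom_Arr[OF assms(1)] hom_Arr[OF assms(2)]
    unfolding strict_symmetric_monoidal_def by blast
  then show ?thesis
    using assms(3,4) unfolding app_def[of "f \<odot> g"] Far_hom(1)[OF assms(1)] Far_hom(1)[OF assms(2)]
    by (simp add: Set_cat_def)
qed

lemma app_Assoc:
  "X \<in> Obj V \<Longrightarrow> Y \<in> Obj V \<Longrightarrow> Z \<in> Obj V \<Longrightarrow> x \<in> el X \<Longrightarrow> y \<in> el Y \<Longrightarrow> z \<in> el Z \<Longrightarrow>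
   app (Assoc V X Y Z) (kpair (kpair x y) z) = kpair x (kpair y z)"
  using strict unfolding strict_symmetric_monoidal_def app_def by (simp add: Set_cat_def)

lemma app_Swap:
  "X \<in> Obj V \<Longrightarrow> Y \<in> Obj V \<Longrightarrow> x \<in> el X \<Longrightarrow> y \<in> el Y \<Longrightarrow> app (Swap V X Y) (kpair x y) = kpair y x"
  using strict unfolding strict_symmetric_monoidal_def app_def by (simp add: Set_cat_def)

lemma app_Lunit: "X \<in> Obj V \<Longrightarrow> x \<in> el X \<Longrightarrow> app (Lunit V X) (kpair star x) = x"
  and app_Runit: "X \<in> Obj V \<Longrightarrow> x \<in> el X \<Longrightarrow> app (Runit V X) (kpair x star) = x"
  using strict unfolding strict_symmetric_monoidal_def app_def by (simp_all add: Set_cat_def)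

lemma inverse_arrows_inv_arr:
  assumes "is_iso V f"
  shows "inverse_arrows V f (inv_arr V f)"
proof -
  obtain g where g: "inverse_arrows V f g"
    using assms unfolding is_iso_def by blast
  have "h = g" if h: "inverse_arrows V f h" for h
  proof -
    have f: "f \<in> hom V (Dom V f) (Cod V f)" and gh: "g \<in> hom V (Cod V f) (Dom V f)"
      "h \<in> hom V (Cod V f) (Dom V f)"
      using g h arr_hom unfolding inverse_arrows_def by auto
    have "h = h \<cdot> (f \<cdot> g)"
      using g comp_Ident[OF gh(2)] unfolding inverse_arrows_def by simp
    also have "\<dots> = h \<cdot> f \<cdot> g"
      using comp_assoc[OF gh(2) f gh(1)] by simp
    also have "\<dots> = g"
      using h Ident_comp[OF gh(1)] unfolding inverse_arrows_def by simp
    finally show ?thesis .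
  qed
  then show ?thesis
    unfolding inv_arr_def using g by (metis theI)
qed

lemma Assoc_inverse_arrows:
  assumes "X \<in> Obj V" "Y \<in> Obj V" "Z \<in> Obj V"
  shows "inverse_arrows V (Assoc V X Y Z) (inv_arr V (Assoc V X Y Z))"
  using assms by (intro inverse_arrows_inv_arr is_iso_Assoc)

lemma inv_Assoc_hom [intro]:
  assumes "X \<in> Obj V" "Y \<in> Obj V" "Z \<in> Obj V"
  shows "inv_arr V (Assoc V X Y Z) \<in> hom V (X \<otimes> (Y \<otimes> Z)) ((X \<otimes> Y) \<otimes> Z)"
  using Assoc_inverse_arrows[OF assms] hom_Arr[OF Assoc_hom[OF assms]]
  unfolding inverse_arrows_def by simp

text \<open>Strictness fixes the action of \<open>Assoc\<close> but not of its inverse; the latter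
  follows from their composite being an identity.\<close>

lemma app_inv_Assoc:
  assumes O: "X \<in> Obj V" "Y \<in> Obj V" "Z \<in> Obj V" and e: "x \<in> el X" "y \<in> el Y" "z \<in> el Z"
  shows "app (inv_arr V (Assoc V X Y Z)) (kpair x (kpair y z)) = kpair (kpair x y) z"
proof -
  have "inv_arr V (Assoc V X Y Z) \<cdot> Assoc V X Y Z = Ident V ((X \<otimes> Y) \<otimes> Z)"
    using Assoc_inverse_arrows[OF O] hom_Arr[OF Assoc_hom[OF O]] unfolding inverse_arrows_def by simp
  from arg_cong[OF this, of "\<lambda>h. app h (kpair (kpair x y) z)"] show ?thesis
    using O e by (simp add: app_comp[OF inv_Assoc_hom[OF O] Assoc_hom[OF O]] app_Assoc)
qed

text \<open>With these rules the simplifier types composite arrows by computing domains and codomains, and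
  evaluates them on elements.\<close>

lemma hom_iff: "f \<in> hom V X Y \<longleftrightarrow> f \<in> Arr V \<and> Dom V f = X \<and> Cod V f = Y"
  unfolding hom_def by simp

lemma
  assumes "X \<in> Obj V"
  shows Ident_typing: "Ident V X \<in> Arr V" "Dom V (Ident V X) = X" "Cod V (Ident V X) = X"
    and Lunit_typing: "Lunit V X \<in> Arr V" "Dom V (Lunit V X) = Unit V \<otimes> X" "Cod V (Lunit V X) = X"
    and Runit_typing: "Runit V X \<in> Arr V" "Dom V (Runit V X) = X \<otimes> Unit V" "Cod V (Runit V X) = X"
  using Ident_hom[OF assms] Lunit_hom[OF assms] Runit_hom[OF assms] by (simp_all add: hom_iff)

lemma
  assumes "f \<in> Arr V" "g \<in> Arr V"
  shows comp_typing: "Dom V g = Cod V f \<Longrightarrow> g \<cdot> f \<in> Arr V"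
      "Dom V g = Cod V f \<Longrightarrow> Dom V (g \<cdot> f) = Dom V f" "Dom V g = Cod V f \<Longrightarrow> Cod V (g \<cdot> f) = Cod V g"
    and tensor_typing: "f \<odot> g \<in> Arr V" "Dom V (f \<odot> g) = Dom V f \<otimes> Dom V g"
      "Cod V (f \<odot> g) = Cod V f \<otimes> Cod V g"
  using comp_hom[of g "Cod V f" "Cod V g" f "Dom V f"]
    tensor_hom[OF arr_hom[OF assms(1)] arr_hom[OF assms(2)]] assms by (simp_all add: hom_iff)

lemma
  assumes "X \<in> Obj V" "Y \<in> Obj V"
  shows Swap_typing: "Swap V X Y \<in> Arr V" "Dom V (Swap V X Y) = X \<otimes> Y" "Cod V (Swap V X Y) = Y \<otimes> X"
  using Swap_hom[OF assms] by (simp_all add: hom_iff)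

lemma
  assumes "X \<in> Obj V" "Y \<in> Obj V" "Z \<in> Obj V"
  shows Assoc_typing: "Assoc V X Y Z \<in> Arr V" "Dom V (Assoc V X Y Z) = (X \<otimes> Y) \<otimes> Z"
      "Cod V (Assoc V X Y Z) = X \<otimes> (Y \<otimes> Z)"
    and inv_Assoc_typing: "inv_arr V (Assoc V X Y Z) \<in> Arr V"
      "Dom V (inv_arr V (Assoc V X Y Z)) = X \<otimes> (Y \<otimes> Z)"
      "Cod V (inv_arr V (Assoc V X Y Z)) = (X \<otimes> Y) \<otimes> Z"
  using Assoc_hom[OF assms] inv_Assoc_hom[OF assms] by (simp_all add: hom_iff)

lemma app_closed: "f \<in> Arr V \<Longrightarrow> Cod V f = Y \<Longrightarrow> x \<in> el (Dom V f) \<Longrightarrow> app f x \<in> el Y"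
  using app_in[OF arr_hom] by blast

lemma app_comp': "f \<in> Arr V \<Longrightarrow> g \<in> Arr V \<Longrightarrow> Dom V g = Cod V f \<Longrightarrow> x \<in> el (Dom V f) \<Longrightarrow>
    app (g \<cdot> f) x = app g (app f x)"
  by (rule app_comp) (auto simp: hom_iff)

lemma app_tensor': "f \<in> Arr V \<Longrightarrow> g \<in> Arr V \<Longrightarrow> x \<in> el (Dom V f) \<Longrightarrow> y \<in> el (Dom V g) \<Longrightarrow>
    app (f \<odot> g) (kpair x y) = kpair (app f x) (app g y)"
  by (rule app_tensor[OF arr_hom arr_hom])

lemmas arr_simps = hom_iff Ident_typing Lunit_typing Runit_typing comp_typing tensor_typing
  Swap_typing Assoc_typing inv_Assoc_typing app_closed app_comp' app_tensor' app_Assoc app_inv_Assoc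
  app_Swap app_Lunit app_Runit

section \<open>Internal homs\<close>

definition ev :: "'o \<Rightarrow> 'o \<Rightarrow> 'u \<Rightarrow> 'u \<Rightarrow> 'u" where
  "ev X Y u x = app (Eval V X Y) (kpair u x)"

lemma
  assumes "X \<in> Obj V" "Y \<in> Obj V"
  shows Ihom_Obj [simp, intro]: "Ihom V X Y \<in> Obj V"
    and Eval_hom [intro]: "Eval V X Y \<in> hom V (Ihom V X Y \<otimes> X) Y"
  using smcc assms unfolding symmetric_monoidal_closed_def by blast+

lemma
  assumes "X \<in> Obj V" "Y \<in> Obj V"
  shows Eval_typing: "Eval V X Y \<in> Arr V" "Dom V (Eval V X Y) = Ihom V X Y \<otimes> X" "Cod V (Eval V X Y) = Y"
  using Eval_hom[OF assms] by (simp_all add: hom_iff)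

lemma adjunct_ex1:
  assumes "X \<in> Obj V" "Y \<in> Obj V" "Z \<in> Obj V" "f \<in> hom V (Z \<otimes> X) Y"
  shows "\<exists>!g. g \<in> hom V Z (Ihom V X Y) \<and> Eval V X Y \<cdot> (g \<odot> Ident V X) = f"
  using smcc assms unfolding symmetric_monoidal_closed_def by blast

lemma adjunct:
  assumes "X \<in> Obj V" "Z \<in> Obj V" "f \<in> hom V (Z \<otimes> X) Y"
  shows adjunct_hom: "adjunct V Z X Y f \<in> hom V Z (Ihom V X Y)"
    and Eval_adjunct: "Eval V X Y \<cdot> (adjunct V Z X Y f \<odot> Ident V X) = f"
  using theI'[OF adjunct_ex1[OF assms(1) _ assms(2,3)]] hom_Obj[OF assms(3)]
  unfolding adjunct_def by blast+

lemma ev_in [intro]: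
  "X \<in> Obj V \<Longrightarrow> Y \<in> Obj V \<Longrightarrow> u \<in> el (Ihom V X Y) \<Longrightarrow> x \<in> el X \<Longrightarrow> ev X Y u x \<in> el Y"
  unfolding ev_def by (rule app_in[OF Eval_hom]) auto

lemma ev_adjunct:
  assumes X: "X \<in> Obj V" and Z: "Z \<in> Obj V" and f: "f \<in> hom V (Z \<otimes> X) Y"
    and z: "z \<in> el Z" and x: "x \<in> el X"
  shows "ev X Y (app (adjunct V Z X Y f) z) x = app f (kpair z x)"
proof -
  have Y: "Y \<in> Obj V"
    using hom_Obj[OF f] by simp
  have "app f (kpair z x) = app (Eval V X Y \<cdot> (adjunct V Z X Y f \<odot> Ident V X)) (kpair z x)"
    using Eval_adjunct[OF X Z f] by simp
  also have "\<dots> = ev X Y (app (adjunct V Z X Y f) z) x"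
    using X Y Z z x adjunct_hom[OF X Z f]
    by (simp add: arr_simps Eval_typing ev_def)
  finally show ?thesis
    by simp
qed

text \<open>By \<open>pt_ex\<close> an element is a point I -> [X, Y]. Its transpose I \<otimes> X
  -> Y has the values \<open>ev X Y u x\<close>, and a point is determined by its transpose.\<close>

lemma Ihom_eqI:
  assumes X: "X \<in> Obj V" and Y: "Y \<in> Obj V"
    and u: "u \<in> el (Ihom V X Y)" and v: "v \<in> el (Ihom V X Y)"
    and eq: "\<And>x. x \<in> el X \<Longrightarrow> ev X Y u x = ev X Y v x"
  shows "u = v"
proof -
  obtain p where p: "p \<in> hom V (Unit V) (Ihom V X Y)" "app p star = u"
    using pt_ex[OF Ihom_Obj[OF X Y] u] by blast
  obtain q where q: "q \<in> hom V (Unit V) (Ihom V X Y)" "app q star = v"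
    using pt_ex[OF Ihom_Obj[OF X Y] v] by blast
  have h: "Eval V X Y \<cdot> (r \<odot> Ident V X) \<in> hom V (Unit V \<otimes> X) Y"
    if "r \<in> hom V (Unit V) (Ihom V X Y)" for r
    using that X Y by blast
  have "Eval V X Y \<cdot> (p \<odot> Ident V X) = Eval V X Y \<cdot> (q \<odot> Ident V X)"
  proof (rule arr_eqI[OF h[OF p(1)] h[OF q(1)]])
    fix t assume "t \<in> el (Unit V \<otimes> X)"
    then obtain x where t: "t = kpair star x" "x \<in> el X"
      using X by (auto simp: el_Unit elim: cartesianE)
    have *: "app (Eval V X Y \<cdot> (r \<odot> Ident V X)) t = ev X Y (app r star) x"
      if "r \<in> hom V (Unit V) (Ihom V X Y)" for r
      using that t X Y el_Unit
      by (simp add: arr_simps Eval_typing ev_def)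
    show "app (Eval V X Y \<cdot> (p \<odot> Ident V X)) t = app (Eval V X Y \<cdot> (q \<odot> Ident V X)) t"
      using *[OF p(1)] *[OF q(1)] p(2) q(2) eq[OF t(2)] by simp
  qed
  then have "p = q"
    using adjunct_ex1[OF X Y Unit_Obj h[OF q(1)]] p(1) q(1) by blast
  then show ?thesis
    using p q by simp
qed

text \<open>The arrow is the transpose of the point naming \<open>u\<close>, composed with the
  inverse of the left unitor. With \<open>elem_of_arr\<close>, elements of [X, Y] and arrows X -> Y
  become interchangeable, which is how elements of hom-objects turn into homomorphisms.\<close>

lemma arr_of_elem:
  assumes X: "X \<in> Obj V" and Y: "Y \<in> Obj V" and u: "u \<in> el (Ihom V X Y)"
  shows "\<exists>m\<in>hom V X Y. \<forall>x\<in>el X. app m x = ev X Y u x"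
proof -
  obtain p where p: "p \<in> hom V (Unit V) (Ihom V X Y)" "app p star = u"
    using pt_ex[OF Ihom_Obj[OF X Y] u] by blast
  have "is_iso V (Lunit V X)"
    using sm X unfolding symmetric_monoidal_def by - (elim conjE, simp)
  then obtain l where l: "l \<in> hom V X (Unit V \<otimes> X)" "Lunit V X \<cdot> l = Ident V X"
    using hom_Arr[OF Lunit_hom[OF X]] unfolding is_iso_def inverse_arrows_def by auto
  \<comment> \<open>Only the action of \<open>Lunit\<close> is given. A value of its inverse is a
    pair with first entry \<open>star\<close>, and applying \<open>Lunit\<close> recovers the second
    entry.\<close>
  have lx: "app l x = kpair star x" if x: "x \<in> el X" for x
  proof -
    obtain x' where x': "app l x = kpair star x'" "x' \<in> el X"
      using app_in[OF l(1) x] X by (auto simp: el_Unit elim: cartesianE)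
    have "x = app (Lunit V X \<cdot> l) x"
      using l(2) X x by simp
    also have "\<dots> = x'"
      using X x x' by (simp add: app_comp[OF Lunit_hom l(1)] app_Lunit)
    finally show ?thesis
      using x' by simp
  qed
  have 1: "p \<odot> Ident V X \<in> hom V (Unit V \<otimes> X) (Ihom V X Y \<otimes> X)"
    using p X by blast
  have "app (Eval V X Y \<cdot> ((p \<odot> Ident V X) \<cdot> l)) x = ev X Y u x" if "x \<in> el X" for x
    using that X Y p l(1) el_Unit
    by (simp add: arr_simps Eval_typing lx ev_def)
  then show ?thesis
    using comp_hom[OF Eval_hom[OF X Y] comp_hom[OF 1 l(1)]] by blast
qed

lemma elem_of_arr:
  assumes m: "m \<in> hom V X Y"
  shows "\<exists>u\<in>el (Ihom V X Y). \<forall>x\<in>el X. ev X Y u x = app m x"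
proof -
  have X: "X \<in> Obj V"
    using hom_Obj[OF m] by simp
  have h: "m \<cdot> Lunit V X \<in> hom V (Unit V \<otimes> X) Y"
    using m X by blast
  show ?thesis
  proof (intro bexI ballI)
    show "app (adjunct V (Unit V) X Y (m \<cdot> Lunit V X)) star \<in> el (Ihom V X Y)"
      by (rule app_in[OF adjunct_hom[OF X Unit_Obj h]]) (simp add: el_Unit)
    fix x assume x: "x \<in> el X"
    show "ev X Y (app (adjunct V (Unit V) X Y (m \<cdot> Lunit V X)) star) x = app m x"
      using X x el_Unit
      by (simp add: ev_adjunct[OF X Unit_Obj h] app_comp[OF m Lunit_hom] app_Lunit)
  qed
qed

section \<open>Composition and precomposition on elements\<close>

lemma post_hom: "X \<in> Obj V \<Longrightarrow> g \<in> hom V Y Z \<Longrightarrow> post V X g \<in> hom V (Ihom V X Y) (Ihom V X Z)"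
  using hom_Obj[of g Y Z] hom_Arr[of g Y Z] unfolding post_def by (auto intro!: adjunct_hom)

lemma ev_post:
  assumes "X \<in> Obj V" "g \<in> hom V Y Z" "u \<in> el (Ihom V X Y)" "x \<in> el X"
  shows "ev X Z (app (post V X g) u) x = app g (ev X Y u x)"
proof -
  have Y: "Y \<in> Obj V"
    using hom_Obj[OF assms(2)] by simp
  have "ev X Z (app (adjunct V (Ihom V X Y) X Z (g \<cdot> Eval V X Y)) u) x = app (g \<cdot> Eval V X Y) (kpair u x)"
    using assms Y by (intro ev_adjunct) (simp_all add: arr_simps Eval_typing)
  then show ?thesis
    using assms Y by (simp add: arr_simps Eval_typing post_def ev_def)
qed

lemma pre_hom: "Z \<in> Obj V \<Longrightarrow> f \<in> hom V X Y \<Longrightarrow> pre V f Z \<in> hom V (Ihom V Y Z) (Ihom V X Z)"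
  using hom_Obj[of f X Y] hom_Arr[of f X Y] unfolding pre_def
  by (auto intro!: adjunct_hom comp_hom[OF Eval_hom] tensor_hom)

lemma ev_pre:
  assumes "Z \<in> Obj V" "f \<in> hom V X Y" "u \<in> el (Ihom V Y Z)" "x \<in> el X"
  shows "ev X Z (app (pre V f Z) u) x = ev Y Z u (app f x)"
proof -
  have X: "X \<in> Obj V" and Y: "Y \<in> Obj V"
    using hom_Obj[OF assms(2)] by simp_all
  have "ev X Z (app (adjunct V (Ihom V Y Z) X Z (Eval V Y Z \<cdot> (Ident V (Ihom V Y Z) \<odot> f))) u) x =
      app (Eval V Y Z \<cdot> (Ident V (Ihom V Y Z) \<odot> f)) (kpair u x)"
    using assms X Y by (intro ev_adjunct) (simp_all add: arr_simps Eval_typing)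
  then show ?thesis
    using assms X Y by (simp add: arr_simps Eval_typing pre_def ev_def)
qed

section \<open>Products, equalizers and copowers of the unit\<close>

text \<open>The set of choice functions gets the initial structure along the projections. Choice
  functions are HOL functions and not elements of the universe, so each is coded by its graph, a
  small set of pairs whose indices are moved into the universe by \<open>c\<close>.\<close>

lemma is_product_ex:
  fixes K :: "'k set"
  assumes K: "small_collection TYPE('u) K" and X: "\<And>k. k \<in> K \<Longrightarrow> X k \<in> Obj V"
  shows "\<exists>P p. is_product V K X P p"
proof -
  obtain L :: "'u set" and d where L: "small L" "K = d ` L"
    using K unfolding small_collection_def by blast
  define c where "c = inv_into L d"
  have c: "inj_on c K" and cK: "small (c ` K)"
    using L inj_on_inv_into[of K d L] small_subset[of L "c ` K"] inv_into_into[of _ d L]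
    unfolding c_def by auto
  define code where "code f = as_element ((\<lambda>k. kpair (c k) (f k)) ` K)" for f
  define A where "A = code ` (\<Pi>\<^sub>E k\<in>K. el (X k))"
  \<comment> \<open>All values of choice functions lie in \<open>T\<close>, so every code is a
    subset of the product of the image of \<open>c\<close> with \<open>T\<close>, and a power set
    bounds the collection of codes.\<close>
  define T where "T = (\<Union>l\<in>c ` K. el (X (inv_into K c l)))"
  have "small T"
    unfolding T_def using cK X c by (intro small_UN small_el) auto
  have gr: "(\<lambda>k. kpair (c k) (f k)) ` K \<subseteq> cartesian (c ` K) T"
    if "f \<in> (\<Pi>\<^sub>E k\<in>K. el (X k))" for f
    using that c unfolding T_def by fastforce
  have elts_code: "elts (code f) = (\<lambda>k. kpair (c k) (f k)) ` K" if "f \<in> (\<Pi>\<^sub>E k\<in>K. el (X k))" for f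
    unfolding code_def
    by (rule elts_as_element[OF small_subset[OF small_cartesian[OF cK \<open>small T\<close>] gr[OF that]]])
  have "small A"
  proof (rule small_subset[OF small_powerset[OF small_cartesian[OF cK \<open>small T\<close>]]])
    show "A \<subseteq> {y. elts y \<subseteq> cartesian (c ` K) T}"
      unfolding A_def by (intro subsetI, elim imageE) (simp only: elts_code mem_Collect_eq gr)
  qed
  define proj where "proj k t = (THE v. kpair (c k) v \<in> elts t)" for k t
  have proj: "proj k (code f) = f k" if "k \<in> K" "f \<in> (\<Pi>\<^sub>E k\<in>K. el (X k))" for k f
    unfolding proj_def elts_code[OF that(2)] using c that(1)
    by (intro the_equality) (auto dest: inj_onD)
  have projA: "proj k x \<in> el (X k)" if "k \<in> K" "x \<in> A" for k x
    using that proj unfolding A_def by auto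
  have A_eqI: "x = y" if xy: "x \<in> A" "y \<in> A" "\<And>k. k \<in> K \<Longrightarrow> proj k x = proj k y" for x y
  proof -
    obtain f g where f: "x = code f" "f \<in> (\<Pi>\<^sub>E k\<in>K. el (X k))"
      and g: "y = code g" "g \<in> (\<Pi>\<^sub>E k\<in>K. el (X k))"
      using xy(1,2) unfolding A_def by blast
    have "f = g"
      using f(2) g(2) by (rule PiE_ext) (use xy(3) f g proj in force)
    then show ?thesis
      using f g by simp
  qed
  obtain P where P: "P \<in> Obj V" "el P = A"
    and lift: "\<And>Z g. (Z, g) \<in> (\<lambda>k. (X k, proj k)) ` K \<Longrightarrow> \<exists>m\<in>hom V P Z. \<forall>x\<in>A. app m x = g x"
    and initial: "\<And>W f. W \<in> Obj V \<Longrightarrow> f \<in> el W \<rightarrow> A \<Longrightarrow>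
       (\<And>Z g. (Z, g) \<in> (\<lambda>k. (X k, proj k)) ` K \<Longrightarrow>
          \<exists>m\<in>hom V W Z. \<forall>x\<in>el W. app m x = g (f x)) \<Longrightarrow>
       \<exists>m\<in>hom V W P. \<forall>x\<in>el W. app m x = f x"
    by (rule initial_lift_ex[OF \<open>small A\<close>, of "(\<lambda>k. (X k, proj k)) ` K"]) (use X projA in auto)
  have "\<exists>m\<in>hom V P (X k). \<forall>x\<in>A. app m x = proj k x" if "k \<in> K" for k
    using that by (intro lift) blast
  then obtain p where p: "\<And>k. k \<in> K \<Longrightarrow> p k \<in> hom V P (X k)"
    and pp: "\<And>k x. k \<in> K \<Longrightarrow> x \<in> A \<Longrightarrow> app (p k) x = proj k x"
    by metis
  have "\<exists>!h. h \<in> hom V Z P \<and> (\<forall>k\<in>K. p k \<cdot> h = f k)"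
    if Z: "Z \<in> Obj V" and f: "\<forall>k\<in>K. f k \<in> hom V Z (X k)" for Z f
  proof (rule ex_ex1I)
    let ?h = "\<lambda>z. code (\<lambda>k\<in>K. app (f k) z)"
    have fz: "(\<lambda>k\<in>K. app (f k) z) \<in> (\<Pi>\<^sub>E k\<in>K. el (X k))" if "z \<in> el Z" for z
      using that f by auto
    have hA: "?h \<in> el Z \<rightarrow> A"
      using fz unfolding A_def by blast
    have "\<exists>m\<in>hom V Z P. \<forall>x\<in>el Z. app m x = ?h x"
    proof (rule initial[OF Z hA])
      fix Y g assume "(Y, g) \<in> (\<lambda>k. (X k, proj k)) ` K"
      then obtain k where k: "k \<in> K" "Y = X k" "g = proj k"
        by blast
      show "\<exists>m\<in>hom V Z Y. \<forall>x\<in>el Z. app m x = g (?h x)"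
        using k f fz by (intro bexI[of _ "f k"]) (auto simp: proj)
    qed
    then obtain m where m: "m \<in> hom V Z P" "\<And>z. z \<in> el Z \<Longrightarrow> app m z = ?h z"
      by blast
    have "p k \<cdot> m = f k" if k: "k \<in> K" for k
    proof (rule arr_eqI[OF comp_hom[OF p[OF k] m(1)]])
      show "f k \<in> hom V Z (X k)"
        using f k by blast
      show "app (p k \<cdot> m) z = app (f k) z" if z: "z \<in> el Z" for z
        using k z m hA fz by (simp add: app_comp[OF p[OF k] m(1)] pp Pi_mem[OF hA] proj)
    qed
    then show "\<exists>h. h \<in> hom V Z P \<and> (\<forall>k\<in>K. p k \<cdot> h = f k)"
      using m(1) by blast
  next
    fix h h' assume hh: "h \<in> hom V Z P \<and> (\<forall>k\<in>K. p k \<cdot> h = f k)"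
      "h' \<in> hom V Z P \<and> (\<forall>k\<in>K. p k \<cdot> h' = f k)"
    show "h = h'"
    proof (rule arr_eqI[of h Z P h'])
      fix z assume z: "z \<in> el Z"
      have hz: "app h z \<in> A" "app h' z \<in> A"
        using hh z P(2) app_in by blast+
      have "proj k (app h z) = proj k (app h' z)" if k: "k \<in> K" for k
        using app_comp[OF p[OF k], of h Z z] app_comp[OF p[OF k], of h' Z z] hh k z pp[OF k] hz
        by metis
      then show "app h z = app h' z"
        by (rule A_eqI[OF hz])
    qed (use hh in simp_all)
  qed
  then have "is_product V K X P p"
    using P(1) p unfolding is_product_def by simp
  then show ?thesis
    by blast
qed

lemma is_product_prod:
  assumes "small_collection TYPE('u) K" and "\<And>k. k \<in> K \<Longrightarrow> X k \<in> Obj V"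
  shows "is_product V K X (prod_obj V K X) (prod_proj V K X)"
proof -
  have "\<exists>c. case c of (P, p) \<Rightarrow> is_product V K X P p"
    using is_product_ex[OF assms] by auto
  then show ?thesis
    unfolding prod_obj_def prod_proj_def product_cone_def by (metis (mono_tags, lifting) case_prod_beta someI_ex)
qed

section \<open>Elements of the chosen products\<close>

context
  fixes K :: "'k set" and X :: "'k \<Rightarrow> 'o"
  assumes K: "small_collection TYPE('u) K" and X: "\<And>k. k \<in> K \<Longrightarrow> X k \<in> Obj V"
begin

lemma is_product_prod': "is_product V K X (prod_obj V K X) (prod_proj V K X)"
  by (rule is_product_prod[OF K]) (rule X)

lemma prod_obj_Obj: "prod_obj V K X \<in> Obj V"
  and prod_proj_hom: "k \<in> K \<Longrightarrow> prod_proj V K X k \<in> hom V (prod_obj V K X) (X k)"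
  using is_product_prod' unfolding is_product_def by blast+

lemma tuple_ex1:
  assumes Z: "Z \<in> Obj V" and f: "\<And>k. k \<in> K \<Longrightarrow> f k \<in> hom V Z (X k)"
  shows "\<exists>!h. h \<in> hom V Z (prod_obj V K X) \<and> (\<forall>k\<in>K. prod_proj V K X k \<cdot> h = f k)"
proof -
  have "\<forall>Z\<in>Obj V. \<forall>f. (\<forall>k\<in>K. f k \<in> hom V Z (X k)) \<longrightarrow>
      (\<exists>!h. h \<in> hom V Z (prod_obj V K X) \<and> (\<forall>k\<in>K. prod_proj V K X k \<cdot> h = f k))"
    using is_product_prod' unfolding is_product_def by (elim conjE)
  from mp[OF spec[OF bspec[OF this Z]]] show ?thesis
    using f by simp
qed

lemma tuple:
  assumes "Z \<in> Obj V" "\<And>k. k \<in> K \<Longrightarrow> f k \<in> hom V Z (X k)"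
  shows tuple_hom: "tuple V K X Z f \<in> hom V Z (prod_obj V K X)"
    and proj_tuple: "k \<in> K \<Longrightarrow> prod_proj V K X k \<cdot> tuple V K X Z f = f k"
proof -
  from theI'[OF tuple_ex1[OF assms]] show "tuple V K X Z f \<in> hom V Z (prod_obj V K X)"
    and "k \<in> K \<Longrightarrow> prod_proj V K X k \<cdot> tuple V K X Z f = f k"
    unfolding tuple_def by blast+
qed

lemma app_proj_tuple:
  assumes "Z \<in> Obj V" "\<And>k. k \<in> K \<Longrightarrow> f k \<in> hom V Z (X k)" "k \<in> K" "z \<in> el Z"
  shows "app (prod_proj V K X k) (app (tuple V K X Z f) z) = app (f k) z"
  using app_comp[OF prod_proj_hom[OF assms(3)] tuple_hom[OF assms(1,2)] assms(4)]
    proj_tuple[OF assms(1-3)] by simp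

text \<open>The chosen product is known only through its universal property, so its elements are
  compared as points: two points with equal projections are the same mediating arrow.\<close>

lemma prod_eqI:
  assumes x: "x \<in> el (prod_obj V K X)" and y: "y \<in> el (prod_obj V K X)"
    and eq: "\<And>k. k \<in> K \<Longrightarrow> app (prod_proj V K X k) x = app (prod_proj V K X k) y"
  shows "x = y"
proof -
  obtain p where p: "p \<in> hom V (Unit V) (prod_obj V K X)" "app p star = x"
    using pt_ex[OF prod_obj_Obj x] by blast
  obtain q where q: "q \<in> hom V (Unit V) (prod_obj V K X)" "app q star = y"
    using pt_ex[OF prod_obj_Obj y] by blast
  have "prod_proj V K X k \<cdot> p = prod_proj V K X k \<cdot> q" if k: "k \<in> K" for k
    using p q eq[OF k] el_Unit
    by (intro arr_eqI[OF comp_hom comp_hom, OF prod_proj_hom[OF k] p(1) prod_proj_hom[OF k] q(1)])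
      (simp add: app_comp[OF prod_proj_hom[OF k]])
  moreover have "\<exists>!h. h \<in> hom V (Unit V) (prod_obj V K X) \<and>
      (\<forall>k\<in>K. prod_proj V K X k \<cdot> h = prod_proj V K X k \<cdot> q)"
    by (rule tuple_ex1[OF Unit_Obj comp_hom[OF prod_proj_hom q(1)]])
  ultimately have "p = q"
    using p(1) q(1) by blast
  then show ?thesis
    using p q by simp
qed

end

text \<open>The embedding of the set \<open>H\<close> with the structure induced from
  \<open>X\<close>, described by its mapping property, since an arbitrarily chosen equalizer is
  determined only up to isomorphism.\<close>

definition subobject :: "'o \<Rightarrow> 'u set \<Rightarrow> 'o \<Rightarrow> 'm \<Rightarrow> bool" where
  "subobject X H E e \<longleftrightarrow> e \<in> hom V E X \<and> (\<forall>x\<in>el E. app e x \<in> H) \<and>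
     (\<forall>Z\<in>Obj V. \<forall>h\<in>hom V Z X. (\<forall>z\<in>el Z. app h z \<in> H) \<longrightarrow> (\<exists>!u. u \<in> hom V Z E \<and> e \<cdot> u = h))"

text \<open>The inclusion of the set where the arrows agree, with its initial structure, is a joint
  equalizer. So one exists and the choice in \<open>joint_equalizer\<close> is a genuine one; and an
  arrow equalizes exactly when its values lie in that set.\<close>

lemma subobject_joint_equalizer:
  assumes X: "X \<in> Obj V"
    and fg: "\<And>k. k \<in> K \<Longrightarrow> f k \<in> hom V X (Y k)" "\<And>k. k \<in> K \<Longrightarrow> g k \<in> hom V X (Y k)"
    and Ee: "(E, e) = joint_equalizer V X K f g"
  shows "subobject X {x \<in> el X. \<forall>k\<in>K. app (f k) x = app (g k) x} E e"
proof -
  let ?H = "{x \<in> el X. \<forall>k\<in>K. app (f k) x = app (g k) x}"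
  have eq: "(\<forall>k\<in>K. f k \<cdot> h = g k \<cdot> h) \<longleftrightarrow> (\<forall>z\<in>el Z. app h z \<in> ?H)" if h: "h \<in> hom V Z X" for h Z
  proof -
    have "f k \<cdot> h = g k \<cdot> h \<longleftrightarrow> (\<forall>z\<in>el Z. app (f k) (app h z) = app (g k) (app h z))"
      if k: "k \<in> K" for k
      using app_comp[OF fg(1)[OF k] h] app_comp[OF fg(2)[OF k] h]
        arr_eqI[OF comp_hom[OF fg(1)[OF k] h] comp_hom[OF fg(2)[OF k] h]] by metis
    then show ?thesis
      using app_in[OF h] by auto
  qed
  have "small ?H"
    using small_subset[OF small_el[OF X], of ?H] by blast
  then obtain D where D: "D \<in> Obj V" "el D = ?H"
    and lift: "\<And>Z g. (Z, g) \<in> {(X, \<lambda>x. x)} \<Longrightarrow> \<exists>m\<in>hom V D Z. \<forall>x\<in>?H. app m x = g x"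
    and initial: "\<And>W f. W \<in> Obj V \<Longrightarrow> f \<in> el W \<rightarrow> ?H \<Longrightarrow>
       (\<And>Z g. (Z, g) \<in> {(X, \<lambda>x. x)} \<Longrightarrow> \<exists>m\<in>hom V W Z. \<forall>x\<in>el W. app m x = g (f x)) \<Longrightarrow>
       \<exists>m\<in>hom V W D. \<forall>x\<in>el W. app m x = f x"
    by (rule initial_lift_ex[of ?H "{(X, \<lambda>x. x)}"]) (use X in auto)
  obtain d where d: "d \<in> hom V D X" "\<And>x. x \<in> ?H \<Longrightarrow> app d x = x"
    using lift[of X "\<lambda>x. x"] by blast
  have "\<exists>!u. u \<in> hom V Z D \<and> d \<cdot> u = h"
    if Z: "Z \<in> Obj V" and h: "h \<in> hom V Z X" and hH: "\<forall>z\<in>el Z. app h z \<in> ?H" for Z h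
  proof (rule ex_ex1I)
    have "\<exists>m\<in>hom V Z D. \<forall>x\<in>el Z. app m x = app h x"
      using Z h hH by (intro initial) auto
    then obtain u where u: "u \<in> hom V Z D" "\<And>z. z \<in> el Z \<Longrightarrow> app u z = app h z"
      by blast
    have "d \<cdot> u = h"
      using hH u d(2) by (intro arr_eqI[OF comp_hom[OF d(1) u(1)] h]) (simp add: app_comp[OF d(1) u(1)])
    then show "\<exists>u. u \<in> hom V Z D \<and> d \<cdot> u = h"
      using u(1) by blast
  next
    fix u v assume uv: "u \<in> hom V Z D \<and> d \<cdot> u = h" "v \<in> hom V Z D \<and> d \<cdot> v = h"
    have *: "app w z = app h z" if "w \<in> hom V Z D \<and> d \<cdot> w = h" "z \<in> el Z" for w z
      using that d(2)[of "app w z"] app_comp[OF d(1), of w Z z] app_in[of w Z D z] D(2) by metis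
    show "u = v"
      using uv by (intro arr_eqI[of u Z D v]) (auto simp: *)
  qed
  then have "is_joint_equalizer V X K f g D d"
    using D(1) d(1) eq[OF d(1)] d D(2) unfolding is_joint_equalizer_def by (auto simp: eq)
  then have "\<exists>c. case c of (E, e) \<Rightarrow> is_joint_equalizer V X K f g E e"
    by auto
  then have "is_joint_equalizer V X K f g E e"
    using Ee unfolding joint_equalizer_def by (metis (mono_tags, lifting) case_prod_conv someI_ex)
  then show ?thesis
    unfolding is_joint_equalizer_def subobject_def by (simp add: eq cong: conj_cong)
qed

text \<open>The initial lift of the source of all functions from \<open>A\<close> to underlying sets
  of objects, in general a proper class. Each member of a source is admissible on its lift, so every
  function out of \<open>A\<close> becomes an arrow.\<close>

lemma discrete_ex:
  assumes "small A"
  obtains D where "D \<in> Obj V" "el D = A"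
    "\<And>Z g. Z \<in> Obj V \<Longrightarrow> g \<in> A \<rightarrow> el Z \<Longrightarrow> \<exists>m\<in>hom V D Z. \<forall>x\<in>A. app m x = g x"
proof -
  obtain D where "D \<in> Obj V" "el D = A"
    "\<And>Z g. (Z, g) \<in> {(Z, g). Z \<in> Obj V \<and> g \<in> A \<rightarrow> el Z} \<Longrightarrow>
       \<exists>m\<in>hom V D Z. \<forall>x\<in>A. app m x = g x"
    by (rule initial_lift_ex[OF assms, of "{(Z, g). Z \<in> Obj V \<and> g \<in> A \<rightarrow> el Z}"]) auto
  then show thesis
    by (intro that) blast+
qed

text \<open>The copower is the discrete object on \<open>n\<close> elements: arrows out of it are
  arbitrary functions, that is, choices of \<open>n\<close> elements, and these are \<open>n\<close>
  arrows out of \<open>I\<close>.\<close>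

lemma copower_ex: "\<exists>Q q. is_coproduct V {..<n::nat} (\<lambda>_. Unit V) Q q"
proof -
  obtain c :: "nat \<Rightarrow> 'u" where c: "inj c" "\<And>N. small (c ` N)"
    using ex_small_indexing by blast
  obtain D where D: "D \<in> Obj V" "el D = c ` {..<n}"
    and disc: "\<And>Z g. Z \<in> Obj V \<Longrightarrow> g \<in> c ` {..<n} \<rightarrow> el Z \<Longrightarrow>
      \<exists>m\<in>hom V D Z. \<forall>x\<in>c ` {..<n}. app m x = g x"
    using discrete_ex[OF c(2)] by metis
  have "\<forall>k\<in>{..<n}. \<exists>q\<in>hom V (Unit V) D. app q star = c k"
    using D by (intro ballI pt_ex) auto
  then obtain q where q: "\<And>k. k < n \<Longrightarrow> q k \<in> hom V (Unit V) D" "\<And>k. k < n \<Longrightarrow> app (q k) star = c k"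
    by (metis lessThan_iff)
  have app_q: "h \<cdot> q k = f \<longleftrightarrow> app h (c k) = app f star"
    if "k < n" "h \<in> hom V D Z" "f \<in> hom V (Unit V) Z" for h f k Z
    using app_comp[OF that(2) q(1)[OF that(1)], of star] q(2)[OF that(1)] el_Unit
      arr_eqI[OF comp_hom[OF that(2) q(1)[OF that(1)]] that(3)] by auto
  have "\<exists>!h. h \<in> hom V D Z \<and> (\<forall>k\<in>{..<n}. h \<cdot> q k = f k)"
    if Z: "Z \<in> Obj V" and f: "\<forall>k\<in>{..<n}. f k \<in> hom V (Unit V) Z" for Z f
  proof (rule ex_ex1I)
    let ?g = "\<lambda>x. app (f (inv c x)) star"
    have "?g \<in> c ` {..<n} \<rightarrow> el Z"
      using f c(1) el_Unit by (auto intro!: app_in[of _ "Unit V"])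
    then obtain h where h: "h \<in> hom V D Z" "\<And>k. k < n \<Longrightarrow> app h (c k) = app (f k) star"
      using disc[OF Z, of ?g] c(1) by auto
    then show "\<exists>h. h \<in> hom V D Z \<and> (\<forall>k\<in>{..<n}. h \<cdot> q k = f k)"
      using app_q f by auto
  next
    fix h h' assume "h \<in> hom V D Z \<and> (\<forall>k\<in>{..<n}. h \<cdot> q k = f k)"
      "h' \<in> hom V D Z \<and> (\<forall>k\<in>{..<n}. h' \<cdot> q k = f k)"
    then show "h = h'"
      using f D(2) by (intro arr_eqI[of h D Z h']) (auto simp: app_q)
  qed
  then show ?thesis
    using D(1) q(1) unfolding is_coproduct_def by (intro exI[of _ D] exI[of _ q]) simp
qed

text \<open>\<open>copower\<close> keeps the object and forgets the injections, so some injections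
  are chosen anew; an injection out of \<open>I\<close> is recorded by its value at
  \<open>star\<close>.\<close>

definition copoint :: "nat \<Rightarrow> nat \<Rightarrow> 'u" where
  "copoint n k =
     app ((SOME q. is_coproduct V {..<n} (\<lambda>_. Unit V) (copower V n (Unit V)) q) k) star"

lemma copower_Obj [simp, intro]: "copower V n (Unit V) \<in> Obj V"
  and copoint_in [intro]: "k < n \<Longrightarrow> copoint n k \<in> el (copower V n (Unit V))"
  and copower_arr_ex: "Z \<in> Obj V \<Longrightarrow> (\<And>k. k < n \<Longrightarrow> z k \<in> el Z) \<Longrightarrow>
    \<exists>h\<in>hom V (copower V n (Unit V)) Z. \<forall>k<n. app h (copoint n k) = z k"
  and copower_arr_eqI: "h \<in> hom V (copower V n (Unit V)) Z \<Longrightarrow> h' \<in> hom V (copower V n (Unit V)) Z \<Longrightarrow>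
    (\<And>k. k < n \<Longrightarrow> app h (copoint n k) = app h' (copoint n k)) \<Longrightarrow> h = h'"
proof -
  let ?Q = "copower V n (Unit V)"
  define q where "q = (SOME q. is_coproduct V {..<n} (\<lambda>_. Unit V) ?Q q)"
  have "\<exists>c. case c of (Q, q) \<Rightarrow> is_coproduct V {..<n} (\<lambda>_. Unit V) Q q"
    using copower_ex by auto
  then have "\<exists>q. is_coproduct V {..<n} (\<lambda>_. Unit V) ?Q q"
    unfolding copower_def by (metis (mono_tags, lifting) case_prod_beta someI_ex)
  then have cop: "is_coproduct V {..<n} (\<lambda>_. Unit V) ?Q q"
    unfolding q_def by (rule someI_ex)
  then have copair: "\<forall>Z\<in>Obj V. \<forall>f. (\<forall>k\<in>{..<n}. f k \<in> hom V (Unit V) Z) \<longrightarrow>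
      (\<exists>!h. h \<in> hom V ?Q Z \<and> (\<forall>k\<in>{..<n}. h \<cdot> q k = f k))"
    unfolding is_coproduct_def by (elim conjE)
  have cpt: "copoint n k = app (q k) star" for k
    unfolding copoint_def q_def by simp
  have q: "k < n \<Longrightarrow> q k \<in> hom V (Unit V) ?Q" for k
    using cop unfolding is_coproduct_def by blast
  show "?Q \<in> Obj V"
    using cop unfolding is_coproduct_def by blast
  show "copoint n k \<in> el ?Q" if "k < n"
    unfolding cpt using q[OF that] el_Unit by blast
  have app_q: "app (h \<cdot> q k) star = app h (copoint n k)" if "k < n" "h \<in> hom V ?Q Z" for k h Z
    unfolding cpt using app_comp[OF that(2) q[OF that(1)]] el_Unit by simp
  show "\<exists>h\<in>hom V ?Q Z. \<forall>k<n. app h (copoint n k) = z k"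
    if Z: "Z \<in> Obj V" and z: "\<And>k. k < n \<Longrightarrow> z k \<in> el Z"
  proof -
    have "\<forall>k\<in>{..<n}. \<exists>m\<in>hom V (Unit V) Z. app m star = z k"
      using z Z by (intro ballI pt_ex) auto
    then obtain m where m: "\<forall>k\<in>{..<n}. m k \<in> hom V (Unit V) Z" "\<And>k. k < n \<Longrightarrow> app (m k) star = z k"
      by (metis lessThan_iff)
    then obtain h where "h \<in> hom V ?Q Z" "\<And>k. k < n \<Longrightarrow> h \<cdot> q k = m k"
      using mp[OF spec[OF bspec[OF copair Z]]] by (metis lessThan_iff)
    then show ?thesis
      using m(2) app_q by metis
  qed
  show "h = h'" if h: "h \<in> hom V ?Q Z" "h' \<in> hom V ?Q Z"
    and eq: "\<And>k. k < n \<Longrightarrow> app h (copoint n k) = app h' (copoint n k)"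
  proof -
    have "h \<cdot> q k = h' \<cdot> q k" if k: "k < n" for k
      using app_q[OF k h(1)] app_q[OF k h(2)] eq[OF k] el_Unit
      by (intro arr_eqI[OF comp_hom comp_hom, OF h(1) q[OF k] h(2) q[OF k]]) simp
    moreover have "\<forall>k\<in>{..<n}. h' \<cdot> q k \<in> hom V (Unit V) Z"
      using q h(2) by blast
    then have "\<exists>!g. g \<in> hom V ?Q Z \<and> (\<forall>k\<in>{..<n}. g \<cdot> q k = h' \<cdot> q k)"
      using mp[OF spec[OF bspec[OF copair]]] hom_Obj[OF h(1)] by simp
    ultimately show ?thesis
      using h by blast
  qed
qed

text \<open>The empty copower maps into the discrete object on the empty set, and only an empty set
  maps into an empty one.\<close>

lemma el_copower_0 [simp]: "el (copower V 0 (Unit V)) = {}"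
proof -
  obtain D where D: "D \<in> Obj V" "el D = {}"
    using discrete_ex[OF small_empty] by metis
  obtain h where "h \<in> hom V (copower V 0 (Unit V)) D"
    using copower_arr_ex[OF D(1), of 0] by blast
  then show ?thesis
    using app_in D(2) by blast
qed

section \<open>Enriched categories in terms of elements\<close>

lemma arr_eqI':
  assumes "f \<in> Arr V" "g \<in> Arr V" "Dom V f = Dom V g" "Cod V f = Cod V g"
    "\<And>x. x \<in> el (Dom V f) \<Longrightarrow> app f x = app g x"
  shows "f = g"
  using assms by (intro arr_eqI[of f "Dom V f" "Cod V f" g]) (simp_all add: hom_iff)

text \<open>Elements of tensor products are pairs, so the associativity and unit diagrams turn into
  equations between values.\<close>

lemma vcategoryI:
  assumes Hom: "\<And>a b. a \<in> VObj B \<Longrightarrow> b \<in> VObj B \<Longrightarrow> VHom B a b \<in> Obj V"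
    and Id: "\<And>a. a \<in> VObj B \<Longrightarrow> VId B a \<in> hom V (Unit V) (VHom B a a)"
    and Cmp: "\<And>a b c. a \<in> VObj B \<Longrightarrow> b \<in> VObj B \<Longrightarrow> c \<in> VObj B \<Longrightarrow>
      VComp B a b c \<in> hom V (VHom B b c \<otimes> VHom B a b) (VHom B a c)"
    and assoc: "\<And>a b c d u v w. a \<in> VObj B \<Longrightarrow> b \<in> VObj B \<Longrightarrow> c \<in> VObj B \<Longrightarrow> d \<in> VObj B \<Longrightarrow>
      u \<in> el (VHom B a b) \<Longrightarrow> v \<in> el (VHom B b c) \<Longrightarrow> w \<in> el (VHom B c d) \<Longrightarrow>
      app (VComp B a b d) (kpair (app (VComp B b c d) (kpair w v)) u) =
      app (VComp B a c d) (kpair w (app (VComp B a b c) (kpair v u)))"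
    and unit: "\<And>a b u. a \<in> VObj B \<Longrightarrow> b \<in> VObj B \<Longrightarrow> u \<in> el (VHom B a b) \<Longrightarrow>
      app (VComp B a b b) (kpair (app (VId B b) star) u) = u"
      "\<And>a b u. a \<in> VObj B \<Longrightarrow> b \<in> VObj B \<Longrightarrow> u \<in> el (VHom B a b) \<Longrightarrow>
      app (VComp B a a b) (kpair u (app (VId B a) star)) = u"
  shows "vcategory V B"
  unfolding vcategory_def
proof (intro conjI ballI)
  fix a b c d assume O: "a \<in> VObj B" "b \<in> VObj B" "c \<in> VObj B" "d \<in> VObj B"
  note t = Hom[OF O(1) O(2)] Hom[OF O(2) O(3)] Hom[OF O(3) O(4)] Hom[OF O(1) O(3)] Hom[OF O(2) O(4)]
    Cmp[OF O(1) O(2) O(4)] Cmp[OF O(2) O(3) O(4)] Cmp[OF O(1) O(3) O(4)] Cmp[OF O(1) O(2) O(3)]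
  show "VComp B a b d \<cdot> (VComp B b c d \<odot> Ident V (VHom B a b)) =
      VComp B a c d \<cdot> (Ident V (VHom B c d) \<odot> VComp B a b c) \<cdot>
        Assoc V (VHom B c d) (VHom B b c) (VHom B a b)"
    using t O by (intro arr_eqI') (auto simp: arr_simps assoc elim!: cartesianE)
next
  fix a b assume O: "a \<in> VObj B" "b \<in> VObj B"
  note t = Hom[OF O(1) O(2)] Hom[OF O(1) O(1)] Hom[OF O(2) O(2)] Id[OF O(1)] Id[OF O(2)]
    Cmp[OF O(1) O(2) O(2)] Cmp[OF O(1) O(1) O(2)]
  show "VComp B a b b \<cdot> (VId B b \<odot> Ident V (VHom B a b)) = Lunit V (VHom B a b)"
    using t O by (intro arr_eqI') (auto simp: arr_simps el_Unit unit elim!: cartesianE)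
  show "VComp B a a b \<cdot> (Ident V (VHom B a b) \<odot> VId B a) = Runit V (VHom B a b)"
    using t O by (intro arr_eqI') (auto simp: arr_simps el_Unit unit elim!: cartesianE)
qed (use Hom Id Cmp in auto)

context
  fixes B :: "('b, 'o, 'm) vcat"
  assumes B: "vcategory V B"
begin

lemma VHom_Obj: "a \<in> VObj B \<Longrightarrow> b \<in> VObj B \<Longrightarrow> VHom B a b \<in> Obj V"
  and VId_hom: "a \<in> VObj B \<Longrightarrow> VId B a \<in> hom V (Unit V) (VHom B a a)"
  and VComp_hom: "a \<in> VObj B \<Longrightarrow> b \<in> VObj B \<Longrightarrow> c \<in> VObj B \<Longrightarrow>
      VComp B a b c \<in> hom V (VHom B b c \<otimes> VHom B a b) (VHom B a c)"
  using B unfolding vcategory_def by - (elim conjE, simp)+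

lemma app_VComp_assoc:
  assumes O: "a \<in> VObj B" "b \<in> VObj B" "c \<in> VObj B" "d \<in> VObj B"
    and e: "u \<in> el (VHom B a b)" "v \<in> el (VHom B b c)" "w \<in> el (VHom B c d)"
  shows "app (VComp B a b d) (kpair (app (VComp B b c d) (kpair w v)) u) =
      app (VComp B a c d) (kpair w (app (VComp B a b c) (kpair v u)))"
proof -
  note t = VHom_Obj[OF O(1) O(2)] VHom_Obj[OF O(2) O(3)] VHom_Obj[OF O(3) O(4)]
    VHom_Obj[OF O(1) O(3)] VHom_Obj[OF O(2) O(4)]
    VComp_hom[OF O(1) O(2) O(4)] VComp_hom[OF O(2) O(3) O(4)] VComp_hom[OF O(1) O(3) O(4)]
    VComp_hom[OF O(1) O(2) O(3)]
  have "VComp B a b d \<cdot> (VComp B b c d \<odot> Ident V (VHom B a b)) =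
      VComp B a c d \<cdot> (Ident V (VHom B c d) \<odot> VComp B a b c) \<cdot>
        Assoc V (VHom B c d) (VHom B b c) (VHom B a b)"
    using B O unfolding vcategory_def by - (elim conjE, simp)
  from arg_cong[OF this, of "\<lambda>h. app h (kpair (kpair w v) u)"] show ?thesis
    using t e by (simp add: arr_simps)
qed

lemma app_VComp_unit:
  assumes O: "a \<in> VObj B" "b \<in> VObj B" and u: "u \<in> el (VHom B a b)"
  shows "app (VComp B a b b) (kpair (app (VId B b) star) u) = u"
    and "app (VComp B a a b) (kpair u (app (VId B a) star)) = u"
proof -
  note t = VHom_Obj[OF O(1) O(2)] VHom_Obj[OF O(1) O(1)] VHom_Obj[OF O(2) O(2)]
    VId_hom[OF O(1)] VId_hom[OF O(2)] VComp_hom[OF O(1) O(2) O(2)] VComp_hom[OF O(1) O(1) O(2)]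
  have "VComp B a b b \<cdot> (VId B b \<odot> Ident V (VHom B a b)) = Lunit V (VHom B a b)"
    and "VComp B a a b \<cdot> (Ident V (VHom B a b) \<odot> VId B a) = Runit V (VHom B a b)"
    using B O unfolding vcategory_def by - (elim conjE, simp)+
  from arg_cong[OF this(1), of "\<lambda>h. app h (kpair star u)"]
    arg_cong[OF this(2), of "\<lambda>h. app h (kpair u star)"]
  show "app (VComp B a b b) (kpair (app (VId B b) star) u) = u"
    and "app (VComp B a a b) (kpair u (app (VId B a) star)) = u"
    using t u by (simp_all add: arr_simps el_Unit)
qed

end

lemma is_vfunctorI:
  assumes A: "vcategory V A" and B: "vcategory V B"
    and ob: "\<And>a. a \<in> VObj A \<Longrightarrow> VFob F a \<in> VObj B"
    and ar: "\<And>a b. a \<in> VObj A \<Longrightarrow> b \<in> VObj A \<Longrightarrow>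
      VFar F a b \<in> hom V (VHom A a b) (VHom B (VFob F a) (VFob F b))"
    and id: "\<And>a. a \<in> VObj A \<Longrightarrow> app (VFar F a a) (app (VId A a) star) = app (VId B (VFob F a)) star"
    and cmp: "\<And>a b c u v. a \<in> VObj A \<Longrightarrow> b \<in> VObj A \<Longrightarrow> c \<in> VObj A \<Longrightarrow>
      u \<in> el (VHom A a b) \<Longrightarrow> v \<in> el (VHom A b c) \<Longrightarrow>
      app (VFar F a c) (app (VComp A a b c) (kpair v u)) =
      app (VComp B (VFob F a) (VFob F b) (VFob F c)) (kpair (app (VFar F b c) v) (app (VFar F a b) u))"
  shows "is_vfunctor V A B F"
  unfolding is_vfunctor_def
proof (intro conjI ballI)
  fix a assume a: "a \<in> VObj A"
  show "VFar F a a \<cdot> VId A a = VId B (VFob F a)"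
    using a VId_hom[OF A a] VId_hom[OF B ob[OF a]] ar[OF a a] id[OF a]
    by (intro arr_eqI') (auto simp: arr_simps el_Unit)
next
  fix a b c assume O: "a \<in> VObj A" "b \<in> VObj A" "c \<in> VObj A"
  note t = VHom_Obj[OF A O(1) O(2)] VHom_Obj[OF A O(2) O(3)] VHom_Obj[OF A O(1) O(3)]
    VComp_hom[OF A O] VComp_hom[OF B ob[OF O(1)] ob[OF O(2)] ob[OF O(3)]]
    ar[OF O(1) O(2)] ar[OF O(2) O(3)] ar[OF O(1) O(3)]
  show "VFar F a c \<cdot> VComp A a b c =
      VComp B (VFob F a) (VFob F b) (VFob F c) \<cdot> (VFar F b c \<odot> VFar F a b)"
    using t by (intro arr_eqI') (auto simp: arr_simps cmp[OF O] elim!: cartesianE)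
qed (use ob ar in auto)

section \<open>Enriched categories induced by subobjects of the hom-objects\<close>

context
  fixes X H E e
  assumes sub: "subobject X H E e"
begin

lemma subobject_hom: "e \<in> hom V E X"
  and subobject_in: "x \<in> el E \<Longrightarrow> app e x \<in> H"
  using sub unfolding subobject_def by simp_all

lemma subobject_ex1:
  assumes h: "h \<in> hom V Z X" and "\<And>z. z \<in> el Z \<Longrightarrow> app h z \<in> H"
  shows "\<exists>!u. u \<in> hom V Z E \<and> e \<cdot> u = h"
proof -
  have "\<forall>Z\<in>Obj V. \<forall>h\<in>hom V Z X. (\<forall>z\<in>el Z. app h z \<in> H) \<longrightarrow> (\<exists>!u. u \<in> hom V Z E \<and> e \<cdot> u = h)"
    using sub unfolding subobject_def by (elim conjE)
  from mp[OF bspec[OF bspec[OF this] h]] show ?thesis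
    using assms(2) hom_Obj[OF h] by simp
qed

text \<open>Elements of \<open>E\<close> are points, and a point of \<open>X\<close> with value in
  \<open>H\<close> factors through \<open>e\<close> in only one way.\<close>

lemma subobject_inj:
  assumes x: "x \<in> el E" and y: "y \<in> el E" and eq: "app e x = app e y"
  shows "x = y"
proof -
  have E: "E \<in> Obj V"
    using hom_Obj[OF subobject_hom] by simp
  obtain p where p: "p \<in> hom V (Unit V) E" "app p star = x"
    using pt_ex[OF E x] by blast
  obtain q where q: "q \<in> hom V (Unit V) E" "app q star = y"
    using pt_ex[OF E y] by blast
  have "e \<cdot> p = e \<cdot> q"
    using subobject_hom p q eq by (intro arr_eqI') (auto simp: arr_simps el_Unit)
  moreover have "\<exists>!u. u \<in> hom V (Unit V) E \<and> e \<cdot> u = e \<cdot> q"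
    using subobject_hom q subobject_in[OF y] by (intro subobject_ex1) (auto simp: arr_simps el_Unit)
  ultimately have "p = q"
    using p(1) q(1) by blast
  then show ?thesis
    using p q by simp
qed

lemma subobject_cancel:
  assumes "f \<in> hom V Z E" "g \<in> hom V Z E" "e \<cdot> f = e \<cdot> g"
  shows "f = g"
proof (rule arr_eqI[OF assms(1,2)])
  fix z assume z: "z \<in> el Z"
  show "app f z = app g z"
    using app_comp[OF subobject_hom assms(1) z] app_comp[OF subobject_hom assms(2) z] assms(3)
    by (intro subobject_inj[OF app_in[OF assms(1) z] app_in[OF assms(2) z]]) simp
qed

end

text \<open>Conditions under which \<open>induced_vcat\<close> is an enriched category over
  \<open>B\<close>. Both categories of algebras fit this pattern, so their structure and the
  isomorphism between them are treated once and for all.\<close>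

definition closed_subobjects ::
  "('b, 'o, 'm) vcat \<Rightarrow> 'a set \<Rightarrow> ('a \<Rightarrow> 'b) \<Rightarrow> ('a \<Rightarrow> 'a \<Rightarrow> 'u set) \<Rightarrow> ('a \<Rightarrow> 'a \<Rightarrow> 'o) \<Rightarrow>
   ('a \<Rightarrow> 'a \<Rightarrow> 'm) \<Rightarrow> bool" where
  "closed_subobjects B A \<phi> H E e \<longleftrightarrow> (\<forall>a\<in>A. \<phi> a \<in> VObj B) \<and>
     (\<forall>a\<in>A. \<forall>b\<in>A. subobject (VHom B (\<phi> a) (\<phi> b)) (H a b) (E a b) (e a b)) \<and>
     (\<forall>a\<in>A. app (VId B (\<phi> a)) star \<in> H a a) \<and>
     (\<forall>a\<in>A. \<forall>b\<in>A. \<forall>c\<in>A. \<forall>u\<in>H a b. \<forall>v\<in>H b c.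
        app (VComp B (\<phi> a) (\<phi> b) (\<phi> c)) (kpair v u) \<in> H a c)"

context
  fixes B :: "('b, 'o, 'm) vcat" and A :: "'a set" and \<phi> H E e
  assumes B: "vcategory V B" and cs: "closed_subobjects B A \<phi> H E e"
begin

lemma cs_ob: "a \<in> A \<Longrightarrow> \<phi> a \<in> VObj B"
  and cs_sub: "a \<in> A \<Longrightarrow> b \<in> A \<Longrightarrow> subobject (VHom B (\<phi> a) (\<phi> b)) (H a b) (E a b) (e a b)"
  and cs_id: "a \<in> A \<Longrightarrow> app (VId B (\<phi> a)) star \<in> H a a"
  and cs_comp: "a \<in> A \<Longrightarrow> b \<in> A \<Longrightarrow> c \<in> A \<Longrightarrow> u \<in> H a b \<Longrightarrow> v \<in> H b c \<Longrightarrow>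
      app (VComp B (\<phi> a) (\<phi> b) (\<phi> c)) (kpair v u) \<in> H a c"
  using cs unfolding closed_subobjects_def by - (elim conjE, simp)+

lemma cs_hom: "a \<in> A \<Longrightarrow> b \<in> A \<Longrightarrow> e a b \<in> hom V (E a b) (VHom B (\<phi> a) (\<phi> b))"
  using subobject_hom[OF cs_sub] .

lemma cs_Obj: "a \<in> A \<Longrightarrow> b \<in> A \<Longrightarrow> E a b \<in> Obj V"
  using hom_Obj[OF cs_hom] by simp

lemma induced_VId:
  assumes a: "a \<in> A"
  shows "VId (induced_vcat V B A \<phi> E e) a \<in> hom V (Unit V) (E a a)"
    and "e a a \<cdot> VId (induced_vcat V B A \<phi> E e) a = VId B (\<phi> a)"
proof -
  have "\<exists>!i. i \<in> hom V (Unit V) (E a a) \<and> e a a \<cdot> i = VId B (\<phi> a)"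
    using cs_id[OF a] by (intro subobject_ex1[OF cs_sub[OF a a] VId_hom[OF B cs_ob[OF a]]]) (simp add: el_Unit)
  from theI'[OF this] show "VId (induced_vcat V B A \<phi> E e) a \<in> hom V (Unit V) (E a a)"
    and "e a a \<cdot> VId (induced_vcat V B A \<phi> E e) a = VId B (\<phi> a)"
    unfolding induced_vcat_def by simp_all
qed

lemma induced_VComp:
  assumes O: "a \<in> A" "b \<in> A" "c \<in> A"
  shows "VComp (induced_vcat V B A \<phi> E e) a b c \<in> hom V (E b c \<otimes> E a b) (E a c)"
    and "e a c \<cdot> VComp (induced_vcat V B A \<phi> E e) a b c =
      VComp B (\<phi> a) (\<phi> b) (\<phi> c) \<cdot> (e b c \<odot> e a b)"
proof -
  note t = VComp_hom[OF B cs_ob[OF O(1)] cs_ob[OF O(2)] cs_ob[OF O(3)]]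
    cs_hom[OF O(1) O(2)] cs_hom[OF O(2) O(3)] cs_Obj[OF O(1) O(2)] cs_Obj[OF O(2) O(3)]
  have "\<exists>!h. h \<in> hom V (E b c \<otimes> E a b) (E a c) \<and>
      e a c \<cdot> h = VComp B (\<phi> a) (\<phi> b) (\<phi> c) \<cdot> (e b c \<odot> e a b)"
  proof (rule subobject_ex1[OF cs_sub[OF O(1) O(3)]])
    show "VComp B (\<phi> a) (\<phi> b) (\<phi> c) \<cdot> (e b c \<odot> e a b) \<in>
        hom V (E b c \<otimes> E a b) (VHom B (\<phi> a) (\<phi> c))"
      using t by (simp add: arr_simps)
    fix z assume "z \<in> el (E b c \<otimes> E a b)"
    then obtain v u where "z = kpair v u" "v \<in> el (E b c)" "u \<in> el (E a b)"
      using t by (auto elim: cartesianE)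
    then show "app (VComp B (\<phi> a) (\<phi> b) (\<phi> c) \<cdot> (e b c \<odot> e a b)) z \<in> H a c"
      using t subobject_in[OF cs_sub] O by (simp add: arr_simps cs_comp)
  qed
  from theI'[OF this] show "VComp (induced_vcat V B A \<phi> E e) a b c \<in> hom V (E b c \<otimes> E a b) (E a c)"
    and "e a c \<cdot> VComp (induced_vcat V B A \<phi> E e) a b c =
      VComp B (\<phi> a) (\<phi> b) (\<phi> c) \<cdot> (e b c \<odot> e a b)"
    unfolding induced_vcat_def by simp_all
qed

lemma app_induced_VId:
  assumes "a \<in> A"
  shows "app (e a a) (app (VId (induced_vcat V B A \<phi> E e) a) star) = app (VId B (\<phi> a)) star"
  using app_comp[OF cs_hom[OF assms assms] induced_VId(1)[OF assms], of star] induced_VId(2)[OF assms]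
    el_Unit by simp

lemma app_induced_VComp:
  assumes O: "a \<in> A" "b \<in> A" "c \<in> A" and uv: "u \<in> el (E a b)" "v \<in> el (E b c)"
  shows "app (e a c) (app (VComp (induced_vcat V B A \<phi> E e) a b c) (kpair v u)) =
    app (VComp B (\<phi> a) (\<phi> b) (\<phi> c)) (kpair (app (e b c) v) (app (e a b) u))"
proof -
  note t = VComp_hom[OF B cs_ob[OF O(1)] cs_ob[OF O(2)] cs_ob[OF O(3)]]
    cs_hom[OF O(1) O(2)] cs_hom[OF O(2) O(3)] cs_hom[OF O(1) O(3)]
    cs_Obj[OF O(1) O(2)] cs_Obj[OF O(2) O(3)] induced_VComp(1)[OF O]
  from arg_cong[OF induced_VComp(2)[OF O], of "\<lambda>h. app h (kpair v u)"] show ?thesis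
    using t uv by (simp add: arr_simps)
qed

text \<open>The laws hold after applying the injective embeddings, where they become those of
  \<open>B\<close>.\<close>

lemma vcategory_induced: "vcategory V (induced_vcat V B A \<phi> E e)" (is "vcategory V ?I")
proof -
  have simps: "VObj ?I = A" "VHom ?I = E"
    unfolding induced_vcat_def by simp_all
  have C: "app (VComp ?I a b c) (kpair v u) \<in> el (E a c)"
    if "a \<in> A" "b \<in> A" "c \<in> A" "u \<in> el (E a b)" "v \<in> el (E b c)" for a b c u v
    using that app_in[OF induced_VComp(1)[OF that(1-3)]] by (simp add: cs_Obj)
  have I: "app (VId ?I a) star \<in> el (E a a)" if "a \<in> A" for a
    using app_in[OF induced_VId(1)[OF that], of star] by (simp add: el_Unit)
  have e: "app (e a b) u \<in> el (VHom B (\<phi> a) (\<phi> b))" if "a \<in> A" "b \<in> A" "u \<in> el (E a b)" for a b u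
    using app_in[OF cs_hom[OF that(1,2)] that(3)] .
  show ?thesis
  proof (rule vcategoryI, unfold simps)
    fix a b c d u v w assume O: "a \<in> A" "b \<in> A" "c \<in> A" "d \<in> A"
      and el: "u \<in> el (E a b)" "v \<in> el (E b c)" "w \<in> el (E c d)"
    show "app (VComp ?I a b d) (kpair (app (VComp ?I b c d) (kpair w v)) u) =
        app (VComp ?I a c d) (kpair w (app (VComp ?I a b c) (kpair v u)))"
      using O el by - (rule subobject_inj[OF cs_sub[OF O(1) O(4)]],
        simp_all add: C e app_induced_VComp app_VComp_assoc[OF B] cs_ob)
  next
    fix a b u assume O: "a \<in> A" "b \<in> A" and u: "u \<in> el (E a b)"
    show "app (VComp ?I a b b) (kpair (app (VId ?I b) star) u) = u"
      and "app (VComp ?I a a b) (kpair u (app (VId ?I a) star)) = u"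
      using O u by - (rule subobject_inj[OF cs_sub[OF O(1) O(2)]];
        simp add: C I e app_induced_VComp app_induced_VId app_VComp_unit[OF B] cs_ob)+
  qed (simp_all add: cs_Obj induced_VId(1) induced_VComp(1))
qed

lemma slice_object_induced:
  "slice_object V B (induced_vcat V B A \<phi> E e) \<lparr> VFob = \<phi>, VFar = e \<rparr>"
  unfolding slice_object_def
proof (intro conjI B vcategory_induced is_vfunctorI)
  fix a b c u v assume "a \<in> VObj (induced_vcat V B A \<phi> E e)"
    "b \<in> VObj (induced_vcat V B A \<phi> E e)" "c \<in> VObj (induced_vcat V B A \<phi> E e)"
    "u \<in> el (VHom (induced_vcat V B A \<phi> E e) a b)" "v \<in> el (VHom (induced_vcat V B A \<phi> E e) b c)"
  then show "app (VFar \<lparr> VFob = \<phi>, VFar = e \<rparr> a c)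
      (app (VComp (induced_vcat V B A \<phi> E e) a b c) (kpair v u)) =
    app (VComp B (VFob \<lparr> VFob = \<phi>, VFar = e \<rparr> a) (VFob \<lparr> VFob = \<phi>, VFar = e \<rparr> b)
        (VFob \<lparr> VFob = \<phi>, VFar = e \<rparr> c))
      (kpair (app (VFar \<lparr> VFob = \<phi>, VFar = e \<rparr> b c) v) (app (VFar \<lparr> VFob = \<phi>, VFar = e \<rparr> a b) u))"
    using app_induced_VComp by (simp add: induced_vcat_def)
next
  fix a assume "a \<in> VObj (induced_vcat V B A \<phi> E e)"
  then show "app (VFar \<lparr> VFob = \<phi>, VFar = e \<rparr> a a) (app (VId (induced_vcat V B A \<phi> E e) a) star) =
      app (VId B (VFob \<lparr> VFob = \<phi>, VFar = e \<rparr> a)) star"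
    using app_induced_VId by (simp add: induced_vcat_def)
qed (simp_all add: induced_vcat_def cs_ob cs_hom)

end

text \<open>A functor over \<open>B\<close> has no freedom on hom-objects: commuting with the
  embeddings forces the unique factorization of \<open>e\<close> through \<open>e'\<close>, which
  exists as soon as \<open>H\<close> is contained in \<open>H'\<close>.\<close>

definition factor_vfun ::
  "('a \<Rightarrow> 'c) \<Rightarrow> ('a \<Rightarrow> 'a \<Rightarrow> 'o) \<Rightarrow> ('a \<Rightarrow> 'a \<Rightarrow> 'm) \<Rightarrow> ('c \<Rightarrow> 'c \<Rightarrow> 'o) \<Rightarrow> ('c \<Rightarrow> 'c \<Rightarrow> 'm) \<Rightarrow>
   ('a, 'c, 'm) vfunctor" where
  "factor_vfun F E e E' e' = \<lparr> VFob = F,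
     VFar = (\<lambda>a b. THE u. u \<in> hom V (E a b) (E' (F a) (F b)) \<and> e' (F a) (F b) \<cdot> u = e a b) \<rparr>"

context
  fixes B :: "('b, 'o, 'm) vcat" and A :: "'a set" and A' :: "'c set" and \<phi> H E e \<phi>' H' E' e' F
  assumes B: "vcategory V B" and cs: "closed_subobjects B A \<phi> H E e"
    and cs': "closed_subobjects B A' \<phi>' H' E' e'"
    and F: "\<And>a. a \<in> A \<Longrightarrow> F a \<in> A'" "\<And>a. a \<in> A \<Longrightarrow> \<phi>' (F a) = \<phi> a"
    and HF: "\<And>a b. a \<in> A \<Longrightarrow> b \<in> A \<Longrightarrow> H a b \<subseteq> H' (F a) (F b)"
begin

lemma VFar_factor_vfun:
  assumes O: "a \<in> A" "b \<in> A"
  shows "VFar (factor_vfun F E e E' e') a b \<in> hom V (E a b) (E' (F a) (F b))"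
    and "e' (F a) (F b) \<cdot> VFar (factor_vfun F E e E' e') a b = e a b"
proof -
  have h: "e a b \<in> hom V (E a b) (VHom B (\<phi>' (F a)) (\<phi>' (F b)))"
    using cs_hom[OF B cs O] F O by simp
  have "\<exists>!u. u \<in> hom V (E a b) (E' (F a) (F b)) \<and> e' (F a) (F b) \<cdot> u = e a b"
    using subobject_in[OF cs_sub[OF B cs O]] HF[OF O]
    by (intro subobject_ex1[OF cs_sub[OF B cs' F(1)[OF O(1)] F(1)[OF O(2)]] h]) auto
  from theI'[OF this] show "VFar (factor_vfun F E e E' e') a b \<in> hom V (E a b) (E' (F a) (F b))"
    and "e' (F a) (F b) \<cdot> VFar (factor_vfun F E e E' e') a b = e a b"
    unfolding factor_vfun_def by simp_all
qed

lemma app_VFar_factor_vfun: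
  assumes O: "a \<in> A" "b \<in> A" and u: "u \<in> el (E a b)"
  shows "app (e' (F a) (F b)) (app (VFar (factor_vfun F E e E' e') a b) u) = app (e a b) u"
  using app_comp[OF cs_hom[OF B cs' F(1)[OF O(1)] F(1)[OF O(2)]] VFar_factor_vfun(1)[OF O] u]
    VFar_factor_vfun(2)[OF O] by simp

lemma slice_morphism_factor_vfun:
  "slice_morphism V (induced_vcat V B A \<phi> E e) \<lparr> VFob = \<phi>, VFar = e \<rparr>
     (induced_vcat V B A' \<phi>' E' e') \<lparr> VFob = \<phi>', VFar = e' \<rparr> (factor_vfun F E e E' e')"
proof -
  let ?I = "induced_vcat V B A \<phi> E e" and ?I' = "induced_vcat V B A' \<phi>' E' e'"
    and ?F = "factor_vfun F E e E' e'"
  have simps: "VObj ?I = A" "VHom ?I = E" "VObj ?I' = A'" "VHom ?I' = E'" "VFob ?F = F"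
    unfolding induced_vcat_def factor_vfun_def by simp_all
  have u: "app (VFar ?F a b) u \<in> el (E' (F a) (F b))" if "a \<in> A" "b \<in> A" "u \<in> el (E a b)" for a b u
    using app_in[OF VFar_factor_vfun(1)[OF that(1,2)] that(3)] .
  have "is_vfunctor V ?I ?I' ?F"
  proof (rule is_vfunctorI[OF vcategory_induced[OF B cs] vcategory_induced[OF B cs']], unfold simps)
    fix a assume a: "a \<in> A"
    show "app (VFar ?F a a) (app (VId ?I a) star) = app (VId ?I' (F a)) star"
    proof (rule subobject_inj[OF cs_sub[OF B cs' F(1)[OF a] F(1)[OF a]]])
      have i: "app (VId ?I a) star \<in> el (E a a)" "app (VId ?I' (F a)) star \<in> el (E' (F a) (F a))"
        using app_in[OF induced_VId(1)[OF B cs a], of star]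
          app_in[OF induced_VId(1)[OF B cs' F(1)[OF a]], of star] by (simp_all add: el_Unit)
      then show "app (VFar ?F a a) (app (VId ?I a) star) \<in> el (E' (F a) (F a))"
        "app (VId ?I' (F a)) star \<in> el (E' (F a) (F a))"
        using u a by auto
      show "app (e' (F a) (F a)) (app (VFar ?F a a) (app (VId ?I a) star)) =
          app (e' (F a) (F a)) (app (VId ?I' (F a)) star)"
        using a i F app_induced_VId[OF B cs a] app_induced_VId[OF B cs' F(1)[OF a]]
        by (simp add: app_VFar_factor_vfun)
    qed
  next
    fix a b c u v assume O: "a \<in> A" "b \<in> A" "c \<in> A" and uv: "u \<in> el (E a b)" "v \<in> el (E b c)"
    note FO = F(1)[OF O(1)] F(1)[OF O(2)] F(1)[OF O(3)]
    have i: "app (VComp ?I a b c) (kpair v u) \<in> el (E a c)"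
      using uv O by (intro app_in[OF induced_VComp(1)[OF B cs O]]) (simp add: cs_Obj[OF B cs])
    have j: "kpair (app (VFar ?F b c) v) (app (VFar ?F a b) u) \<in> el (E' (F b) (F c) \<otimes> E' (F a) (F b))"
      using uv O FO by (simp add: cs_Obj[OF B cs'] u)
    show "app (VFar ?F a c) (app (VComp ?I a b c) (kpair v u)) =
        app (VComp ?I' (F a) (F b) (F c)) (kpair (app (VFar ?F b c) v) (app (VFar ?F a b) u))"
      using O uv i F u app_in[OF induced_VComp(1)[OF B cs' FO] j]
      by - (rule subobject_inj[OF cs_sub[OF B cs' FO(1) FO(3)]],
        simp_all add: app_VFar_factor_vfun app_induced_VComp[OF B cs] app_induced_VComp[OF B cs'])
  qed (simp_all add: F VFar_factor_vfun)
  moreover have "vfun_eq ?I (vfun_comp V \<lparr> VFob = \<phi>', VFar = e' \<rparr> ?F) \<lparr> VFob = \<phi>, VFar = e \<rparr>"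
    unfolding vfun_eq_def vfun_comp_def using F VFar_factor_vfun(2) by (simp add: simps)
  ultimately show ?thesis
    unfolding slice_morphism_def by blast
qed

end

text \<open>On each hom-object, the composite and the identity both become \<open>e a b\<close>
  after composition with the embedding \<open>e a b\<close>, which can be cancelled.\<close>

lemma vfun_comp_factor_vfun:
  fixes B :: "('b, 'o, 'm) vcat"
  assumes B: "vcategory V B" and cs: "closed_subobjects B A \<phi> H E e"
    and cs': "closed_subobjects B A' \<phi>' H' E' e'"
    and F: "\<And>a. a \<in> A \<Longrightarrow> F a \<in> A'" "\<And>a. a \<in> A \<Longrightarrow> \<phi>' (F a) = \<phi> a"
    and G: "\<And>a. a \<in> A' \<Longrightarrow> G a \<in> A" "\<And>a. a \<in> A' \<Longrightarrow> \<phi> (G a) = \<phi>' a"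
    and HF: "\<And>a b. a \<in> A \<Longrightarrow> b \<in> A \<Longrightarrow> H a b \<subseteq> H' (F a) (F b)"
    and HG: "\<And>a b. a \<in> A' \<Longrightarrow> b \<in> A' \<Longrightarrow> H' a b \<subseteq> H (G a) (G b)"
    and GF: "\<And>a. a \<in> A \<Longrightarrow> G (F a) = a"
  shows "vfun_eq (induced_vcat V B A \<phi> E e)
    (vfun_comp V (factor_vfun G E' e' E e) (factor_vfun F E e E' e')) (vfun_id V (induced_vcat V B A \<phi> E e))"
proof -
  let ?F = "factor_vfun F E e E' e'" and ?G = "factor_vfun G E' e' E e"
  have "VFar ?G (F a) (F b) \<cdot> VFar ?F a b = Ident V (E a b)" if O: "a \<in> A" "b \<in> A" for a b
  proof (rule subobject_cancel[OF cs_sub[OF B cs O]])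
    note f = VFar_factor_vfun[of B A \<phi> H E e A' \<phi>' H' E' e' F, OF B cs cs' F HF O]
    note g = VFar_factor_vfun[of B A' \<phi>' H' E' e' A \<phi> H E e G, OF B cs' cs G HG F(1)[OF O(1)] F(1)[OF O(2)],
        unfolded GF[OF O(1)] GF[OF O(2)]]
    show "VFar ?G (F a) (F b) \<cdot> VFar ?F a b \<in> hom V (E a b) (E a b)"
      by (rule comp_hom[OF g(1) f(1)])
    show "Ident V (E a b) \<in> hom V (E a b) (E a b)"
      using cs_Obj[OF B cs O] by simp
    have "e a b \<cdot> (VFar ?G (F a) (F b) \<cdot> VFar ?F a b) = e' (F a) (F b) \<cdot> VFar ?F a b"
      using comp_assoc[OF cs_hom[OF B cs O] g(1) f(1)] g(2) by simp
    then show "e a b \<cdot> (VFar ?G (F a) (F b) \<cdot> VFar ?F a b) = e a b \<cdot> Ident V (E a b)"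
      using f(2) comp_Ident[OF cs_hom[OF B cs O]] by simp
  qed
  then show ?thesis
    unfolding vfun_eq_def vfun_comp_def vfun_id_def
    using GF by (simp add: induced_vcat_def) (simp add: factor_vfun_def)
qed

text \<open>Reduces an isomorphism over \<open>B\<close> to set-level data: a bijection of objects
  that respects the images in \<open>B\<close> and the sets of elements of hom-objects. The
  structure of the hom-objects is carried along because each is determined by its set of elements
  inside that of \<open>B\<close>.\<close>

lemma slice_iso_induced:
  fixes B :: "('b, 'o, 'm) vcat"
  assumes B: "vcategory V B" and cs: "closed_subobjects B A \<phi> H E e"
    and cs': "closed_subobjects B A' \<phi>' H' E' e'"
    and F: "\<And>a. a \<in> A \<Longrightarrow> F a \<in> A'" "\<And>a. a \<in> A \<Longrightarrow> \<phi>' (F a) = \<phi> a"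
    and G: "\<And>a. a \<in> A' \<Longrightarrow> G a \<in> A"
    and HF: "\<And>a b. a \<in> A \<Longrightarrow> b \<in> A \<Longrightarrow> H' (F a) (F b) = H a b"
    and GF: "\<And>a. a \<in> A \<Longrightarrow> G (F a) = a" and FG: "\<And>a. a \<in> A' \<Longrightarrow> F (G a) = a"
  shows "slice_iso V B (induced_vcat V B A \<phi> E e) \<lparr> VFob = \<phi>, VFar = e \<rparr>
     (induced_vcat V B A' \<phi>' E' e') \<lparr> VFob = \<phi>', VFar = e' \<rparr> (factor_vfun F E e E' e')"
proof -
  have G2: "\<phi> (G a) = \<phi>' a" if "a \<in> A'" for a
    using F(2)[OF G[OF that]] FG[OF that] by simp
  have HF': "H a b \<subseteq> H' (F a) (F b)" if "a \<in> A" "b \<in> A" for a b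
    using HF that by simp
  have HG: "H' a b \<subseteq> H (G a) (G b)" if "a \<in> A'" "b \<in> A'" for a b
    using HF[OF G G, OF that] FG that by simp
  show ?thesis
    unfolding slice_iso_def
    using slice_object_induced[OF B cs] slice_object_induced[OF B cs']
      slice_morphism_factor_vfun[of B A \<phi> H E e A' \<phi>' H' E' e' F, OF B cs cs' F HF']
      slice_morphism_factor_vfun[of B A' \<phi>' H' E' e' A \<phi> H E e G, OF B cs' cs G G2 HG]
      vfun_comp_factor_vfun[of B A \<phi> H E e A' \<phi>' H' E' e' F G, OF B cs cs' F G G2 HF' HG GF]
      vfun_comp_factor_vfun[of B A' \<phi>' H' E' e' A \<phi> H E e G F, OF B cs' cs G G2 F HG HF' FG]
    by blast
qed

section \<open>Elements of internal homs as arrows, uncurrying, and evaluation at an element\<close>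

lemma Ihom_elem_eqI:
  assumes "X \<in> Obj V" "Y \<in> Obj V" "u \<in> el (Ihom V X Y)" "v \<in> el (Ihom V X Y)"
    and "\<And>m n. m \<in> hom V X Y \<Longrightarrow> n \<in> hom V X Y \<Longrightarrow> \<forall>x\<in>el X. app m x = ev X Y u x \<Longrightarrow>
      \<forall>x\<in>el X. app n x = ev X Y v x \<Longrightarrow> m = n"
  shows "u = v"
  using arr_of_elem[OF assms(1-3)] arr_of_elem[OF assms(1,2,4)] assms(5)
  by (metis Ihom_eqI[OF assms(1-4)])

text \<open>Turns a mapping property of \<open>X\<close>, such as that of a copower, into arrows out
  of its tensor product with \<open>Y\<close>. The tensor order is exchanged so that
  \<open>X\<close> ends up on the right.\<close>

lemma flip_ex:
  assumes h: "h \<in> hom V X (Ihom V Y Z)" and Y: "Y \<in> Obj V" and Z: "Z \<in> Obj V"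
  shows "\<exists>m\<in>hom V (Y \<otimes> X) Z. \<forall>x\<in>el X. \<forall>y\<in>el Y. app m (kpair y x) = ev Y Z (app h x) y"
proof (intro bexI ballI)
  note t = h hom_Obj[OF h] Y Z Eval_typing
  show "Eval V Y Z \<cdot> (h \<odot> Ident V Y) \<cdot> Swap V Y X \<in> hom V (Y \<otimes> X) Z"
    using t by (simp add: arr_simps)
  fix x y assume "x \<in> el X" "y \<in> el Y"
  then show "app (Eval V Y Z \<cdot> (h \<odot> Ident V Y) \<cdot> Swap V Y X) (kpair y x) = ev Y Z (app h x) y"
    using t by (simp add: arr_simps ev_def)
qed

text \<open>Evaluation with exchanged arguments transposes to X -> [[X, Y], Y], and the value at
  \<open>x\<close> names the required arrow.\<close>

lemma eval_at_ex:
  assumes X: "X \<in> Obj V" and Y: "Y \<in> Obj V" and x: "x \<in> el X"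
  shows "\<exists>m\<in>hom V (Ihom V X Y) Y. \<forall>u\<in>el (Ihom V X Y). app m u = ev X Y u x"
proof -
  let ?H = "Ihom V X Y"
  have h: "Eval V X Y \<cdot> Swap V X ?H \<in> hom V (X \<otimes> ?H) Y"
    using X Y by (simp add: arr_simps Eval_typing)
  have "app (adjunct V X ?H Y (Eval V X Y \<cdot> Swap V X ?H)) x \<in> el (Ihom V ?H Y)"
    using x by (intro app_in[OF adjunct_hom[OF Ihom_Obj[OF X Y] X h]])
  from arr_of_elem[OF Ihom_Obj[OF X Y] Y this] obtain m where m: "m \<in> hom V ?H Y"
    "\<And>u. u \<in> el ?H \<Longrightarrow> app m u = ev ?H Y (app (adjunct V X ?H Y (Eval V X Y \<cdot> Swap V X ?H)) x) u"
    by blast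
  have "app m u = ev X Y u x" if u: "u \<in> el ?H" for u
    using m(2)[OF u] ev_adjunct[OF Ihom_Obj[OF X Y] X h x u] X Y x u
    by (simp add: arr_simps Eval_typing ev_def)
  then show ?thesis
    using m(1) by blast
qed

text \<open>X \<otimes> - is a left adjoint and so preserves the initial object: an arrow 0 ->
  [X, Z] is uncurried. This supplies the components of \<open>spread\<close> off the output
  sort.\<close>

lemma tensor_empty_arr_ex:
  assumes X: "X \<in> Obj V" and Z: "Z \<in> Obj V"
  shows "\<exists>m. m \<in> hom V (X \<otimes> copower V 0 (Unit V)) Z"
proof -
  obtain h where "h \<in> hom V (copower V 0 (Unit V)) (Ihom V X Z)"
    using copower_arr_ex[OF Ihom_Obj[OF X Z], of 0] by blast
  from flip_ex[OF this X Z] show ?thesis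
    by blast
qed

section \<open>The enriched structure of \<open>V\<close> on elements\<close>

lemma VId_self:
  assumes "X \<in> Obj V"
  shows "VId (self_vcat V) X \<in> hom V (Unit V) (Ihom V X X)"
    and "x \<in> el X \<Longrightarrow> ev X X (app (VId (self_vcat V) X) star) x = x"
  unfolding self_vcat_def
  using assms adjunct_hom[OF assms Unit_Obj Lunit_hom[OF assms]]
    ev_adjunct[OF assms Unit_Obj Lunit_hom[OF assms], of star x]
  by (simp_all add: el_Unit app_Lunit)

lemma VComp_self:
  assumes O: "X \<in> Obj V" "Y \<in> Obj V" "Z \<in> Obj V"
  shows "VComp (self_vcat V) X Y Z \<in> hom V (Ihom V Y Z \<otimes> Ihom V X Y) (Ihom V X Z)"
    and "u \<in> el (Ihom V X Y) \<Longrightarrow> v \<in> el (Ihom V Y Z) \<Longrightarrow> x \<in> el X \<Longrightarrow>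
      ev X Z (app (VComp (self_vcat V) X Y Z) (kpair v u)) x = ev Y Z v (ev X Y u x)"
proof -
  let ?m = "Eval V Y Z \<cdot> (Ident V (Ihom V Y Z) \<odot> Eval V X Y) \<cdot> Assoc V (Ihom V Y Z) (Ihom V X Y) X"
  have m: "?m \<in> hom V ((Ihom V Y Z \<otimes> Ihom V X Y) \<otimes> X) Z"
    using O by (simp add: arr_simps Eval_typing)
  have T: "Ihom V Y Z \<otimes> Ihom V X Y \<in> Obj V"
    using O by simp
  show "VComp (self_vcat V) X Y Z \<in> hom V (Ihom V Y Z \<otimes> Ihom V X Y) (Ihom V X Z)"
    using adjunct_hom[OF O(1) T m] unfolding self_vcat_def by simp
  assume u: "u \<in> el (Ihom V X Y)" and v: "v \<in> el (Ihom V Y Z)" and x: "x \<in> el X"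
  have "ev X Z (app (VComp (self_vcat V) X Y Z) (kpair v u)) x = app ?m (kpair (kpair v u) x)"
    using ev_adjunct[OF O(1) T m, of "kpair v u" x] u v x O unfolding self_vcat_def by simp
  then show "ev X Z (app (VComp (self_vcat V) X Y Z) (kpair v u)) x = ev Y Z v (ev X Y u x)"
    using O u v x by (simp add: arr_simps Eval_typing ev_def)
qed

lemma small_lessThan: "small_collection TYPE('u) {..<n::nat}"
proof -
  obtain c :: "nat \<Rightarrow> 'u" where c: "inj c" "\<And>N. small (c ` N)"
    using ex_small_indexing by blast
  then have "{..<n} = inv c ` c ` {..<n}"
    by (simp add: image_image)
  then show ?thesis
    using c(2) unfolding small_collection_def by blast
qed

end

locale sorted_smcc = topological_smcc V U
  for V :: "('o, 'm) smccat" (structure) and U :: "('o, 'm, 'u::set_universe) setfunctor" +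
  fixes S :: "'u set"
  assumes small_S: "small S"
begin

section \<open>The powers of V\<close>

abbreviation fam :: "('u \<Rightarrow> 'o) \<Rightarrow> bool" where "fam A \<equiv> \<forall>s\<in>S. A s \<in> Obj V"

lemma small_sorts: "small_collection TYPE('u) S"
  unfolding small_collection_def using small_S by (intro exI[of _ S] exI[of _ "\<lambda>x. x"]) simp

definition act :: "('u \<Rightarrow> 'o) \<Rightarrow> ('u \<Rightarrow> 'o) \<Rightarrow> 'u \<Rightarrow> 'u \<Rightarrow> 'u \<Rightarrow> 'u" where
  "act A B w s x = ev (A s) (B s) (app (pow_proj V S A B s) w) x"

lemma
  assumes "fam A" "fam B"
  shows pow_hom_Obj [simp]: "pow_hom V S A B \<in> Obj V"
    and pow_proj_hom: "s \<in> S \<Longrightarrow> pow_proj V S A B s \<in> hom V (pow_hom V S A B) (Ihom V (A s) (B s))"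
  using assms prod_obj_Obj[OF small_sorts, of "\<lambda>s. Ihom V (A s) (B s)"]
    prod_proj_hom[OF small_sorts, of "\<lambda>s. Ihom V (A s) (B s)" s]
  unfolding pow_hom_def pow_proj_def by simp_all

lemma act_in:
  assumes "fam A" "fam B" "w \<in> el (pow_hom V S A B)" "s \<in> S" "x \<in> el (A s)"
  shows "act A B w s x \<in> el (B s)"
  using assms app_in[OF pow_proj_hom] unfolding act_def by auto

lemma pow_eqI:
  assumes AB: "fam A" "fam B" and w: "w \<in> el (pow_hom V S A B)" "w' \<in> el (pow_hom V S A B)"
    and eq: "\<And>s x. s \<in> S \<Longrightarrow> x \<in> el (A s) \<Longrightarrow> act A B w s x = act A B w' s x"
  shows "w = w'"
proof (rule prod_eqI[OF small_sorts _ w[unfolded pow_hom_def]])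
  fix s assume s: "s \<in> S"
  show "Ihom V (A s) (B s) \<in> Obj V"
    using AB s by simp
  show "app (prod_proj V S (\<lambda>s. Ihom V (A s) (B s)) s) w = app (prod_proj V S (\<lambda>s. Ihom V (A s) (B s)) s) w'"
    using Ihom_eqI[of "A s" "B s", OF _ _ app_in[OF pow_proj_hom[OF AB s] w(1)]
        app_in[OF pow_proj_hom[OF AB s] w(2)]] AB s eq[OF s]
    unfolding act_def pow_proj_def by simp
qed

lemma into_pow_hom:
  assumes AB: "fam A" "fam B" and Z: "Z \<in> Obj V"
    and f: "\<And>s. s \<in> S \<Longrightarrow> f s \<in> hom V Z (Ihom V (A s) (B s))"
  shows into_pow_hom_hom: "into_pow_hom V S A B Z f \<in> hom V Z (pow_hom V S A B)"
    and act_into_pow_hom: "s \<in> S \<Longrightarrow> z \<in> el Z \<Longrightarrow>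
      act A B (app (into_pow_hom V S A B Z f) z) s x = ev (A s) (B s) (app (f s) z) x"
proof -
  have O: "Ihom V (A s) (B s) \<in> Obj V" if "s \<in> S" for s
    using AB that by simp
  show "into_pow_hom V S A B Z f \<in> hom V Z (pow_hom V S A B)"
    unfolding into_pow_hom_def pow_hom_def using tuple_hom[OF small_sorts O Z f] by simp
  show "act A B (app (into_pow_hom V S A B Z f) z) s x = ev (A s) (B s) (app (f s) z) x"
    if "s \<in> S" "z \<in> el Z"
    unfolding act_def into_pow_hom_def pow_proj_def
    using app_proj_tuple[OF small_sorts O Z f that] by simp
qed

lemma VObj_pow: "VObj (pow_vcat V S) = S \<rightarrow>\<^sub>E Obj V" and VHom_pow: "VHom (pow_vcat V S) = pow_hom V S"
  unfolding pow_vcat_def by simp_all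

lemma VId_pow:
  assumes "fam A"
  shows "VId (pow_vcat V S) A \<in> hom V (Unit V) (pow_hom V S A A)"
    and "s \<in> S \<Longrightarrow> x \<in> el (A s) \<Longrightarrow> act A A (app (VId (pow_vcat V S) A) star) s x = x"
  unfolding pow_vcat_def
  using assms into_pow_hom[OF assms assms Unit_Obj, of "\<lambda>s. VId (self_vcat V) (A s)"] VId_self
  by (simp_all add: el_Unit)

lemma VComp_pow:
  assumes O: "fam A" "fam B" "fam C"
  shows VComp_pow_hom:
      "VComp (pow_vcat V S) A B C \<in> hom V (pow_hom V S B C \<otimes> pow_hom V S A B) (pow_hom V S A C)"
    and act_VComp: "u \<in> el (pow_hom V S A B) \<Longrightarrow> v \<in> el (pow_hom V S B C) \<Longrightarrow> s \<in> S \<Longrightarrow> x \<in> el (A s) \<Longrightarrow>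
      act A C (app (VComp (pow_vcat V S) A B C) (kpair v u)) s x = act B C v s (act A B u s x)"
proof -
  let ?f = "\<lambda>s. VComp (self_vcat V) (A s) (B s) (C s) \<cdot> (pow_proj V S B C s \<odot> pow_proj V S A B s)"
  have t: "pow_proj V S B C s \<in> hom V (pow_hom V S B C) (Ihom V (B s) (C s))"
    "pow_proj V S A B s \<in> hom V (pow_hom V S A B) (Ihom V (A s) (B s))"
    "VComp (self_vcat V) (A s) (B s) (C s) \<in> hom V (Ihom V (B s) (C s) \<otimes> Ihom V (A s) (B s)) (Ihom V (A s) (C s))"
    if "s \<in> S" for s
    using that O pow_proj_hom VComp_self(1) by auto
  have f: "?f s \<in> hom V (pow_hom V S B C \<otimes> pow_hom V S A B) (Ihom V (A s) (C s))" if "s \<in> S" for s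
    using t[OF that] by (simp add: arr_simps)
  have Z: "pow_hom V S B C \<otimes> pow_hom V S A B \<in> Obj V"
    using O by simp
  show "VComp (pow_vcat V S) A B C \<in> hom V (pow_hom V S B C \<otimes> pow_hom V S A B) (pow_hom V S A C)"
    using into_pow_hom_hom[OF O(1) O(3) Z f] unfolding pow_vcat_def by simp
  assume uv: "u \<in> el (pow_hom V S A B)" "v \<in> el (pow_hom V S B C)" and s: "s \<in> S" and x: "x \<in> el (A s)"
  have "act A C (app (VComp (pow_vcat V S) A B C) (kpair v u)) s x =
      ev (A s) (C s) (app (?f s) (kpair v u)) x"
    using act_into_pow_hom[OF O(1) O(3) Z f s, of "kpair v u" x] uv O unfolding pow_vcat_def by simp
  also have "\<dots> = act B C v s (act A B u s x)"
    unfolding act_def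
    using t[OF s] uv s x O by (simp add: arr_simps VComp_self(2))
  finally show "act A C (app (VComp (pow_vcat V S) A B C) (kpair v u)) s x = act B C v s (act A B u s x)" .
qed

lemma app_VComp_in:
  assumes "fam A" "fam B" "fam C" "u \<in> el (pow_hom V S A B)" "v \<in> el (pow_hom V S B C)"
  shows "app (VComp (pow_vcat V S) A B C) (kpair v u) \<in> el (pow_hom V S A C)"
  using assms by (intro app_in[OF VComp_pow_hom]) simp_all

lemma app_VId_in: "fam A \<Longrightarrow> app (VId (pow_vcat V S) A) star \<in> el (pow_hom V S A A)"
  by (rule app_in[OF VId_pow(1)]) (simp_all add: el_Unit)

lemma fam_PiE: "A \<in> S \<rightarrow>\<^sub>E Obj V \<Longrightarrow> fam A"
  by auto

lemma vcategory_pow: "vcategory V (pow_vcat V S)"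
proof (rule vcategoryI, unfold VObj_pow VHom_pow)
  fix A B C D u v w assume "A \<in> S \<rightarrow>\<^sub>E Obj V" "B \<in> S \<rightarrow>\<^sub>E Obj V" "C \<in> S \<rightarrow>\<^sub>E Obj V" "D \<in> S \<rightarrow>\<^sub>E Obj V"
    and e: "u \<in> el (pow_hom V S A B)" "v \<in> el (pow_hom V S B C)" "w \<in> el (pow_hom V S C D)"
  then have O: "fam A" "fam B" "fam C" "fam D"
    by (auto dest: PiE_mem)
  show "app (VComp (pow_vcat V S) A B D) (kpair (app (VComp (pow_vcat V S) B C D) (kpair w v)) u) =
      app (VComp (pow_vcat V S) A C D) (kpair w (app (VComp (pow_vcat V S) A B C) (kpair v u)))"
    using O e by - (rule pow_eqI[OF O(1) O(4)], simp_all add: app_VComp_in act_VComp act_in)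
next
  fix A B u assume "A \<in> S \<rightarrow>\<^sub>E Obj V" "B \<in> S \<rightarrow>\<^sub>E Obj V" and e: "u \<in> el (pow_hom V S A B)"
  then have O: "fam A" "fam B"
    by (auto dest: PiE_mem)
  note i = app_VId_in[OF O(1)] app_VId_in[OF O(2)]
  show "app (VComp (pow_vcat V S) A B B) (kpair (app (VId (pow_vcat V S) B) star) u) = u"
    by (rule pow_eqI[OF O app_VComp_in[OF O O(2) e i(2)] e])
      (simp add: act_VComp[OF O O(2) e i(2)] act_in[OF O e] VId_pow(2)[OF O(2)])
  show "app (VComp (pow_vcat V S) A A B) (kpair u (app (VId (pow_vcat V S) A) star)) = u"
    by (rule pow_eqI[OF O app_VComp_in[OF O(1) O i(1) e] e])
      (simp add: act_VComp[OF O(1) O i(1) e] VId_pow(2)[OF O(1)])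
qed (simp_all add: fam_PiE VId_pow(1) VComp_pow_hom)

lemma pow_post:
  assumes O: "fam A" "fam B" "fam C" and g: "\<And>s. s \<in> S \<Longrightarrow> g s \<in> hom V (B s) (C s)"
  shows pow_post_hom: "pow_post V S A B C g \<in> hom V (pow_hom V S A B) (pow_hom V S A C)"
    and act_pow_post: "w \<in> el (pow_hom V S A B) \<Longrightarrow> s \<in> S \<Longrightarrow> x \<in> el (A s) \<Longrightarrow>
      act A C (app (pow_post V S A B C g) w) s x = app (g s) (act A B w s x)"
proof -
  let ?f = "\<lambda>s. post V (A s) (g s) \<cdot> pow_proj V S A B s"
  have t: "pow_proj V S A B s \<in> hom V (pow_hom V S A B) (Ihom V (A s) (B s))"
    "post V (A s) (g s) \<in> hom V (Ihom V (A s) (B s)) (Ihom V (A s) (C s))" if "s \<in> S" for s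
    using that O pow_proj_hom post_hom[OF _ g] by auto
  have f: "?f s \<in> hom V (pow_hom V S A B) (Ihom V (A s) (C s))" if "s \<in> S" for s
    using t[OF that] by blast
  show "pow_post V S A B C g \<in> hom V (pow_hom V S A B) (pow_hom V S A C)"
    unfolding pow_post_def by (rule into_pow_hom_hom[OF O(1) O(3) pow_hom_Obj[OF O(1,2)] f])
  assume w: "w \<in> el (pow_hom V S A B)" and s: "s \<in> S" and x: "x \<in> el (A s)"
  have "act A C (app (pow_post V S A B C g) w) s x = ev (A s) (C s) (app (?f s) w) x"
    unfolding pow_post_def by (rule act_into_pow_hom[OF O(1) O(3) pow_hom_Obj[OF O(1,2)] f s w])
  then show "act A C (app (pow_post V S A B C g) w) s x = app (g s) (act A B w s x)"
    unfolding app_comp[OF t(2)[OF s] t(1)[OF s] w]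
    using O s x app_in[OF t(1)[OF s] w] by (simp add: ev_post[OF _ g] act_def)
qed

lemma pow_pre:
  assumes O: "fam A" "fam B" "fam C" and f: "\<And>s. s \<in> S \<Longrightarrow> f s \<in> hom V (A s) (B s)"
  shows pow_pre_hom: "pow_pre V S A B C f \<in> hom V (pow_hom V S B C) (pow_hom V S A C)"
    and act_pow_pre: "w \<in> el (pow_hom V S B C) \<Longrightarrow> s \<in> S \<Longrightarrow> x \<in> el (A s) \<Longrightarrow>
      act A C (app (pow_pre V S A B C f) w) s x = act B C w s (app (f s) x)"
proof -
  let ?f = "\<lambda>s. pre V (f s) (C s) \<cdot> pow_proj V S B C s"
  have t: "pow_proj V S B C s \<in> hom V (pow_hom V S B C) (Ihom V (B s) (C s))"
    "pre V (f s) (C s) \<in> hom V (Ihom V (B s) (C s)) (Ihom V (A s) (C s))" if "s \<in> S" for s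
    using that O pow_proj_hom pre_hom[OF _ f] by auto
  have h: "?f s \<in> hom V (pow_hom V S B C) (Ihom V (A s) (C s))" if "s \<in> S" for s
    using t[OF that] by blast
  show "pow_pre V S A B C f \<in> hom V (pow_hom V S B C) (pow_hom V S A C)"
    unfolding pow_pre_def by (rule into_pow_hom_hom[OF O(1) O(3) pow_hom_Obj[OF O(2,3)] h])
  assume w: "w \<in> el (pow_hom V S B C)" and s: "s \<in> S" and x: "x \<in> el (A s)"
  have "act A C (app (pow_pre V S A B C f) w) s x = ev (A s) (C s) (app (?f s) w) x"
    unfolding pow_pre_def by (rule act_into_pow_hom[OF O(1) O(3) pow_hom_Obj[OF O(2,3)] h s w])
  then show "act A C (app (pow_pre V S A B C f) w) s x = act B C w s (app (f s) x)"
    unfolding app_comp[OF t(2)[OF s] t(1)[OF s] w]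
    using O s x app_in[OF t(1)[OF s] w] by (simp add: ev_pre[OF _ f] act_def)
qed

section \<open>The argument functors of signatures\<close>

context
  fixes ss :: "'u list" and A :: "'u \<Rightarrow> 'o"
  assumes ss: "set ss \<subseteq> S" and A: "fam A"
begin

lemma nth_Obj: "i \<in> {..<length ss} \<Longrightarrow> A (ss ! i) \<in> Obj V"
  using ss A nth_mem[of i ss] by blast

lemma sorts_power_Obj: "sorts_power V ss A \<in> Obj V"
  and sorts_proj_hom: "i < length ss \<Longrightarrow> sorts_proj V ss A i \<in> hom V (sorts_power V ss A) (A (ss ! i))"
  unfolding sorts_power_def sorts_proj_def
  using prod_obj_Obj[OF small_lessThan nth_Obj] prod_proj_hom[OF small_lessThan nth_Obj] by auto

lemma into_sorts_power:
  assumes Z: "Z \<in> Obj V" and f: "\<And>i. i < length ss \<Longrightarrow> f i \<in> hom V Z (A (ss ! i))"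
  shows into_sorts_power_hom: "into_sorts_power V ss A Z f \<in> hom V Z (sorts_power V ss A)"
    and app_proj_into: "i < length ss \<Longrightarrow> z \<in> el Z \<Longrightarrow>
      app (sorts_proj V ss A i) (app (into_sorts_power V ss A Z f) z) = app (f i) z"
  unfolding sorts_power_def sorts_proj_def into_sorts_power_def
  using tuple_hom[OF small_lessThan nth_Obj Z, where f = f]
    app_proj_tuple[OF small_lessThan nth_Obj Z, where f = f] f
  by simp_all

lemma sorts_power_eqI:
  assumes "x \<in> el (sorts_power V ss A)" "y \<in> el (sorts_power V ss A)"
    and "\<And>i. i < length ss \<Longrightarrow> app (sorts_proj V ss A i) x = app (sorts_proj V ss A i) y"
  shows "x = y"
  using prod_eqI[OF small_lessThan nth_Obj] assms unfolding sorts_power_def sorts_proj_def by auto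

end

text \<open>The product of the components of \<open>w\<close> along the list of sorts. It is read
  off from the enriched functor because the hom-objects are defined through that functor;
  \<open>proj_smap\<close> recovers the coordinatewise description.\<close>

definition smap :: "'u list \<Rightarrow> ('u \<Rightarrow> 'o) \<Rightarrow> ('u \<Rightarrow> 'o) \<Rightarrow> 'u \<Rightarrow> 'u \<Rightarrow> 'u" where
  "smap ss A B w t =
     ev (sorts_power V ss A) (sorts_power V ss B) (app (VFar (sorts_power_vfun V S ss) A B) w) t"

lemma
  assumes ss: "set ss \<subseteq> S" and O: "fam A" "fam B"
  shows sorts_power_vfun_hom: "VFar (sorts_power_vfun V S ss) A B \<in>
      hom V (pow_hom V S A B) (Ihom V (sorts_power V ss A) (sorts_power V ss B))"
    and smap_in: "w \<in> el (pow_hom V S A B) \<Longrightarrow> t \<in> el (sorts_power V ss A) \<Longrightarrow>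
      smap ss A B w t \<in> el (sorts_power V ss B)"
    and proj_smap: "w \<in> el (pow_hom V S A B) \<Longrightarrow> t \<in> el (sorts_power V ss A) \<Longrightarrow> i < length ss \<Longrightarrow>
      app (sorts_proj V ss B i) (smap ss A B w t) = act A B w (ss ! i) (app (sorts_proj V ss A i) t)"
proof -
  let ?A = "sorts_power V ss A" and ?H = "pow_hom V S A B"
  let ?f = "\<lambda>i. Eval V (A (ss ! i)) (B (ss ! i)) \<cdot> (pow_proj V S A B (ss ! i) \<odot> sorts_proj V ss A i)"
  let ?g = "into_sorts_power V ss B (?H \<otimes> ?A) ?f"
  have nth: "ss ! i \<in> S" if "i < length ss" for i
    using that ss nth_mem by blast
  note AO = sorts_power_Obj[OF ss O(1)] and HO = pow_hom_Obj[OF O]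
  have f: "?f i \<in> hom V (?H \<otimes> ?A) (B (ss ! i))" if "i < length ss" for i
    using that nth[OF that] O sorts_proj_hom[OF ss O(1)] pow_proj_hom[OF O] Eval_typing
    by (simp add: arr_simps)
  have g: "?g \<in> hom V (?H \<otimes> ?A) (sorts_power V ss B)"
    by (rule into_sorts_power_hom[OF ss O(2) tensor_Obj[OF HO AO] f])
  have eq: "VFar (sorts_power_vfun V S ss) A B = adjunct V ?H ?A (sorts_power V ss B) ?g"
    unfolding sorts_power_vfun_def by simp
  show "VFar (sorts_power_vfun V S ss) A B \<in> hom V ?H (Ihom V ?A (sorts_power V ss B))"
    unfolding eq by (rule adjunct_hom[OF AO HO g])
  assume w: "w \<in> el ?H" and t: "t \<in> el ?A"
  have sm: "smap ss A B w t = app ?g (kpair w t)"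
    unfolding smap_def eq by (rule ev_adjunct[OF AO HO g w t])
  have wt: "kpair w t \<in> el (?H \<otimes> ?A)"
    using w t AO HO by simp
  show "smap ss A B w t \<in> el (sorts_power V ss B)"
    unfolding sm by (rule app_in[OF g wt])
  assume i: "i < length ss"
  have "app (sorts_proj V ss B i) (smap ss A B w t) = app (?f i) (kpair w t)"
    unfolding sm by (rule app_proj_into[OF ss O(2) tensor_Obj[OF HO AO] f i wt])
  then show "app (sorts_proj V ss B i) (smap ss A B w t) = act A B w (ss ! i) (app (sorts_proj V ss A i) t)"
    using i nth[OF i] O AO w t sorts_proj_hom[OF ss O(1)] pow_proj_hom[OF O] Eval_typing
    by (simp add: arr_simps act_def ev_def)
qed

text \<open>The homomorphism condition for one operation at an element \<open>w\<close> of V^S(A,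
  B). It is the common form of three conditions: the equalizer conditions for the two kinds of
  signature, and the equation that defines ordinary homomorphisms.\<close>

definition hom_at ::
  "'u list \<Rightarrow> 'u \<Rightarrow> 'o \<Rightarrow> ('u \<Rightarrow> 'o) \<Rightarrow> ('u \<Rightarrow> 'o) \<Rightarrow> 'm \<Rightarrow> 'm \<Rightarrow> 'u \<Rightarrow> bool" where
  "hom_at ss s P A B a b w \<longleftrightarrow> (\<forall>p\<in>el P. \<forall>t\<in>el (sorts_power V ss A).
     app b (kpair p (smap ss A B w t)) = act A B w s (app a (kpair p t)))"

lemma ltensor:
  assumes O: "P \<in> Obj V" "X \<in> Obj V" "Y \<in> Obj V"
  shows ltensor_hom: "VFar (ltensor_vfun V P) X Y \<in> hom V (Ihom V X Y) (Ihom V (P \<otimes> X) (P \<otimes> Y))"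
    and ev_ltensor: "w \<in> el (Ihom V X Y) \<Longrightarrow> p \<in> el P \<Longrightarrow> x \<in> el X \<Longrightarrow>
      ev (P \<otimes> X) (P \<otimes> Y) (app (VFar (ltensor_vfun V P) X Y) w) (kpair p x) = kpair p (ev X Y w x)"
proof -
  let ?H = "Ihom V X Y"
  let ?m = "(Ident V P \<odot> Eval V X Y) \<cdot> Assoc V P ?H X \<cdot> (Swap V ?H P \<odot> Ident V X) \<cdot>
    inv_arr V (Assoc V ?H P X)"
  have m: "?m \<in> hom V (?H \<otimes> (P \<otimes> X)) (P \<otimes> Y)"
    using O by (simp add: arr_simps Eval_typing)
  have eq: "VFar (ltensor_vfun V P) X Y = adjunct V ?H (P \<otimes> X) (P \<otimes> Y) ?m"
    unfolding ltensor_vfun_def by simp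
  show "VFar (ltensor_vfun V P) X Y \<in> hom V ?H (Ihom V (P \<otimes> X) (P \<otimes> Y))"
    unfolding eq using O by (intro adjunct_hom m) simp_all
  assume e: "w \<in> el ?H" "p \<in> el P" "x \<in> el X"
  have "ev (P \<otimes> X) (P \<otimes> Y) (app (VFar (ltensor_vfun V P) X Y) w) (kpair p x) =
      app ?m (kpair w (kpair p x))"
    unfolding eq using O e by (intro ev_adjunct m) simp_all
  then show "ev (P \<otimes> X) (P \<otimes> Y) (app (VFar (ltensor_vfun V P) X Y) w) (kpair p x) = kpair p (ev X Y w x)"
    using O e by (simp add: arr_simps Eval_typing ev_def)
qed

lemma arg_vfun_hom:
  assumes ss: "set ss \<subseteq> S" and P: "P \<in> Obj V" and O: "fam A" "fam B"
  shows "VFar (arg_vfun V S ss P) A B \<in>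
    hom V (pow_hom V S A B) (Ihom V (P \<otimes> sorts_power V ss A) (P \<otimes> sorts_power V ss B))"
  unfolding arg_vfun_def vfun_comp_def
  using comp_hom[OF ltensor_hom[OF P sorts_power_Obj[OF ss O(1)] sorts_power_Obj[OF ss O(2)]]
      sorts_power_vfun_hom[OF ss O]]
  by (simp add: sorts_power_vfun_def)

lemma ev_arg_vfun:
  assumes ss: "set ss \<subseteq> S" and P: "P \<in> Obj V" and O: "fam A" "fam B"
    and e: "w \<in> el (pow_hom V S A B)" "p \<in> el P" "t \<in> el (sorts_power V ss A)"
  shows "ev (P \<otimes> sorts_power V ss A) (P \<otimes> sorts_power V ss B) (app (VFar (arg_vfun V S ss P) A B) w) (kpair p t) =
    kpair p (smap ss A B w t)"
proof -
  note AB = sorts_power_Obj[OF ss O(1)] sorts_power_Obj[OF ss O(2)]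
  have "app (VFar (arg_vfun V S ss P) A B) w =
      app (VFar (ltensor_vfun V P) (sorts_power V ss A) (sorts_power V ss B)) (app (VFar (sorts_power_vfun V S ss) A B) w)"
    unfolding arg_vfun_def vfun_comp_def
    using app_comp[OF ltensor_hom[OF P AB] sorts_power_vfun_hom[OF ss O] e(1)]
    by (simp add: sorts_power_vfun_def)
  then show ?thesis
    using ev_ltensor[OF P AB app_in[OF sorts_power_vfun_hom[OF ss O] e(1)] e(2,3)]
    unfolding smap_def by simp
qed

lemma op_typeD:
  assumes "op_type V S ss s P"
  shows "set ss \<subseteq> S" "s \<in> S" "P \<in> Obj V"
  using assms unfolding op_type_def by simp_all

section \<open>Homomorphism conditions for one operation\<close>

context
  fixes ss s P A B a b
  assumes ty: "op_type V S ss s P" and O: "fam A" "fam B"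
    and a: "a \<in> hom V (P \<otimes> sorts_power V ss A) (A s)" and b: "b \<in> hom V (P \<otimes> sorts_power V ss B) (B s)"
begin

lemmas type_facts = op_typeD[OF ty]

lemma algebra_condition_typing:
  shows "post V (P \<otimes> sorts_power V ss A) b \<cdot> VFar (arg_vfun V S ss P) A B \<in>
      hom V (pow_hom V S A B) (Ihom V (P \<otimes> sorts_power V ss A) (B s))"
    and "pre V a (B s) \<cdot> pow_proj V S A B s \<in>
      hom V (pow_hom V S A B) (Ihom V (P \<otimes> sorts_power V ss A) (B s))"
  using comp_hom[OF post_hom[OF tensor_Obj[OF type_facts(3) sorts_power_Obj[OF type_facts(1) O(1)]] b] arg_vfun_hom[OF type_facts(1,3) O]]
    comp_hom[OF pre_hom[OF _ a] pow_proj_hom[OF O type_facts(2)]] O type_facts(2) by simp_all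

lemma algebra_condition_iff:
  assumes w: "w \<in> el (pow_hom V S A B)"
  shows "app (post V (P \<otimes> sorts_power V ss A) b \<cdot> VFar (arg_vfun V S ss P) A B) w =
      app (pre V a (B s) \<cdot> pow_proj V S A B s) w \<longleftrightarrow> hom_at ss s P A B a b w"
    (is "app ?l w = app ?r w \<longleftrightarrow> _")
proof -
  let ?X = "P \<otimes> sorts_power V ss A"
  have X: "?X \<in> Obj V" and Bs: "B s \<in> Obj V"
    using type_facts O sorts_power_Obj[OF type_facts(1) O(1)] by auto
  note arg = arg_vfun_hom[OF type_facts(1,3) O] and pr = pow_proj_hom[OF O type_facts(2)]
  have l: "ev ?X (B s) (app ?l w) (kpair p t) = app b (kpair p (smap ss A B w t))"
    if "p \<in> el P" "t \<in> el (sorts_power V ss A)" for p t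
    unfolding app_comp[OF post_hom[OF X b] arg w]
    using ev_post[OF X b app_in[OF arg w], of "kpair p t"] that ev_arg_vfun[OF type_facts(1,3) O w that]
      type_facts(3) sorts_power_Obj[OF type_facts(1) O(1)] by simp
  have r: "ev ?X (B s) (app ?r w) (kpair p t) = act A B w s (app a (kpair p t))"
    if "p \<in> el P" "t \<in> el (sorts_power V ss A)" for p t
    unfolding app_comp[OF pre_hom[OF Bs a] pr w] act_def
    using ev_pre[OF Bs a app_in[OF pr w], of "kpair p t"] that
      type_facts(3) sorts_power_Obj[OF type_facts(1) O(1)] by simp
  have "app ?l w = app ?r w \<longleftrightarrow> (\<forall>x\<in>el ?X. ev ?X (B s) (app ?l w) x = ev ?X (B s) (app ?r w) x)"
    using Ihom_eqI[OF X Bs app_in[OF algebra_condition_typing(1) w] app_in[OF algebra_condition_typing(2) w]]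
    by metis
  also have "\<dots> \<longleftrightarrow> hom_at ss s P A B a b w"
    unfolding hom_at_def using type_facts(3) sorts_power_Obj[OF type_facts(1) O(1)] l r
    by (fastforce elim!: cartesianE)
  finally show ?thesis .
qed

text \<open>Both sides compare the same values when \<open>f\<close> acts as \<open>w\<close> does.
  Ordinary naturality can thereby be used at an element of a hom-object.\<close>

lemma algebra_arrow_iff:
  assumes w: "w \<in> el (pow_hom V S A B)" and f: "f \<in> pow_arrows V S A B"
    and wf: "\<And>s x. s \<in> S \<Longrightarrow> x \<in> el (A s) \<Longrightarrow> act A B w s x = app (f s) x"
  shows "f s \<cdot> a = b \<cdot> arg_arrow V ss P A B f \<longleftrightarrow> hom_at ss s P A B a b w"
proof -
  let ?A = "sorts_power V ss A"
  let ?f = "\<lambda>i. f (ss ! i) \<cdot> sorts_proj V ss A i"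
  note AO = sorts_power_Obj[OF type_facts(1) O(1)]
  have nth: "ss ! i \<in> S" if "i < length ss" for i
    using that type_facts(1) nth_mem by blast
  have fs: "f s \<in> hom V (A s) (B s)" if "s \<in> S" for s
    using f that unfolding pow_arrows_def by auto
  have fi: "?f i \<in> hom V ?A (B (ss ! i))" if "i < length ss" for i
    using comp_hom[OF fs[OF nth[OF that]] sorts_proj_hom[OF type_facts(1) O(1) that]] .
  note t = into_sorts_power_hom[OF type_facts(1) O(2) AO fi]
  have sm: "app (into_sorts_power V ss B ?A ?f) t = smap ss A B w t" if tA: "t \<in> el ?A" for t
  proof (rule sorts_power_eqI[OF type_facts(1) O(2) app_in[OF t tA] smap_in[OF type_facts(1) O w tA]])
    fix i assume i: "i < length ss"
    have "app (sorts_proj V ss B i) (app (into_sorts_power V ss B ?A ?f) t) = app (?f i) t"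
      by (rule app_proj_into[OF type_facts(1) O(2) AO fi i tA])
    then show "app (sorts_proj V ss B i) (app (into_sorts_power V ss B ?A ?f) t) =
        app (sorts_proj V ss B i) (smap ss A B w t)"
      unfolding proj_smap[OF type_facts(1) O w tA i]
        app_comp[OF fs[OF nth[OF i]] sorts_proj_hom[OF type_facts(1) O(1) i] tA]
      using wf[OF nth[OF i] app_in[OF sorts_proj_hom[OF type_facts(1) O(1) i] tA]] by simp
  qed
  have arr: "arg_arrow V ss P A B f \<in> hom V (P \<otimes> ?A) (P \<otimes> sorts_power V ss B)"
    unfolding arg_arrow_def using tensor_hom[OF Ident_hom[OF type_facts(3)] t] .
  have app_arr: "app (arg_arrow V ss P A B f) (kpair p t) = kpair p (smap ss A B w t)"
    if "p \<in> el P" "t \<in> el ?A" for p t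
    unfolding arg_arrow_def using app_tensor[OF Ident_hom[OF type_facts(3)] t that] that type_facts(3) sm by simp
  have "f s \<cdot> a = b \<cdot> arg_arrow V ss P A B f \<longleftrightarrow>
      (\<forall>x\<in>el (P \<otimes> ?A). app (f s \<cdot> a) x = app (b \<cdot> arg_arrow V ss P A B f) x)"
    using arr_eqI[OF comp_hom[OF fs[OF type_facts(2)] a] comp_hom[OF b arr]] by metis
  also have "\<dots> \<longleftrightarrow> (\<forall>p\<in>el P. \<forall>t\<in>el ?A. app (f s \<cdot> a) (kpair p t) = app (b \<cdot> arg_arrow V ss P A B f) (kpair p t))"
    using type_facts(3) AO by (fastforce elim!: cartesianE)
  also have "\<dots> \<longleftrightarrow> hom_at ss s P A B a b w"
  proof -
    have "app (f s \<cdot> a) (kpair p t) = act A B w s (app a (kpair p t))"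
      "app (b \<cdot> arg_arrow V ss P A B f) (kpair p t) = app b (kpair p (smap ss A B w t))"
      if "p \<in> el P" "t \<in> el ?A" for p t
    proof -
      have pt: "kpair p t \<in> el (P \<otimes> ?A)"
        using that type_facts(3) AO by simp
      show "app (f s \<cdot> a) (kpair p t) = act A B w s (app a (kpair p t))"
        using app_comp[OF fs[OF type_facts(2)] a pt] wf[OF type_facts(2) app_in[OF a pt]] by simp
      show "app (b \<cdot> arg_arrow V ss P A B f) (kpair p t) = app b (kpair p (smap ss A B w t))"
        using app_comp[OF b arr pt] app_arr[OF that] by simp
    qed
    then show ?thesis
      unfolding hom_at_def by (metis (no_types, lifting))
  qed
  finally show ?thesis .
qed

end

text \<open>Provides, with \<open>hom_at_VComp\<close>, the closure conditions of
  \<open>closed_subobjects\<close> one operation at a time.\<close>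

lemma hom_at_VId:
  assumes ty: "op_type V S ss s P" and O: "fam A"
    and a: "a \<in> hom V (P \<otimes> sorts_power V ss A) (A s)"
  shows "hom_at ss s P A A a a (app (VId (pow_vcat V S) A) star)"
proof -
  note ty' = op_typeD[OF ty]
  note SO = sorts_power_Obj[OF ty'(1) O]
  let ?i = "app (VId (pow_vcat V S) A) star"
  have i: "?i \<in> el (pow_hom V S A A)"
    by (rule app_VId_in[OF O])
  have nth: "ss ! i \<in> S" if "i < length ss" for i
    using that ty'(1) nth_mem by blast
  have "smap ss A A ?i t = t" if t: "t \<in> el (sorts_power V ss A)" for t
    using smap_in[OF ty'(1) O O i t] t
    by (rule sorts_power_eqI[OF ty'(1) O])
      (simp add: proj_smap[OF ty'(1) O O i t] VId_pow(2)[OF O nth] app_in[OF sorts_proj_hom[OF ty'(1) O] t])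
  moreover have "act A A ?i s (app a (kpair p t)) = app a (kpair p t)"
    if "p \<in> el P" "t \<in> el (sorts_power V ss A)" for p t
    using app_in[OF a, of "kpair p t"] that ty' SO by (intro VId_pow(2)[OF O ty'(2)]) simp
  ultimately show ?thesis
    unfolding hom_at_def by simp
qed

lemma hom_at_VComp:
  assumes ty: "op_type V S ss s P" and O: "fam A" "fam B" "fam C"
    and a: "a \<in> hom V (P \<otimes> sorts_power V ss A) (A s)"
    and u: "u \<in> el (pow_hom V S A B)" "hom_at ss s P A B a b u"
    and v: "v \<in> el (pow_hom V S B C)" "hom_at ss s P B C b c v"
  shows "hom_at ss s P A C a c (app (VComp (pow_vcat V S) A B C) (kpair v u))"
proof -
  note ty' = op_typeD[OF ty]
  note SO = sorts_power_Obj[OF ty'(1) O(1)]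
  let ?i = "app (VComp (pow_vcat V S) A B C) (kpair v u)"
  have i: "?i \<in> el (pow_hom V S A C)"
    by (rule app_VComp_in[OF O u(1) v(1)])
  have nth: "ss ! i \<in> S" if "i < length ss" for i
    using that ty'(1) nth_mem by blast
  have sm: "smap ss A C ?i t = smap ss B C v (smap ss A B u t)" if t: "t \<in> el (sorts_power V ss A)" for t
  proof -
    note ut = smap_in[OF ty'(1) O(1,2) u(1) t]
    show ?thesis
      using smap_in[OF ty'(1) O(1,3) i t] smap_in[OF ty'(1) O(2,3) v(1) ut]
      by (rule sorts_power_eqI[OF ty'(1) O(3)])
        (simp add: proj_smap[OF ty'(1) O(1,3) i t] proj_smap[OF ty'(1) O(2,3) v(1) ut]
          proj_smap[OF ty'(1) O(1,2) u(1) t]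
          act_VComp[OF O u(1) v(1) nth] app_in[OF sorts_proj_hom[OF ty'(1) O(1)] t])
  qed
  show ?thesis
    unfolding hom_at_def
  proof (intro ballI)
    fix p t assume p: "p \<in> el P" and t: "t \<in> el (sorts_power V ss A)"
    note ut = smap_in[OF ty'(1) O(1,2) u(1) t]
    have pt: "app a (kpair p t) \<in> el (A s)"
      using app_in[OF a, of "kpair p t"] p t ty' SO by simp
    have "app c (kpair p (smap ss A C ?i t)) = act B C v s (app b (kpair p (smap ss A B u t)))"
      using v(2) p ut unfolding sm[OF t] hom_at_def by blast
    also have "\<dots> = act B C v s (act A B u s (app a (kpair p t)))"
      using u(2) p t unfolding hom_at_def by simp
    also have "\<dots> = act A C ?i s (app a (kpair p t))"
      using act_VComp[OF O u(1) v(1) ty'(2) pt] by simp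
    finally show "app c (kpair p (smap ss A C ?i t)) = act A C ?i s (app a (kpair p t))" .
  qed
qed

section \<open>Arities as lists of sorts\<close>

definition occurrences :: "'u list \<Rightarrow> 'u \<Rightarrow> nat set" where
  "occurrences ss s = {i. i < length ss \<and> ss ! i = s}"

definition arity :: "'u list \<Rightarrow> 'u \<Rightarrow> 'o" where
  "arity ss = (\<lambda>s\<in>S. copower V (card (occurrences ss s)) (Unit V))"

text \<open>The copies of \<open>I\<close> in a copower are numbered consecutively, while arguments
  are positions in the list; any enumeration of the positions that carry the sort will do.\<close>

definition slot :: "'u list \<Rightarrow> 'u \<Rightarrow> nat \<Rightarrow> nat" where
  "slot ss s = (SOME b. bij_betw b {..<card (occurrences ss s)} (occurrences ss s))"

text \<open>The point of the arity at the sort of position \<open>i\<close> that stands for the \<open>i\<close>-th argument.\<close>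

definition generic_point :: "'u list \<Rightarrow> nat \<Rightarrow> 'u" where
  "generic_point ss i = (let s = ss ! i; n = card (occurrences ss s) in
     copoint n (inv_into {..<n} (slot ss s) i))"

lemma finite_occurrences: "finite (occurrences ss s)"
  unfolding occurrences_def by simp

lemma bij_slot: "bij_betw (slot ss s) {..<card (occurrences ss s)} (occurrences ss s)"
  unfolding slot_def
  using ex_bij_betw_nat_finite[OF finite_occurrences, of ss s]
  by (intro someI_ex[of "\<lambda>b. bij_betw b _ _"]) (simp add: atLeast0LessThan)

text \<open>Only sorts in the list occur, so the number of copies is zero at all but finitely many
  sorts.\<close>

lemma arity_in_finitary: "arity ss \<in> finitary_arities V S"
proof -
  have "{s \<in> S. card (occurrences ss s) \<noteq> 0} \<subseteq> set ss"
    unfolding occurrences_def by (auto simp: card_eq_0_iff)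
  then have "finite {s \<in> S. card (occurrences ss s) \<noteq> 0}"
    by (rule finite_subset) simp
  then show ?thesis
    unfolding finitary_arities_def arity_def
    by (intro CollectI exI[of _ "\<lambda>s. card (occurrences ss s)"] conjI refl)
qed

lemma arity_Obj [simp]: "s \<in> S \<Longrightarrow> arity ss s \<in> Obj V"
  unfolding arity_def by simp

lemma slot_inv:
  assumes "i \<in> occurrences ss s"
  shows "inv_into {..<card (occurrences ss s)} (slot ss s) i < card (occurrences ss s)"
    and "slot ss s (inv_into {..<card (occurrences ss s)} (slot ss s) i) = i"
  using assms bij_slot[of ss s] inv_into_into[of i "slot ss s" "{..<card (occurrences ss s)}"]
    f_inv_into_f[of i "slot ss s" "{..<card (occurrences ss s)}"]
  unfolding bij_betw_def by auto

lemma generic_point_in: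
  assumes "i \<in> occurrences ss s" "s \<in> S"
  shows "generic_point ss i \<in> el (arity ss s)"
proof -
  have "ss ! i = s"
    using assms(1) unfolding occurrences_def by simp
  then show ?thesis
    using slot_inv(1)[OF assms(1)] assms(2) unfolding generic_point_def arity_def
    by (auto simp: Let_def)
qed

text \<open>With \<open>arity_arr_eqI\<close>, the freeness of the arity on its generic points: the
  mapping property of a copower of \<open>I\<close>, re-indexed along \<open>slot\<close>.\<close>

lemma arity_arr_ex:
  assumes s: "s \<in> S" and Z: "Z \<in> Obj V" and z: "\<And>i. i \<in> occurrences ss s \<Longrightarrow> z i \<in> el Z"
  shows "\<exists>h\<in>hom V (arity ss s) Z. \<forall>i\<in>occurrences ss s. app h (generic_point ss i) = z i"
proof -
  let ?n = "card (occurrences ss s)"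
  have "z (slot ss s k) \<in> el Z" if "k < ?n" for k
    using z that bij_slot[of ss s] unfolding bij_betw_def by blast
  from copower_arr_ex[of Z ?n "\<lambda>k. z (slot ss s k)", OF Z this]
  obtain h where h: "h \<in> hom V (copower V ?n (Unit V)) Z"
    "\<And>k. k < ?n \<Longrightarrow> app h (copoint ?n k) = z (slot ss s k)"
    by blast
  have "app h (generic_point ss i) = z i" if i: "i \<in> occurrences ss s" for i
    using h(2)[OF slot_inv(1)[OF i]] slot_inv(2)[OF i] i
    unfolding generic_point_def occurrences_def by (simp add: Let_def)
  then show ?thesis
    using h(1) s unfolding arity_def by auto
qed

lemma arity_arr_eqI:
  assumes s: "s \<in> S" and h: "h \<in> hom V (arity ss s) Z" "h' \<in> hom V (arity ss s) Z"
    and eq: "\<And>i. i \<in> occurrences ss s \<Longrightarrow> app h (generic_point ss i) = app h' (generic_point ss i)"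
  shows "h = h'"
proof (rule copower_arr_eqI)
  let ?n = "card (occurrences ss s)"
  show "h \<in> hom V (copower V ?n (Unit V)) Z" "h' \<in> hom V (copower V ?n (Unit V)) Z"
    using h s unfolding arity_def by simp_all
  fix k assume k: "k < ?n"
  then have i: "slot ss s k \<in> occurrences ss s"
    using bij_slot[of ss s] unfolding bij_betw_def by blast
  have "inv_into {..<?n} (slot ss s) (slot ss s k) = k"
    using bij_slot[of ss s] k unfolding bij_betw_def by (simp add: inv_into_f_f)
  then have "generic_point ss (slot ss s k) = copoint ?n k"
    using i unfolding generic_point_def occurrences_def by (simp add: Let_def)
  then show "app h (copoint ?n k) = app h' (copoint ?n k)"
    using eq[OF i] by simp
qed

lemma pow_arity_eqI:
  assumes A: "fam A" and u: "u \<in> el (pow_hom V S (arity ss) A)" "v \<in> el (pow_hom V S (arity ss) A)"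
    and eq: "\<And>s i. s \<in> S \<Longrightarrow> i \<in> occurrences ss s \<Longrightarrow>
      act (arity ss) A u s (generic_point ss i) = act (arity ss) A v s (generic_point ss i)"
  shows "u = v"
proof (rule pow_eqI[OF _ A u])
  fix s x assume s: "s \<in> S" and x: "x \<in> el (arity ss s)"
  have fJ: "fam (arity ss)"
    by simp
  have O: "arity ss s \<in> Obj V" "A s \<in> Obj V"
    using s A by simp_all
  let ?u = "app (pow_proj V S (arity ss) A s) u" and ?v = "app (pow_proj V S (arity ss) A s) v"
  note uv = app_in[OF pow_proj_hom[OF fJ A s] u(1)] app_in[OF pow_proj_hom[OF fJ A s] u(2)]
  \<comment> \<open>Freeness concerns arrows out of \<open>arity ss s\<close>. It applies to the
    elements \<open>?u\<close> and \<open>?v\<close> because \<open>Ihom_elem_eqI\<close> replaces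
    them by the arrows that they name.\<close>
  have "?u = ?v"
  proof (rule Ihom_elem_eqI[OF O uv])
    fix m n assume m: "m \<in> hom V (arity ss s) (A s)" "\<forall>x\<in>el (arity ss s). app m x = ev (arity ss s) (A s) ?u x"
      and n: "n \<in> hom V (arity ss s) (A s)" "\<forall>x\<in>el (arity ss s). app n x = ev (arity ss s) (A s) ?v x"
    show "m = n"
      using eq[OF s] m(2) n(2) generic_point_in[OF _ s] unfolding act_def
      by - (rule arity_arr_eqI[OF s m(1) n(1)], simp)
  qed
  then show "act (arity ss) A u s x = act (arity ss) A v s x"
    unfolding act_def by simp
qed simp

text \<open>Evaluation at the generic points identifies \<open>V\<^sup>S(J, A)\<close> with the product of the values
  of \<open>A\<close> along the list of sorts, because these points generate \<open>J\<close> freely.\<close>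

definition comparison :: "'u list \<Rightarrow> ('u \<Rightarrow> 'o) \<Rightarrow> 'm \<Rightarrow> 'm \<Rightarrow> bool" where
  "comparison ss A k l \<longleftrightarrow> k \<in> hom V (pow_hom V S (arity ss) A) (sorts_power V ss A) \<and>
    l \<in> hom V (sorts_power V ss A) (pow_hom V S (arity ss) A) \<and>
    (\<forall>u\<in>el (pow_hom V S (arity ss) A). app l (app k u) = u) \<and>
    (\<forall>t\<in>el (sorts_power V ss A). app k (app l t) = t) \<and>
    (\<forall>u\<in>el (pow_hom V S (arity ss) A). \<forall>i<length ss.
       app (sorts_proj V ss A i) (app k u) = act (arity ss) A u (ss ! i) (generic_point ss i))"

lemma comparison_ex:
  assumes ss: "set ss \<subseteq> S" and A: "fam A"
  shows "\<exists>k l. comparison ss A k l"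
proof -
  let ?J = "arity ss"
  let ?H = "pow_hom V S ?J A" and ?X = "sorts_power V ss A"
  have J: "fam ?J"
    by simp
  note H = pow_hom_Obj[OF J A] and X = sorts_power_Obj[OF ss A]
  have nth: "ss ! i \<in> S" and iocc: "i \<in> occurrences ss (ss ! i)" if "i < length ss" for i
    using that ss nth_mem unfolding occurrences_def by auto
  \<comment> \<open>Evaluation at a generic point must be an arrow of \<open>V\<close> and not just
    a function, for the universal property of the product to apply.\<close>
  have "\<exists>e\<in>hom V ?H (A (ss ! i)). \<forall>u\<in>el ?H. app e u = act ?J A u (ss ! i) (generic_point ss i)"
    if i: "i < length ss" for i
  proof -
    obtain m where m: "m \<in> hom V (Ihom V (?J (ss ! i)) (A (ss ! i))) (A (ss ! i))"
      "\<And>u. u \<in> el (Ihom V (?J (ss ! i)) (A (ss ! i))) \<Longrightarrow>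
        app m u = ev (?J (ss ! i)) (A (ss ! i)) u (generic_point ss i)"
      using eval_at_ex[OF _ _ generic_point_in[OF iocc[OF i] nth[OF i]], of "A (ss ! i)"] A nth[OF i]
      by auto
    note pr = pow_proj_hom[OF J A nth[OF i]]
    have "app (m \<cdot> pow_proj V S ?J A (ss ! i)) u = act ?J A u (ss ! i) (generic_point ss i)"
      if "u \<in> el ?H" for u
      using app_comp[OF m(1) pr that] m(2)[OF app_in[OF pr that]] unfolding act_def by simp
    then show ?thesis
      using comp_hom[OF m(1) pr] by blast
  qed
  then obtain e where e: "\<And>i. i < length ss \<Longrightarrow> e i \<in> hom V ?H (A (ss ! i))"
    "\<And>i u. i < length ss \<Longrightarrow> u \<in> el ?H \<Longrightarrow> app (e i) u = act ?J A u (ss ! i) (generic_point ss i)"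
    by metis
  define k where "k = into_sorts_power V ss A ?H e"
  have k: "k \<in> hom V ?H ?X"
    unfolding k_def using into_sorts_power_hom[OF ss A H e(1)] .
  have proj_k: "app (sorts_proj V ss A i) (app k u) = act ?J A u (ss ! i) (generic_point ss i)"
    if "i < length ss" "u \<in> el ?H" for i u
    unfolding k_def using app_proj_into[OF ss A H e(1) that] e(2)[OF that] by simp
  \<comment> \<open>For the inverse, freeness of \<open>?J s\<close> is used with values in
    [?X, A s]: the generic point of position \<open>i\<close> goes to the name of the
    \<open>i\<close>-th projection. Uncurrying gives an arrow out of ?X \<otimes> ?J s, and its
    transpose in the other variable is the component of \<open>l\<close> at
    \<open>s\<close>.\<close>
  have "\<exists>g. g \<in> hom V (?X \<otimes> ?J s) (A s) \<and> (\<forall>t\<in>el ?X. \<forall>i\<in>occurrences ss s.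
      app g (kpair t (generic_point ss i)) = app (sorts_proj V ss A i) t)" if s: "s \<in> S" for s
  proof -
    have As: "A s \<in> Obj V"
      using A s by simp
    have "\<forall>i\<in>occurrences ss s. \<exists>u\<in>el (Ihom V ?X (A s)). \<forall>t\<in>el ?X. ev ?X (A s) u t = app (sorts_proj V ss A i) t"
      using elem_of_arr sorts_proj_hom[OF ss A] unfolding occurrences_def by blast
    then obtain z where z: "\<And>i. i \<in> occurrences ss s \<Longrightarrow> z i \<in> el (Ihom V ?X (A s))"
      "\<And>i t. i \<in> occurrences ss s \<Longrightarrow> t \<in> el ?X \<Longrightarrow> ev ?X (A s) (z i) t = app (sorts_proj V ss A i) t"
      by metis
    obtain h where h: "h \<in> hom V (?J s) (Ihom V ?X (A s))"
      "\<And>i. i \<in> occurrences ss s \<Longrightarrow> app h (generic_point ss i) = z i"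
      using arity_arr_ex[OF s Ihom_Obj[OF X As], of ss z, OF z(1)] by blast
    obtain g where g: "g \<in> hom V (?X \<otimes> ?J s) (A s)"
      "\<And>x t. x \<in> el (?J s) \<Longrightarrow> t \<in> el ?X \<Longrightarrow> app g (kpair t x) = ev ?X (A s) (app h x) t"
      using flip_ex[OF h(1) X As] by blast
    have "app g (kpair t (generic_point ss i)) = app (sorts_proj V ss A i) t"
      if "t \<in> el ?X" "i \<in> occurrences ss s" for t i
      using g(2)[OF generic_point_in[OF that(2) s] that(1)] h(2)[OF that(2)] z(2)[OF that(2,1)] by simp
    then show ?thesis
      using g(1) by blast
  qed
  then obtain g where g: "\<And>s. s \<in> S \<Longrightarrow> g s \<in> hom V (?X \<otimes> ?J s) (A s)"
    "\<And>s i t. s \<in> S \<Longrightarrow> t \<in> el ?X \<Longrightarrow> i \<in> occurrences ss s \<Longrightarrow>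
      app (g s) (kpair t (generic_point ss i)) = app (sorts_proj V ss A i) t"
    by metis
  let ?f = "\<lambda>s. adjunct V ?X (?J s) (A s) (g s)"
  define l where "l = into_pow_hom V S ?J A ?X ?f"
  have f: "?f s \<in> hom V ?X (Ihom V (?J s) (A s))" if "s \<in> S" for s
    using adjunct_hom[OF arity_Obj[OF that] X g(1)[OF that]] .
  have l: "l \<in> hom V ?X ?H"
    unfolding l_def using into_pow_hom_hom[OF J A X f] .
  have act_l: "act ?J A (app l t) s (generic_point ss i) = app (sorts_proj V ss A i) t"
    if s: "s \<in> S" and t: "t \<in> el ?X" and i: "i \<in> occurrences ss s" for s t i
  proof -
    have "act ?J A (app l t) s (generic_point ss i) = ev (?J s) (A s) (app (?f s) t) (generic_point ss i)"
      unfolding l_def by (rule act_into_pow_hom[OF J A X f s t])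
    then show ?thesis
      using ev_adjunct[OF arity_Obj[OF s] X g(1)[OF s] t generic_point_in[OF i s]] g(2)[OF s t i] by simp
  qed
  have lk: "app l (app k u) = u" if u: "u \<in> el ?H" for u
  proof (rule pow_arity_eqI[OF A app_in[OF l app_in[OF k u]] u])
    fix s i assume s: "s \<in> S" and i: "i \<in> occurrences ss s"
    then have "i < length ss" "ss ! i = s"
      unfolding occurrences_def by simp_all
    then show "act ?J A (app l (app k u)) s (generic_point ss i) = act ?J A u s (generic_point ss i)"
      using act_l[OF s app_in[OF k u] i] proj_k[of i u] u by simp
  qed
  have kl: "app k (app l t) = t" if t: "t \<in> el ?X" for t
  proof (rule sorts_power_eqI[OF ss A app_in[OF k app_in[OF l t]] t])
    fix i assume i: "i < length ss"
    show "app (sorts_proj V ss A i) (app k (app l t)) = app (sorts_proj V ss A i) t"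
      using proj_k[OF i app_in[OF l t]] act_l[OF nth[OF i] t iocc[OF i]] by simp
  qed
  show ?thesis
    using k l lk kl proj_k unfolding comparison_def by blast
qed

definition args :: "'u list \<Rightarrow> ('u \<Rightarrow> 'o) \<Rightarrow> 'm" where
  "args ss A = (SOME k. \<exists>l. comparison ss A k l)"

definition unargs :: "'u list \<Rightarrow> ('u \<Rightarrow> 'o) \<Rightarrow> 'm" where
  "unargs ss A = (SOME l. comparison ss A (args ss A) l)"

lemma
  assumes "set ss \<subseteq> S" "fam A"
  shows args_hom: "args ss A \<in> hom V (pow_hom V S (arity ss) A) (sorts_power V ss A)"
    and unargs_hom: "unargs ss A \<in> hom V (sorts_power V ss A) (pow_hom V S (arity ss) A)"
    and unargs_args: "u \<in> el (pow_hom V S (arity ss) A) \<Longrightarrow> app (unargs ss A) (app (args ss A) u) = u"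
    and args_unargs: "t \<in> el (sorts_power V ss A) \<Longrightarrow> app (args ss A) (app (unargs ss A) t) = t"
    and proj_args: "u \<in> el (pow_hom V S (arity ss) A) \<Longrightarrow> i < length ss \<Longrightarrow>
      app (sorts_proj V ss A i) (app (args ss A) u) = act (arity ss) A u (ss ! i) (generic_point ss i)"
proof -
  have "\<exists>l. comparison ss A (args ss A) l"
    unfolding args_def by (rule someI_ex[OF comparison_ex[OF assms]])
  then have "comparison ss A (args ss A) (unargs ss A)"
    unfolding unargs_def by (rule someI_ex)
  then show "args ss A \<in> hom V (pow_hom V S (arity ss) A) (sorts_power V ss A)"
    "unargs ss A \<in> hom V (sorts_power V ss A) (pow_hom V S (arity ss) A)"
    "u \<in> el (pow_hom V S (arity ss) A) \<Longrightarrow> app (unargs ss A) (app (args ss A) u) = u"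
    "t \<in> el (sorts_power V ss A) \<Longrightarrow> app (args ss A) (app (unargs ss A) t) = t"
    "u \<in> el (pow_hom V S (arity ss) A) \<Longrightarrow> i < length ss \<Longrightarrow>
      app (sorts_proj V ss A i) (app (args ss A) u) = act (arity ss) A u (ss ! i) (generic_point ss i)"
    unfolding comparison_def by simp_all
qed

text \<open>At each position both sides are \<open>w\<close> applied to the value of
  \<open>u\<close> at the generic point, since composition in V^S acts on values.\<close>

lemma args_natural:
  assumes ss: "set ss \<subseteq> S" and O: "fam A" "fam B"
    and w: "w \<in> el (pow_hom V S A B)" and u: "u \<in> el (pow_hom V S (arity ss) A)"
  shows "app (args ss B) (app (VComp (pow_vcat V S) (arity ss) A B) (kpair w u)) =
    smap ss A B w (app (args ss A) u)"
proof -
  have J: "fam (arity ss)"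
    by simp
  note wu = app_VComp_in[OF J O u w] and au = app_in[OF args_hom[OF ss O(1)] u]
  show ?thesis
  proof (rule sorts_power_eqI[OF ss O(2) app_in[OF args_hom[OF ss O(2)] wu] smap_in[OF ss O w au]])
    fix i assume i: "i < length ss"
    then have s: "ss ! i \<in> S" and o: "i \<in> occurrences ss (ss ! i)"
      using ss nth_mem unfolding occurrences_def by auto
    show "app (sorts_proj V ss B i) (app (args ss B) (app (VComp (pow_vcat V S) (arity ss) A B) (kpair w u))) =
        app (sorts_proj V ss B i) (smap ss A B w (app (args ss A) u))"
      unfolding proj_args[OF ss O(2) wu i] proj_smap[OF ss O w au i] proj_args[OF ss O(1) u i]
        act_VComp[OF J O u w s generic_point_in[OF o s]] ..
  qed
qed

section \<open>The argument functors of free-form signatures\<close>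

definition ff_ob :: "('u \<Rightarrow> 'o) \<Rightarrow> ('u \<Rightarrow> 'o) \<Rightarrow> ('u \<Rightarrow> 'o) \<Rightarrow> 'u \<Rightarrow> 'o" where
  "ff_ob J P A = (\<lambda>s\<in>S. pow_hom V S J A \<otimes> P s)"

lemma VFob_ff_arg: "VFob (ff_arg_vfun V S J P) = ff_ob J P"
  unfolding ff_arg_vfun_def vfun_comp_def rtensor_vfun_def rep_vfun_def ff_ob_def
  by (simp add: VHom_pow)

lemma fam_ff_ob: "fam J \<Longrightarrow> fam P \<Longrightarrow> fam A \<Longrightarrow> fam (ff_ob J P A)"
  unfolding ff_ob_def by simp

lemma rtensor:
  assumes P: "fam P" and O: "X \<in> Obj V" "Y \<in> Obj V"
  shows rtensor_hom: "VFar (rtensor_vfun V S P) X Y \<in>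
      hom V (Ihom V X Y) (pow_hom V S (\<lambda>s\<in>S. X \<otimes> P s) (\<lambda>s\<in>S. Y \<otimes> P s))"
    and act_rtensor: "w \<in> el (Ihom V X Y) \<Longrightarrow> s \<in> S \<Longrightarrow> x \<in> el X \<Longrightarrow> p \<in> el (P s) \<Longrightarrow>
      act (\<lambda>s\<in>S. X \<otimes> P s) (\<lambda>s\<in>S. Y \<otimes> P s) (app (VFar (rtensor_vfun V S P) X Y) w) s (kpair x p) =
      kpair (ev X Y w x) p"
proof -
  let ?A = "\<lambda>s\<in>S. X \<otimes> P s" and ?B = "\<lambda>s\<in>S. Y \<otimes> P s" and ?H = "Ihom V X Y"
  let ?m = "\<lambda>s. (Eval V X Y \<odot> Ident V (P s)) \<cdot> inv_arr V (Assoc V ?H X (P s))"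
  let ?f = "\<lambda>s. adjunct V ?H (X \<otimes> P s) (Y \<otimes> P s) (?m s)"
  have AB: "fam ?A" "fam ?B" and H: "?H \<in> Obj V"
    using P O by simp_all
  have m: "?m s \<in> hom V (?H \<otimes> (X \<otimes> P s)) (Y \<otimes> P s)" if "s \<in> S" for s
    using that P O by (simp add: arr_simps Eval_typing)
  have f: "?f s \<in> hom V ?H (Ihom V (?A s) (?B s))" if "s \<in> S" for s
    using adjunct_hom[OF _ H m[OF that]] that P O by simp
  have eq: "VFar (rtensor_vfun V S P) X Y = into_pow_hom V S ?A ?B ?H ?f"
    unfolding rtensor_vfun_def by simp
  show "VFar (rtensor_vfun V S P) X Y \<in> hom V ?H (pow_hom V S ?A ?B)"
    unfolding eq by (rule into_pow_hom_hom[OF AB H f])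
  assume w: "w \<in> el ?H" and s: "s \<in> S" and x: "x \<in> el X" and p: "p \<in> el (P s)"
  have "act ?A ?B (app (VFar (rtensor_vfun V S P) X Y) w) s (kpair x p) =
      ev (?A s) (?B s) (app (?f s) w) (kpair x p)"
    unfolding eq by (rule act_into_pow_hom[OF AB H f s w])
  also have "\<dots> = app (?m s) (kpair w (kpair x p))"
    using ev_adjunct[OF _ H m[OF s] w, of "kpair x p"] s P O x p by simp
  finally show "act ?A ?B (app (VFar (rtensor_vfun V S P) X Y) w) s (kpair x p) = kpair (ev X Y w x) p"
    using s P O x p w by (simp add: arr_simps Eval_typing ev_def)
qed

lemma
  assumes O: "fam J" "fam P" "fam A" "fam B"
  shows ff_arg_hom: "VFar (ff_arg_vfun V S J P) A B \<in>
      hom V (pow_hom V S A B) (pow_hom V S (ff_ob J P A) (ff_ob J P B))"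
    and act_ff_arg: "w \<in> el (pow_hom V S A B) \<Longrightarrow> s \<in> S \<Longrightarrow> u \<in> el (pow_hom V S J A) \<Longrightarrow> p \<in> el (P s) \<Longrightarrow>
      act (ff_ob J P A) (ff_ob J P B) (app (VFar (ff_arg_vfun V S J P) A B) w) s (kpair u p) =
      kpair (app (VComp (pow_vcat V S) J A B) (kpair w u)) p"
proof -
  let ?X = "pow_hom V S J A" and ?Y = "pow_hom V S J B" and ?H = "pow_hom V S A B"
  note X = pow_hom_Obj[OF O(1,3)] and Y = pow_hom_Obj[OF O(1,4)] and H = pow_hom_Obj[OF O(3,4)]
    and C = VComp_pow_hom[OF O(1,3,4)]
  let ?r = "adjunct V ?H ?X ?Y (VComp (pow_vcat V S) J A B)"
  note r = adjunct_hom[OF X H C] and t = rtensor_hom[OF O(2) X Y]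
  have eq: "VFar (ff_arg_vfun V S J P) A B = VFar (rtensor_vfun V S P) ?X ?Y \<cdot> ?r"
    unfolding ff_arg_vfun_def vfun_comp_def rep_vfun_def by (simp add: VHom_pow)
  show "VFar (ff_arg_vfun V S J P) A B \<in> hom V ?H (pow_hom V S (ff_ob J P A) (ff_ob J P B))"
    unfolding eq ff_ob_def by (rule comp_hom[OF t r])
  assume w: "w \<in> el ?H" and s: "s \<in> S" and u: "u \<in> el ?X" and p: "p \<in> el (P s)"
  show "act (ff_ob J P A) (ff_ob J P B) (app (VFar (ff_arg_vfun V S J P) A B) w) s (kpair u p) =
      kpair (app (VComp (pow_vcat V S) J A B) (kpair w u)) p"
    unfolding eq ff_ob_def app_comp[OF t r w] act_rtensor[OF O(2) X Y app_in[OF r w] s u p]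
      ev_adjunct[OF X H C w u] ..
qed

context
  fixes J P A B a b
  assumes O: "fam J" "fam P" "fam A" "fam B"
    and a: "a \<in> pow_arrows V S (ff_ob J P A) A" and b: "b \<in> pow_arrows V S (ff_ob J P B) B"
begin

lemma ff_condition_typing:
  shows "pow_post V S (ff_ob J P A) (ff_ob J P B) B b \<cdot> VFar (ff_arg_vfun V S J P) A B \<in>
      hom V (pow_hom V S A B) (pow_hom V S (ff_ob J P A) B)"
    and "pow_pre V S (ff_ob J P A) A B a \<in> hom V (pow_hom V S A B) (pow_hom V S (ff_ob J P A) B)"
proof -
  have bs: "b s \<in> hom V (ff_ob J P B s) (B s)" and as: "a s \<in> hom V (ff_ob J P A s) (A s)" if "s \<in> S" for s
    using a b that unfolding pow_arrows_def by auto
  note T = fam_ff_ob[OF O(1,2,3)] fam_ff_ob[OF O(1,2,4)]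
  show "pow_post V S (ff_ob J P A) (ff_ob J P B) B b \<cdot> VFar (ff_arg_vfun V S J P) A B \<in>
      hom V (pow_hom V S A B) (pow_hom V S (ff_ob J P A) B)"
    by (rule comp_hom[OF pow_post_hom[OF T O(4) bs] ff_arg_hom[OF O]])
  show "pow_pre V S (ff_ob J P A) A B a \<in> hom V (pow_hom V S A B) (pow_hom V S (ff_ob J P A) B)"
    by (rule pow_pre_hom[OF T(1) O(3,4) as])
qed

text \<open>Elements of V^S(J, A) \<otimes> P at a sort are pairs, and the argument functor composes
  their first entry with \<open>w\<close>, so the equalizer condition can be read at each sort
  separately.\<close>

lemma ff_condition_iff:
  assumes w: "w \<in> el (pow_hom V S A B)"
  shows "app (pow_post V S (ff_ob J P A) (ff_ob J P B) B b \<cdot> VFar (ff_arg_vfun V S J P) A B) w =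
      app (pow_pre V S (ff_ob J P A) A B a) w \<longleftrightarrow>
    (\<forall>s\<in>S. \<forall>u\<in>el (pow_hom V S J A). \<forall>p\<in>el (P s).
      app (b s) (kpair (app (VComp (pow_vcat V S) J A B) (kpair w u)) p) =
      act A B w s (app (a s) (kpair u p)))" (is "app ?l w = app ?r w \<longleftrightarrow> ?R")
proof -
  have bs: "b s \<in> hom V (ff_ob J P B s) (B s)" and as: "a s \<in> hom V (ff_ob J P A s) (A s)" if "s \<in> S" for s
    using a b that unfolding pow_arrows_def by auto
  note T = fam_ff_ob[OF O(1,2,3)] fam_ff_ob[OF O(1,2,4)] and F = ff_arg_hom[OF O]
  note X = pow_hom_Obj[OF O(1,3)]
  have l: "act (ff_ob J P A) B (app ?l w) s (kpair u p) =
      app (b s) (kpair (app (VComp (pow_vcat V S) J A B) (kpair w u)) p)"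
    if s: "s \<in> S" and u: "u \<in> el (pow_hom V S J A)" and p: "p \<in> el (P s)" for s u p
  proof -
    have up: "kpair u p \<in> el (ff_ob J P A s)"
      using s u p X O unfolding ff_ob_def by simp
    have "app ?l w = app (pow_post V S (ff_ob J P A) (ff_ob J P B) B b) (app (VFar (ff_arg_vfun V S J P) A B) w)"
      by (rule app_comp[OF pow_post_hom[OF T O(4) bs] F w])
    moreover have "act (ff_ob J P A) B \<dots> s (kpair u p) =
        app (b s) (act (ff_ob J P A) (ff_ob J P B) (app (VFar (ff_arg_vfun V S J P) A B) w) s (kpair u p))"
      by (rule act_pow_post[OF T O(4) bs app_in[OF F w] s up])
    ultimately have "act (ff_ob J P A) B (app ?l w) s (kpair u p) =
        app (b s) (act (ff_ob J P A) (ff_ob J P B) (app (VFar (ff_arg_vfun V S J P) A B) w) s (kpair u p))"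
      by simp
    then show ?thesis
      unfolding act_ff_arg[OF O w s u p] .
  qed
  have r: "act (ff_ob J P A) B (app ?r w) s x = act A B w s (app (a s) x)"
    if "s \<in> S" "x \<in> el (ff_ob J P A s)" for s x
    by (rule act_pow_pre[OF T(1) O(3,4) as w that])
  have "app ?l w = app ?r w \<longleftrightarrow>
      (\<forall>s\<in>S. \<forall>x\<in>el (ff_ob J P A s). act (ff_ob J P A) B (app ?l w) s x = act (ff_ob J P A) B (app ?r w) s x)"
    using pow_eqI[OF T(1) O(4) app_in[OF ff_condition_typing(1) w] app_in[OF ff_condition_typing(2) w]]
    by metis
  also have "\<dots> \<longleftrightarrow> (\<forall>s\<in>S. \<forall>u\<in>el (pow_hom V S J A). \<forall>p\<in>el (P s).
      act (ff_ob J P A) B (app ?l w) s (kpair u p) = act (ff_ob J P A) B (app ?r w) s (kpair u p))"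
  proof (rule ball_cong[OF refl])
    fix s assume s: "s \<in> S"
    then have "el (ff_ob J P A s) = cartesian (el (pow_hom V S J A)) (el (P s))"
      using X O unfolding ff_ob_def by simp
    then show "(\<forall>x\<in>el (ff_ob J P A s). act (ff_ob J P A) B (app ?l w) s x = act (ff_ob J P A) B (app ?r w) s x) \<longleftrightarrow>
      (\<forall>u\<in>el (pow_hom V S J A). \<forall>p\<in>el (P s).
        act (ff_ob J P A) B (app ?l w) s (kpair u p) = act (ff_ob J P A) B (app ?r w) s (kpair u p))"
      by (fastforce elim!: cartesianE)
  qed
  also have "\<dots> \<longleftrightarrow> ?R"
  proof (intro ball_cong refl)
    fix s u p assume s: "s \<in> S" and u: "u \<in> el (pow_hom V S J A)" and p: "p \<in> el (P s)"
    then have "kpair u p \<in> el (ff_ob J P A s)"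
      using X O unfolding ff_ob_def by simp
    then show "act (ff_ob J P A) B (app ?l w) s (kpair u p) = act (ff_ob J P A) B (app ?r w) s (kpair u p) \<longleftrightarrow>
        app (b s) (kpair (app (VComp (pow_vcat V S) J A B) (kpair w u)) p) = act A B w s (app (a s) (kpair u p))"
      using l[OF s u p] r[OF s] by simp
  qed
  finally show ?thesis .
qed

end

section \<open>Transport of operations\<close>

text \<open>Away from the output sort the parameter is initial, so that an operation of \<open>V\<^sup>S\<close>
  carries no information there.\<close>

definition param :: "'u \<Rightarrow> 'o \<Rightarrow> 'u \<Rightarrow> 'o" where
  "param s P = (\<lambda>r\<in>S. if r = s then P else copower V 0 (Unit V))"

text \<open>\<open>Swap\<close> is there because the parameter stands on the left for algebraic
  operations and on the right for free-form ones. Off the output sort the domain is a tensor product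
  with the initial object, so the arbitrary choice has only one candidate.\<close>

definition spread :: "'u list \<Rightarrow> 'u \<Rightarrow> 'o \<Rightarrow> ('u \<Rightarrow> 'o) \<Rightarrow> 'm \<Rightarrow> 'u \<Rightarrow> 'm" where
  "spread ss s P A a = (\<lambda>r\<in>S. if r = s
     then a \<cdot> (Ident V P \<odot> args ss A) \<cdot> Swap V (pow_hom V S (arity ss) A) P
     else (SOME m. m \<in> hom V (pow_hom V S (arity ss) A \<otimes> copower V 0 (Unit V)) (A r)))"

definition unspread :: "'u list \<Rightarrow> 'u \<Rightarrow> 'o \<Rightarrow> ('u \<Rightarrow> 'o) \<Rightarrow> ('u \<Rightarrow> 'm) \<Rightarrow> 'm" where
  "unspread ss s P A b = b s \<cdot> Swap V P (pow_hom V S (arity ss) A) \<cdot> (Ident V P \<odot> unargs ss A)"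

lemma param_PiE: "P \<in> Obj V \<Longrightarrow> param s P \<in> S \<rightarrow>\<^sub>E Obj V"
  unfolding param_def by auto

context
  fixes ss s P A
  assumes ty: "op_type V S ss s P" and A: "fam A"
begin

lemma transport_typing:
  shows "pow_hom V S (arity ss) A \<in> Obj V" "sorts_power V ss A \<in> Obj V" "P \<in> Obj V" "s \<in> S" "A s \<in> Obj V"
    "args ss A \<in> hom V (pow_hom V S (arity ss) A) (sorts_power V ss A)"
    "unargs ss A \<in> hom V (sorts_power V ss A) (pow_hom V S (arity ss) A)"
  using op_typeD[OF ty] A sorts_power_Obj args_hom unargs_hom by simp_all

lemma spread_in:
  assumes a: "a \<in> hom V (P \<otimes> sorts_power V ss A) (A s)"
  shows "spread ss s P A a \<in> pow_arrows V S (ff_ob (arity ss) (param s P) A) A"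
proof -
  have "spread ss s P A a r \<in> hom V (ff_ob (arity ss) (param s P) A r) (A r)" if r: "r \<in> S" for r
  proof (cases "r = s")
    case True
    then show ?thesis
      using transport_typing a r unfolding spread_def ff_ob_def param_def by (simp add: arr_simps)
  next
    case False
    then show ?thesis
      using someI_ex[OF tensor_empty_arr_ex[OF transport_typing(1), of "A r"]] r A
      unfolding spread_def ff_ob_def param_def by simp
  qed
  then show ?thesis
    unfolding pow_arrows_def by (intro PiE_I) (auto simp: spread_def)
qed

lemma app_spread:
  assumes a: "a \<in> hom V (P \<otimes> sorts_power V ss A) (A s)"
    and u: "u \<in> el (pow_hom V S (arity ss) A)" and p: "p \<in> el P"
  shows "app (spread ss s P A a s) (kpair u p) = app a (kpair p (app (args ss A) u))"
  using transport_typing a u p unfolding spread_def by (simp add: arr_simps)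

lemma unspread_in:
  assumes b: "b \<in> pow_arrows V S (ff_ob (arity ss) (param s P) A) A"
  shows "unspread ss s P A b \<in> hom V (P \<otimes> sorts_power V ss A) (A s)"
    and "p \<in> el P \<Longrightarrow> t \<in> el (sorts_power V ss A) \<Longrightarrow>
      app (unspread ss s P A b) (kpair p t) = app (b s) (kpair (app (unargs ss A) t) p)"
proof -
  have bs: "b s \<in> hom V (pow_hom V S (arity ss) A \<otimes> P) (A s)"
    using PiE_mem[OF b[unfolded pow_arrows_def] transport_typing(4)] transport_typing(4)
    unfolding ff_ob_def param_def by simp
  show "unspread ss s P A b \<in> hom V (P \<otimes> sorts_power V ss A) (A s)"
    using transport_typing bs unfolding unspread_def by (simp add: arr_simps)
  assume "p \<in> el P" "t \<in> el (sorts_power V ss A)"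
  then show "app (unspread ss s P A b) (kpair p t) = app (b s) (kpair (app (unargs ss A) t) p)"
    using transport_typing bs unfolding unspread_def by (simp add: arr_simps)
qed

lemma unspread_spread:
  assumes a: "a \<in> hom V (P \<otimes> sorts_power V ss A) (A s)"
  shows "unspread ss s P A (spread ss s P A a) = a"
proof (rule arr_eqI[OF unspread_in(1)[OF spread_in[OF a]] a])
  fix x assume "x \<in> el (P \<otimes> sorts_power V ss A)"
  then obtain p t where x: "x = kpair p t" "p \<in> el P" "t \<in> el (sorts_power V ss A)"
    using transport_typing by (auto elim: cartesianE)
  show "app (unspread ss s P A (spread ss s P A a)) x = app a x"
    unfolding x(1) unspread_in(2)[OF spread_in[OF a] x(2,3)]
      app_spread[OF a app_in[OF transport_typing(7) x(3)] x(2)]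
      args_unargs[OF op_typeD(1)[OF ty] A x(3)] ..
qed

lemma spread_unspread:
  assumes b: "b \<in> pow_arrows V S (ff_ob (arity ss) (param s P) A) A"
  shows "spread ss s P A (unspread ss s P A b) = b"
  using spread_in[OF unspread_in(1)[OF b], unfolded pow_arrows_def] b[unfolded pow_arrows_def]
proof (rule PiE_ext)
  fix r assume r: "r \<in> S"
  show "spread ss s P A (unspread ss s P A b) r = b r"
  proof (rule arr_eqI)
    show "spread ss s P A (unspread ss s P A b) r \<in> hom V (ff_ob (arity ss) (param s P) A r) (A r)"
      "b r \<in> hom V (ff_ob (arity ss) (param s P) A r) (A r)"
      using spread_in[OF unspread_in(1)[OF b]] b r unfolding pow_arrows_def by auto
    fix x assume x: "x \<in> el (ff_ob (arity ss) (param s P) A r)"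
    show "app (spread ss s P A (unspread ss s P A b) r) x = app (b r) x"
    proof (cases "r = s")
      case True
      then obtain u p where up: "x = kpair u p" "u \<in> el (pow_hom V S (arity ss) A)" "p \<in> el P"
        using x r transport_typing unfolding ff_ob_def param_def by (auto elim: cartesianE)
      show ?thesis
        unfolding True up(1) app_spread[OF unspread_in(1)[OF b] up(2,3)]
          unspread_in(2)[OF b up(3) app_in[OF transport_typing(6) up(2)]]
          unargs_args[OF op_typeD(1)[OF ty] A up(2)] ..
    next
      \<comment> \<open>The domain is a tensor product with the initial object and has no
        elements.\<close>
      case False
      then show ?thesis
        using x r transport_typing unfolding ff_ob_def param_def by (auto elim: cartesianE)
    qed
  qed
qed

end

text \<open>By \<open>args_natural\<close>, the condition at an element of V^S(J, A) is the
  condition at the corresponding tuple, and the comparison reaches every tuple. This is why the two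
  kinds of hom-objects have the same elements.\<close>

lemma spread_condition_iff:
  assumes ty: "op_type V S ss s P" and O: "fam A" "fam B"
    and a: "a \<in> hom V (P \<otimes> sorts_power V ss A) (A s)" and b: "b \<in> hom V (P \<otimes> sorts_power V ss B) (B s)"
    and w: "w \<in> el (pow_hom V S A B)"
  shows "app (pow_post V S (ff_ob (arity ss) (param s P) A) (ff_ob (arity ss) (param s P) B) B (spread ss s P B b) \<cdot>
        VFar (ff_arg_vfun V S (arity ss) (param s P)) A B) w =
      app (pow_pre V S (ff_ob (arity ss) (param s P) A) A B (spread ss s P A a)) w \<longleftrightarrow>
    hom_at ss s P A B a b w" (is "?L \<longleftrightarrow> _")
proof -
  note ty' = op_typeD[OF ty]
  have J: "fam (arity ss)" and P: "fam (param s P)"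
    using param_PiE[OF ty'(3)] by auto
  let ?H = "pow_hom V S (arity ss) A"
  let ?c = "\<lambda>r u p. app (spread ss s P B b r) (kpair (app (VComp (pow_vcat V S) (arity ss) A B) (kpair w u)) p) =
      act A B w r (app (spread ss s P A a r) (kpair u p))"
  have c: "?c s u p \<longleftrightarrow> app b (kpair p (smap ss A B w (app (args ss A) u))) =
      act A B w s (app a (kpair p (app (args ss A) u)))" if u: "u \<in> el ?H" and p: "p \<in> el P" for u p
    unfolding app_spread[OF ty O(1) a u p] app_spread[OF ty O(2) b app_VComp_in[OF J O u w] p]
      args_natural[OF ty'(1) O w u] ..
  have "?L \<longleftrightarrow> (\<forall>r\<in>S. \<forall>u\<in>el ?H. \<forall>p\<in>el (param s P r). ?c r u p)"
    by (rule ff_condition_iff[OF J P O spread_in[OF ty O(1) a] spread_in[OF ty O(2) b] w])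
  \<comment> \<open>At sorts other than \<open>s\<close> the parameter has no elements and the
    condition is vacuous.\<close>
  also have "\<dots> \<longleftrightarrow> (\<forall>u\<in>el ?H. \<forall>p\<in>el P. ?c s u p)"
  proof -
    have "el (param s P r) = (if r = s then el P else {})" if "r \<in> S" for r
      using that unfolding param_def by simp
    then show ?thesis
      using ty'(2) by (auto split: if_splits)
  qed
  also have "\<dots> \<longleftrightarrow> hom_at ss s P A B a b w"
  proof
    assume L: "\<forall>u\<in>el ?H. \<forall>p\<in>el P. ?c s u p"
    show "hom_at ss s P A B a b w"
      unfolding hom_at_def
    proof (intro ballI)
      fix p t assume p: "p \<in> el P" and t: "t \<in> el (sorts_power V ss A)"
      note u = app_in[OF unargs_hom[OF ty'(1) O(1)] t]
      show "app b (kpair p (smap ss A B w t)) = act A B w s (app a (kpair p t))"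
        using c[OF u p] L u p unfolding args_unargs[OF ty'(1) O(1) t] by blast
    qed
  next
    assume "hom_at ss s P A B a b w"
    then show "\<forall>u\<in>el ?H. \<forall>p\<in>el P. ?c s u p"
      using c app_in[OF args_hom[OF ty'(1) O(1)]] unfolding hom_at_def by simp
  qed
  finally show ?thesis .
qed

end

section \<open>Full subcategories\<close>

text \<open>Full subcategories keep hom-objects, identities and composition, so the isomorphism and
  its inverse restrict once the objects match.\<close>

lemma slice_iso_full_on:
  assumes iso: "slice_iso V B A U A' U' F"
    and X: "X \<subseteq> VObj A" and X': "X' \<subseteq> VObj A'"
    and F: "\<And>a. a \<in> VObj A \<Longrightarrow> a \<in> X \<longleftrightarrow> VFob F a \<in> X'"
  shows "slice_iso V B (full_on A X) U (full_on A' X') U' F"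
proof -
  have vcat: "vcategory V (full_on C Y)" if "vcategory V C" "Y \<subseteq> VObj C" for C :: "('x, 'a, 'b) vcat" and Y
    using that unfolding vcategory_def full_on_def by (auto simp: subset_iff)
  have vfun: "is_vfunctor V (full_on C Y) D K"
    if "is_vfunctor V C D K" "Y \<subseteq> VObj C"
    for C :: "('x, 'a, 'b) vcat" and D :: "('y, 'a, 'b) vcat" and Y K
    using that unfolding is_vfunctor_def full_on_def by (auto simp: subset_iff)
  have vfun_into: "is_vfunctor V C (full_on D Y) K"
    if "is_vfunctor V C D K" "\<And>c. c \<in> VObj C \<Longrightarrow> VFob K c \<in> Y"
    for C :: "('x, 'a, 'b) vcat" and D :: "('y, 'a, 'b) vcat" and Y K
    using that unfolding is_vfunctor_def full_on_def by auto
  have eq: "vfun_eq (full_on C Y) K L" if "vfun_eq C K L" "Y \<subseteq> VObj C"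
    for C :: "('x, 'a, 'b) vcat" and Y and K L :: "('x, 'y, 'b) vfunctor"
    using that unfolding vfun_eq_def full_on_def by (auto simp: subset_iff)
  have id: "vfun_id V (full_on C Y) = vfun_id V C" for C :: "('x, 'a, 'b) vcat" and Y
    unfolding vfun_id_def full_on_def by simp
  have ob: "VObj (full_on C Y) = Y" for C :: "('x, 'a, 'b) vcat" and Y
    unfolding full_on_def by simp
  obtain G where sA: "slice_object V B A U" and sA': "slice_object V B A' U'"
    and mF: "slice_morphism V A U A' U' F" and mG: "slice_morphism V A' U' A U G"
    and GF: "vfun_eq A (vfun_comp V G F) (vfun_id V A)"
    and FG: "vfun_eq A' (vfun_comp V F G) (vfun_id V A')"
    using iso unfolding slice_iso_def by blast
  \<comment> \<open>The hypothesis on \<open>F\<close> is an equivalence: membership is reflected as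
    well, which is what the inverse requires.\<close>
  have G: "VFob G a \<in> X" if a: "a \<in> X'" for a
  proof -
    have "VFob G a \<in> VObj A" "VFob F (VFob G a) = a"
      using mG FG a X' unfolding slice_morphism_def is_vfunctor_def vfun_eq_def vfun_comp_def vfun_id_def
      by auto
    then show ?thesis
      using F a by simp
  qed
  have FX: "VFob F a \<in> X'" if "a \<in> X" for a
    using F that X by blast
  have "slice_object V B (full_on A X) U" "slice_object V B (full_on A' X') U'"
    using sA sA' vcat vfun X X' unfolding slice_object_def by auto
  moreover have "slice_morphism V (full_on A X) U (full_on A' X') U' F"
    using mF vfun_into[OF vfun[OF _ X], of A' F X'] eq[OF _ X, of "vfun_comp V U' F" U] FX unfolding slice_morphism_def
    by (simp add: ob)
  moreover have "slice_morphism V (full_on A' X') U' (full_on A X) U G"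
    using mG vfun_into[OF vfun[OF _ X'], of A G X] eq[OF _ X', of "vfun_comp V U G" U'] G unfolding slice_morphism_def
    by (simp add: ob)
  ultimately show ?thesis
    unfolding slice_iso_def id using eq[OF GF X] eq[OF FG X'] by blast
qed

context sorted_smcc
begin

section \<open>The free-form signature of a signature\<close>

definition ff_sig :: "('u, 'o) signature \<Rightarrow> ('u, 'o) ff_signature" where
  "ff_sig Sg = \<lparr> FSyms = Syms Sg, FArity = (\<lambda>\<sigma>. arity (Ins Sg \<sigma>)),
     FPar = (\<lambda>\<sigma>. param (Out Sg \<sigma>) (Par Sg \<sigma>)) \<rparr>"

definition to_ff :: "('u, 'o) signature \<Rightarrow> ('u, 'o, 'm) alg \<Rightarrow> ('u, 'o, 'm) ff_alg" where
  "to_ff Sg A = (fst A, \<lambda>\<sigma>\<in>Syms Sg. spread (Ins Sg \<sigma>) (Out Sg \<sigma>) (Par Sg \<sigma>) (fst A) (snd A \<sigma>))"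

definition of_ff :: "('u, 'o) signature \<Rightarrow> ('u, 'o, 'm) ff_alg \<Rightarrow> ('u, 'o, 'm) alg" where
  "of_ff Sg A = (fst A, \<lambda>\<sigma>\<in>Syms Sg. unspread (Ins Sg \<sigma>) (Out Sg \<sigma>) (Par Sg \<sigma>) (fst A) (snd A \<sigma>))"

text \<open>The elements of V^S(A, B) that come from the hom-object of algebras.\<close>

definition alg_homs :: "('u, 'o) signature \<Rightarrow> ('u, 'o, 'm) alg \<Rightarrow> ('u, 'o, 'm) alg \<Rightarrow> 'u set" where
  "alg_homs Sg A B = {w \<in> el (pow_hom V S (fst A) (fst B)). \<forall>\<sigma>\<in>Syms Sg.
     hom_at (Ins Sg \<sigma>) (Out Sg \<sigma>) (Par Sg \<sigma>) (fst A) (fst B) (snd A \<sigma>) (snd B \<sigma>) w}"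

text \<open>Each component of \<open>w\<close> names an arrow. This turns an element into an
  ordinary morphism, to which the naturality of algebraic operations applies.\<close>

lemma pow_elem_arrows:
  assumes O: "fam A" "fam B" and w: "w \<in> el (pow_hom V S A B)"
  shows "\<exists>f\<in>pow_arrows V S A B. \<forall>s\<in>S. \<forall>x\<in>el (A s). act A B w s x = app (f s) x"
proof -
  have "\<forall>s\<in>S. \<exists>m\<in>hom V (A s) (B s). \<forall>x\<in>el (A s). app m x = act A B w s x"
    using arr_of_elem app_in[OF pow_proj_hom[OF O] w] O unfolding act_def by blast
  then obtain f where f: "\<And>s. s \<in> S \<Longrightarrow> f s \<in> hom V (A s) (B s)"
    "\<And>s x. s \<in> S \<Longrightarrow> x \<in> el (A s) \<Longrightarrow> app (f s) x = act A B w s x"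
    by metis
  have "restrict f S \<in> pow_arrows V S A B"
    using f(1) unfolding pow_arrows_def by simp
  then show ?thesis
    using f(2) by (intro bexI[of _ "restrict f S"]) simp_all
qed

context
  fixes Sg :: "('u, 'o) signature"
  assumes Sg: "is_signature V S Sg"
begin

lemma sym_type: "\<sigma> \<in> Syms Sg \<Longrightarrow> op_type V S (Ins Sg \<sigma>) (Out Sg \<sigma>) (Par Sg \<sigma>)"
  using Sg unfolding is_signature_def by blast

lemma is_ff_signature_ff_sig: "is_ff_signature V S (ff_sig Sg)"
  using Sg op_typeD(3)[OF sym_type] unfolding is_ff_signature_def ff_sig_def is_signature_def
  by (simp add: arity_in_finitary param_PiE)

section \<open>The bijection between the two kinds of algebras\<close>

lemma algebra_carrier:
  assumes "A \<in> algebras V S Sg"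
  shows "fst A \<in> S \<rightarrow>\<^sub>E Obj V" "fam (fst A)"
  using assms unfolding algebras_def by auto

lemma algebra_op:
  assumes "A \<in> algebras V S Sg" "\<sigma> \<in> Syms Sg"
  shows "snd A \<sigma> \<in> hom V (Par Sg \<sigma> \<otimes> sorts_power V (Ins Sg \<sigma>) (fst A)) (fst A (Out Sg \<sigma>))"
  using assms unfolding algebras_def by (auto simp: PiE_mem)

lemma ff_algebra_carrier:
  assumes "A \<in> ff_algebras V S (ff_sig Sg)"
  shows "fst A \<in> S \<rightarrow>\<^sub>E Obj V" "fam (fst A)"
  using assms unfolding ff_algebras_def by auto

lemma ff_algebra_op:
  assumes "A \<in> ff_algebras V S (ff_sig Sg)" "\<sigma> \<in> Syms Sg"
  shows "snd A \<sigma> \<in> pow_arrows V S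
    (ff_ob (arity (Ins Sg \<sigma>)) (param (Out Sg \<sigma>) (Par Sg \<sigma>)) (fst A)) (fst A)"
  using assms unfolding ff_algebras_def ff_sig_def by (auto simp: PiE_mem VFob_ff_arg)

lemma to_ff_in:
  assumes A: "A \<in> algebras V S Sg"
  shows "to_ff Sg A \<in> ff_algebras V S (ff_sig Sg)"
  using algebra_carrier[OF A] spread_in[OF sym_type algebra_carrier(2)[OF A] algebra_op[OF A]]
  unfolding ff_algebras_def to_ff_def ff_sig_def by (simp add: VFob_ff_arg)

lemma of_ff_in:
  assumes A: "A \<in> ff_algebras V S (ff_sig Sg)"
  shows "of_ff Sg A \<in> algebras V S Sg"
  using ff_algebra_carrier[OF A] unspread_in(1)[OF sym_type ff_algebra_carrier(2)[OF A] ff_algebra_op[OF A]]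
  unfolding algebras_def of_ff_def by simp

lemma of_ff_to_ff:
  assumes A: "A \<in> algebras V S Sg"
  shows "of_ff Sg (to_ff Sg A) = A"
proof -
  have "snd A \<in> extensional (Syms Sg)"
    using A unfolding algebras_def PiE_def by auto
  then have "(\<lambda>\<sigma>\<in>Syms Sg. unspread (Ins Sg \<sigma>) (Out Sg \<sigma>) (Par Sg \<sigma>) (fst A)
      (spread (Ins Sg \<sigma>) (Out Sg \<sigma>) (Par Sg \<sigma>) (fst A) (snd A \<sigma>))) = snd A"
    using unspread_spread[OF sym_type algebra_carrier(2)[OF A] algebra_op[OF A]]
    by - (rule extensionalityI[of _ "Syms Sg"], simp_all)
  then show ?thesis
    unfolding of_ff_def to_ff_def by (simp add: prod_eq_iff cong: restrict_cong)
qed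

lemma to_ff_of_ff:
  assumes A: "A \<in> ff_algebras V S (ff_sig Sg)"
  shows "to_ff Sg (of_ff Sg A) = A"
proof -
  have "snd A \<in> extensional (Syms Sg)"
    using A unfolding ff_algebras_def PiE_def ff_sig_def by auto
  then have "(\<lambda>\<sigma>\<in>Syms Sg. spread (Ins Sg \<sigma>) (Out Sg \<sigma>) (Par Sg \<sigma>) (fst A)
      (unspread (Ins Sg \<sigma>) (Out Sg \<sigma>) (Par Sg \<sigma>) (fst A) (snd A \<sigma>))) = snd A"
    using spread_unspread[OF sym_type ff_algebra_carrier(2)[OF A] ff_algebra_op[OF A]]
    by - (rule extensionalityI[of _ "Syms Sg"], simp_all)
  then show ?thesis
    unfolding of_ff_def to_ff_def by (simp add: prod_eq_iff cong: restrict_cong)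
qed

section \<open>Hom-objects of algebras as subobjects of those of V^S\<close>

lemma alg_homs_VId:
  assumes A: "A \<in> algebras V S Sg"
  shows "app (VId (pow_vcat V S) (fst A)) star \<in> alg_homs Sg A A"
  using app_VId_in[OF algebra_carrier(2)[OF A]]
    hom_at_VId[OF sym_type algebra_carrier(2)[OF A] algebra_op[OF A]]
  unfolding alg_homs_def by simp

lemma alg_homs_VComp:
  assumes A: "A \<in> algebras V S Sg" "B \<in> algebras V S Sg" "C \<in> algebras V S Sg"
    and u: "u \<in> alg_homs Sg A B" and v: "v \<in> alg_homs Sg B C"
  shows "app (VComp (pow_vcat V S) (fst A) (fst B) (fst C)) (kpair v u) \<in> alg_homs Sg A C"
proof -
  note O = algebra_carrier(2)[OF A(1)] algebra_carrier(2)[OF A(2)] algebra_carrier(2)[OF A(3)]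
  have u': "u \<in> el (pow_hom V S (fst A) (fst B))" and v': "v \<in> el (pow_hom V S (fst B) (fst C))"
    using u v unfolding alg_homs_def by simp_all
  have "hom_at (Ins Sg \<sigma>) (Out Sg \<sigma>) (Par Sg \<sigma>) (fst A) (fst C) (snd A \<sigma>) (snd C \<sigma>)
      (app (VComp (pow_vcat V S) (fst A) (fst B) (fst C)) (kpair v u))" if s: "\<sigma> \<in> Syms Sg" for \<sigma>
    using u v s
    by (intro hom_at_VComp[OF sym_type[OF s] O algebra_op[OF A(1) s] u' _ v', where b = "snd B \<sigma>"])
      (simp_all add: alg_homs_def)
  then show ?thesis
    using app_VComp_in[OF O u' v'] unfolding alg_homs_def by simp
qed

text \<open>The equalizer condition at an element is \<open>hom_at\<close> for every symbol, so the
  chosen equalizer is the subobject on \<open>alg_homs\<close>.\<close>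

lemma closed_subobjects_algebras:
  "closed_subobjects (pow_vcat V S) (algebras V S Sg) fst (alg_homs Sg)
     (\<lambda>A B. fst (algebra_equalizer V S Sg A B)) (\<lambda>A B. snd (algebra_equalizer V S Sg A B))"
  unfolding closed_subobjects_def VObj_pow VHom_pow
proof (intro conjI ballI alg_homs_VId alg_homs_VComp algebra_carrier(1))
  fix A B assume AB: "A \<in> algebras V S Sg" "B \<in> algebras V S Sg"
  note O = algebra_carrier(2)[OF AB(1)] algebra_carrier(2)[OF AB(2)]
  let ?f = "\<lambda>\<sigma>. post V (Par Sg \<sigma> \<otimes> sorts_power V (Ins Sg \<sigma>) (fst A)) (snd B \<sigma>)
      \<cdot> VFar (arg_vfun V S (Ins Sg \<sigma>) (Par Sg \<sigma>)) (fst A) (fst B)"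
    and ?g = "\<lambda>\<sigma>. pre V (snd A \<sigma>) (fst B (Out Sg \<sigma>)) \<cdot> pow_proj V S (fst A) (fst B) (Out Sg \<sigma>)"
  have "subobject (pow_hom V S (fst A) (fst B))
      {w \<in> el (pow_hom V S (fst A) (fst B)). \<forall>\<sigma>\<in>Syms Sg. app (?f \<sigma>) w = app (?g \<sigma>) w}
      (fst (algebra_equalizer V S Sg A B)) (snd (algebra_equalizer V S Sg A B))"
  proof (rule subobject_joint_equalizer[OF pow_hom_Obj[OF O]])
    fix \<sigma> assume s: "\<sigma> \<in> Syms Sg"
    note t = algebra_condition_typing[OF sym_type[OF s] O algebra_op[OF AB(1) s] algebra_op[OF AB(2) s]]
    show "?f \<sigma> \<in> hom V (pow_hom V S (fst A) (fst B))
        (Ihom V (Par Sg \<sigma> \<otimes> sorts_power V (Ins Sg \<sigma>) (fst A)) (fst B (Out Sg \<sigma>)))"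
      by (rule t(1))
    show "?g \<sigma> \<in> hom V (pow_hom V S (fst A) (fst B))
        (Ihom V (Par Sg \<sigma> \<otimes> sorts_power V (Ins Sg \<sigma>) (fst A)) (fst B (Out Sg \<sigma>)))"
      by (rule t(2))
  qed (simp add: algebra_equalizer_def)
  moreover have "{w \<in> el (pow_hom V S (fst A) (fst B)). \<forall>\<sigma>\<in>Syms Sg. app (?f \<sigma>) w = app (?g \<sigma>) w} =
      alg_homs Sg A B"
    unfolding alg_homs_def
    using algebra_condition_iff[OF sym_type O algebra_op[OF AB(1)] algebra_op[OF AB(2)]] by auto
  ultimately show "subobject (pow_hom V S (fst A) (fst B)) (alg_homs Sg A B)
      (fst (algebra_equalizer V S Sg A B)) (snd (algebra_equalizer V S Sg A B))"
    by simp
qed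

text \<open>Every free-form operation is a \<open>spread\<close>, which makes
  \<open>spread_condition_iff\<close> applicable to arbitrary free-form algebras.\<close>

lemma snd_ff_algebra:
  assumes A: "A \<in> ff_algebras V S (ff_sig Sg)" and s: "\<sigma> \<in> Syms Sg"
  shows "snd A \<sigma> = spread (Ins Sg \<sigma>) (Out Sg \<sigma>) (Par Sg \<sigma>) (fst A) (snd (of_ff Sg A) \<sigma>)"
  using spread_unspread[OF sym_type[OF s] ff_algebra_carrier(2)[OF A] ff_algebra_op[OF A s]] s
  unfolding of_ff_def by simp

lemma fst_of_ff [simp]: "fst (of_ff Sg A) = fst A"
  unfolding of_ff_def by simp

text \<open>The sets are stated through \<open>of_ff\<close> so that they are literally those of the
  corresponding algebras over \<open>Sg\<close>; their agreement under the isomorphism is then just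
  that \<open>of_ff\<close> undoes \<open>to_ff\<close>.\<close>

lemma closed_subobjects_ff_algebras:
  "closed_subobjects (pow_vcat V S) (ff_algebras V S (ff_sig Sg)) fst
     (\<lambda>A B. alg_homs Sg (of_ff Sg A) (of_ff Sg B))
     (\<lambda>A B. fst (ff_algebra_equalizer V S (ff_sig Sg) A B))
     (\<lambda>A B. snd (ff_algebra_equalizer V S (ff_sig Sg) A B))"
  unfolding closed_subobjects_def VObj_pow VHom_pow
proof (intro conjI ballI ff_algebra_carrier(1))
  fix A assume A: "A \<in> ff_algebras V S (ff_sig Sg)"
  show "app (VId (pow_vcat V S) (fst A)) star \<in> alg_homs Sg (of_ff Sg A) (of_ff Sg A)"
    using alg_homs_VId[OF of_ff_in[OF A]] by simp
next
  fix A B C u v assume A: "A \<in> ff_algebras V S (ff_sig Sg)" "B \<in> ff_algebras V S (ff_sig Sg)"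
    "C \<in> ff_algebras V S (ff_sig Sg)"
    and "u \<in> alg_homs Sg (of_ff Sg A) (of_ff Sg B)" "v \<in> alg_homs Sg (of_ff Sg B) (of_ff Sg C)"
  then show "app (VComp (pow_vcat V S) (fst A) (fst B) (fst C)) (kpair v u) \<in>
      alg_homs Sg (of_ff Sg A) (of_ff Sg C)"
    using alg_homs_VComp[OF of_ff_in[OF A(1)] of_ff_in[OF A(2)] of_ff_in[OF A(3)]] by simp
next
  fix A B assume AB: "A \<in> ff_algebras V S (ff_sig Sg)" "B \<in> ff_algebras V S (ff_sig Sg)"
  note O = ff_algebra_carrier(2)[OF AB(1)] ff_algebra_carrier(2)[OF AB(2)]
  let ?J = "\<lambda>\<sigma>. arity (Ins Sg \<sigma>)" and ?P = "\<lambda>\<sigma>. param (Out Sg \<sigma>) (Par Sg \<sigma>)"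
  let ?f = "\<lambda>\<sigma>. pow_post V S (ff_ob (?J \<sigma>) (?P \<sigma>) (fst A)) (ff_ob (?J \<sigma>) (?P \<sigma>) (fst B)) (fst B) (snd B \<sigma>)
      \<cdot> VFar (ff_arg_vfun V S (?J \<sigma>) (?P \<sigma>)) (fst A) (fst B)"
    and ?g = "\<lambda>\<sigma>. pow_pre V S (ff_ob (?J \<sigma>) (?P \<sigma>) (fst A)) (fst A) (fst B) (snd A \<sigma>)"
  have J: "fam (?J \<sigma>)" and P: "\<sigma> \<in> Syms Sg \<Longrightarrow> fam (?P \<sigma>)" for \<sigma>
    using param_PiE[OF op_typeD(3)[OF sym_type]] by auto
  have "subobject (pow_hom V S (fst A) (fst B))
      {w \<in> el (pow_hom V S (fst A) (fst B)). \<forall>\<sigma>\<in>Syms Sg. app (?f \<sigma>) w = app (?g \<sigma>) w}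
      (fst (ff_algebra_equalizer V S (ff_sig Sg) A B)) (snd (ff_algebra_equalizer V S (ff_sig Sg) A B))"
  proof (rule subobject_joint_equalizer[OF pow_hom_Obj[OF O]])
    fix \<sigma> assume s: "\<sigma> \<in> Syms Sg"
    note t = ff_condition_typing[OF J P[OF s] O ff_algebra_op[OF AB(1) s] ff_algebra_op[OF AB(2) s]]
    show "?f \<sigma> \<in> hom V (pow_hom V S (fst A) (fst B)) (pow_hom V S (ff_ob (?J \<sigma>) (?P \<sigma>) (fst A)) (fst B))"
      by (rule t(1))
    show "?g \<sigma> \<in> hom V (pow_hom V S (fst A) (fst B)) (pow_hom V S (ff_ob (?J \<sigma>) (?P \<sigma>) (fst A)) (fst B))"
      by (rule t(2))
  qed (simp add: ff_algebra_equalizer_def ff_sig_def VFob_ff_arg Let_def)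
  moreover have "app (?f \<sigma>) w = app (?g \<sigma>) w \<longleftrightarrow> hom_at (Ins Sg \<sigma>) (Out Sg \<sigma>) (Par Sg \<sigma>) (fst A) (fst B)
      (snd (of_ff Sg A) \<sigma>) (snd (of_ff Sg B) \<sigma>) w"
    if s: "\<sigma> \<in> Syms Sg" and w: "w \<in> el (pow_hom V S (fst A) (fst B))" for \<sigma> w
    unfolding snd_ff_algebra[OF AB(1) s] snd_ff_algebra[OF AB(2) s]
    using algebra_op[OF of_ff_in[OF AB(1)] s] algebra_op[OF of_ff_in[OF AB(2)] s]
    by (intro spread_condition_iff[OF sym_type[OF s] O _ _ w]) simp_all
  then have "{w \<in> el (pow_hom V S (fst A) (fst B)). \<forall>\<sigma>\<in>Syms Sg. app (?f \<sigma>) w = app (?g \<sigma>) w} =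
      alg_homs Sg (of_ff Sg A) (of_ff Sg B)"
    unfolding alg_homs_def fst_of_ff by blast
  ultimately show "subobject (pow_hom V S (fst A) (fst B)) (alg_homs Sg (of_ff Sg A) (of_ff Sg B))
      (fst (ff_algebra_equalizer V S (ff_sig Sg) A B)) (snd (ff_algebra_equalizer V S (ff_sig Sg) A B))"
    by simp
qed

text \<open>The object map is recorded because the claims about equations compare an algebra with
  its image.\<close>

lemma slice_iso_Alg:
  "\<exists>F. VFob F = to_ff Sg \<and> slice_iso V (pow_vcat V S)
     (Alg_vcat V S Sg) (Alg_forget V S Sg) (ff_Alg_vcat V S (ff_sig Sg)) (ff_Alg_forget V S (ff_sig Sg)) F"
proof -
  have "alg_homs Sg (of_ff Sg (to_ff Sg A)) (of_ff Sg (to_ff Sg B)) = alg_homs Sg A B"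
    if "A \<in> algebras V S Sg" "B \<in> algebras V S Sg" for A B
    using of_ff_to_ff that by simp
  note iso = slice_iso_induced[where F = "to_ff Sg" and G = "of_ff Sg",
      OF vcategory_pow closed_subobjects_algebras closed_subobjects_ff_algebras
        to_ff_in _ of_ff_in this of_ff_to_ff to_ff_of_ff]
  have "fst (to_ff Sg A) = fst A" for A
    unfolding to_ff_def by simp
  note iso = iso[OF _ this]
  show ?thesis
    unfolding Alg_vcat_def Alg_forget_def ff_Alg_vcat_def ff_Alg_forget_def
    by (rule exI, rule conjI[OF _ iso]) (simp_all add: factor_vfun_def)
qed

section \<open>Operations and equations\<close>

text \<open>Evaluation at the corresponding algebra over \<open>Sg\<close>, then transport; the
  restriction is there because natural operations are extensional families.\<close>

definition ff_operation ::
  "'u list \<Rightarrow> 'u \<Rightarrow> 'o \<Rightarrow> (('u, 'o, 'm) alg \<Rightarrow> 'm) \<Rightarrow> ('u, 'o, 'm) ff_alg \<Rightarrow> 'u \<Rightarrow> 'm" where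
  "ff_operation ss s P \<omega> = (\<lambda>B\<in>ff_algebras V S (ff_sig Sg). spread ss s P (fst B) (\<omega> (of_ff Sg B)))"

text \<open>Enriched naturality is an equation between arrows out of a hom-object, so it can be
  checked at each element. An element gives an ordinary homomorphism, and there the equation is the
  naturality of \<omega>.\<close>

lemma natural_operation_ff:
  assumes ty: "op_type V S ss s P" and \<omega>: "algebraic_operation V S Sg ss s P \<omega>"
  shows "natural_operation V S (ff_sig Sg) (arity ss) (param s P) (ff_operation ss s P \<omega>)"
proof -
  let ?J = "arity ss" and ?P = "param s P" and ?\<eta> = "ff_operation ss s P \<omega>"
  let ?E = "\<lambda>A B. fst (ff_algebra_equalizer V S (ff_sig Sg) A B)"
    and ?e = "\<lambda>A B. snd (ff_algebra_equalizer V S (ff_sig Sg) A B)"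
  have J: "fam ?J" and P: "fam ?P"
    using param_PiE[OF op_typeD(3)[OF ty]] by auto
  have \<omega>h: "\<omega> A \<in> hom V (P \<otimes> sorts_power V ss (fst A)) (fst A s)" if "A \<in> algebras V S Sg" for A
    using \<omega> that unfolding algebraic_operation_def by (auto simp: PiE_mem)
  have \<omega>n: "f s \<cdot> \<omega> A = \<omega> B \<cdot> arg_arrow V ss P (fst A) (fst B) f"
    if "A \<in> algebras V S Sg" "B \<in> algebras V S Sg" "f \<in> algebra_arrows V S Sg A B" for A B f
    using \<omega> that unfolding algebraic_operation_def by blast
  have \<omega>of: "\<omega> (of_ff Sg A) \<in> hom V (P \<otimes> sorts_power V ss (fst A)) (fst A s)"
    if "A \<in> ff_algebras V S (ff_sig Sg)" for A
    using \<omega>h[OF of_ff_in[OF that]] by simp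
  have \<eta>: "?\<eta> A = spread ss s P (fst A) (\<omega> (of_ff Sg A))" if "A \<in> ff_algebras V S (ff_sig Sg)" for A
    using that unfolding ff_operation_def by simp
  have \<eta>in: "?\<eta> A \<in> pow_arrows V S (ff_ob ?J ?P (fst A)) (fst A)"
    if "A \<in> ff_algebras V S (ff_sig Sg)" for A
    unfolding \<eta>[OF that] by (rule spread_in[OF ty ff_algebra_carrier(2)[OF that] \<omega>of[OF that]])
  have nat: "pow_post V S (ff_ob ?J ?P (fst A)) (ff_ob ?J ?P (fst B)) (fst B) (?\<eta> B)
      \<cdot> (VFar (ff_arg_vfun V S ?J ?P) (fst A) (fst B) \<cdot> ?e A B) =
    pow_pre V S (ff_ob ?J ?P (fst A)) (fst A) (fst B) (?\<eta> A) \<cdot> ?e A B" (is "?p \<cdot> (?v \<cdot> _) = ?q \<cdot> _")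
    if AB: "A \<in> ff_algebras V S (ff_sig Sg)" "B \<in> ff_algebras V S (ff_sig Sg)" for A B
  proof -
    note O = ff_algebra_carrier(2)[OF AB(1)] ff_algebra_carrier(2)[OF AB(2)]
    note T = fam_ff_ob[OF J P O(1)] fam_ff_ob[OF J P O(2)]
    note sub = cs_sub[OF vcategory_pow closed_subobjects_ff_algebras AB, unfolded VHom_pow]
    note e = subobject_hom[OF sub]
    note t = ff_condition_typing[OF J P O \<eta>in[OF AB(1)] \<eta>in[OF AB(2)]]
    have p: "?p \<in> hom V (pow_hom V S (ff_ob ?J ?P (fst A)) (ff_ob ?J ?P (fst B)))
        (pow_hom V S (ff_ob ?J ?P (fst A)) (fst B))"
      using \<eta>in[OF AB(2)] unfolding pow_arrows_def by (intro pow_post_hom[OF T O(2)]) auto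
    \<comment> \<open>Bracketed to the left, the equation concerns the two arrows of
      \<open>ff_condition_typing\<close>; composition of enriched functors produces the other
      bracketing.\<close>
    have "?p \<cdot> ?v \<cdot> ?e A B = ?q \<cdot> ?e A B"
    proof (rule arr_eqI[OF comp_hom[OF t(1) e] comp_hom[OF t(2) e]])
      fix x assume x: "x \<in> el (?E A B)"
      let ?w = "app (?e A B) x"
      have w: "?w \<in> alg_homs Sg (of_ff Sg A) (of_ff Sg B)"
        by (rule subobject_in[OF sub x])
      then have w': "?w \<in> el (pow_hom V S (fst A) (fst B))"
        unfolding alg_homs_def by simp
      \<comment> \<open>The family of arrows named by \<open>?w\<close>; membership of
        \<open>?w\<close> in \<open>alg_homs\<close> makes it a homomorphism.\<close>
      obtain f where f: "f \<in> pow_arrows V S (fst A) (fst B)"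
        "\<And>s x. s \<in> S \<Longrightarrow> x \<in> el (fst A s) \<Longrightarrow> act (fst A) (fst B) ?w s x = app (f s) x"
        using pow_elem_arrows[OF O w'] by blast
      have "f (Out Sg \<sigma>) \<cdot> snd (of_ff Sg A) \<sigma> =
          snd (of_ff Sg B) \<sigma> \<cdot> arg_arrow V (Ins Sg \<sigma>) (Par Sg \<sigma>) (fst A) (fst B) f"
        if s: "\<sigma> \<in> Syms Sg" for \<sigma>
        using algebra_arrow_iff[OF sym_type[OF s] O _ _ w' f] w s
          algebra_op[OF of_ff_in[OF AB(1)] s] algebra_op[OF of_ff_in[OF AB(2)] s]
        unfolding alg_homs_def by simp
      then have "f \<in> algebra_arrows V S Sg (of_ff Sg A) (of_ff Sg B)"
        using f(1) unfolding algebra_arrows_def by simp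
      from \<omega>n[OF of_ff_in[OF AB(1)] of_ff_in[OF AB(2)] this]
      have "hom_at ss s P (fst A) (fst B) (\<omega> (of_ff Sg A)) (\<omega> (of_ff Sg B)) ?w"
        using algebra_arrow_iff[OF ty O \<omega>of[OF AB(1)] \<omega>of[OF AB(2)] w' f] by simp
      \<comment> \<open>The equivalence that matched the equalizer conditions is reused with
        \<omega> in place of an operation symbol, since it holds for any type and any two arrows of
        that type.\<close>
      then have "app (?p \<cdot> ?v) ?w = app ?q ?w"
        using spread_condition_iff[OF ty O \<omega>of[OF AB(1)] \<omega>of[OF AB(2)] w']
        unfolding \<eta>[OF AB(1)] \<eta>[OF AB(2)] by blast
      then show "app (?p \<cdot> ?v \<cdot> ?e A B) x = app (?q \<cdot> ?e A B) x"
        using app_comp[OF t(1) e x] app_comp[OF t(2) e x] by simp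
    qed
    then show ?thesis
      using comp_assoc[OF p ff_arg_hom[OF J P O] e] by simp
  qed
  show ?thesis
    unfolding natural_operation_def pow_vnatural_def
  proof (intro conjI ballI)
    show "?\<eta> \<in> (\<Pi>\<^sub>E A\<in>VObj (ff_Alg_vcat V S (ff_sig Sg)).
        pow_arrows V S (VFob (vfun_comp V (ff_arg_vfun V S ?J ?P) (ff_Alg_forget V S (ff_sig Sg))) A)
          (VFob (ff_Alg_forget V S (ff_sig Sg)) A))"
      using \<eta>in unfolding ff_Alg_vcat_def induced_vcat_def vfun_comp_def ff_Alg_forget_def
      by (auto simp: VFob_ff_arg ff_operation_def)
  next
    fix A B assume "A \<in> VObj (ff_Alg_vcat V S (ff_sig Sg))" "B \<in> VObj (ff_Alg_vcat V S (ff_sig Sg))"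
    then show "pow_post V S (VFob (vfun_comp V (ff_arg_vfun V S ?J ?P) (ff_Alg_forget V S (ff_sig Sg))) A)
        (VFob (vfun_comp V (ff_arg_vfun V S ?J ?P) (ff_Alg_forget V S (ff_sig Sg))) B)
        (VFob (ff_Alg_forget V S (ff_sig Sg)) B) (?\<eta> B) \<cdot>
        VFar (vfun_comp V (ff_arg_vfun V S ?J ?P) (ff_Alg_forget V S (ff_sig Sg))) A B =
      pow_pre V S (VFob (vfun_comp V (ff_arg_vfun V S ?J ?P) (ff_Alg_forget V S (ff_sig Sg))) A)
        (VFob (ff_Alg_forget V S (ff_sig Sg)) A) (VFob (ff_Alg_forget V S (ff_sig Sg)) B) (?\<eta> A) \<cdot>
        VFar (ff_Alg_forget V S (ff_sig Sg)) A B"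
      using nat by (simp add: ff_Alg_vcat_def induced_vcat_def vfun_comp_def ff_Alg_forget_def VFob_ff_arg)
  qed
qed

text \<open>Satisfaction is reflected because \<open>spread\<close> has the left inverse
  \<open>unspread\<close>.\<close>

lemma diagrammatic_equation_ex:
  assumes "algebraic_equation V S Sg eq"
  shows "\<exists>eq'. diagrammatic_equation V S (ff_sig Sg) eq' \<and>
    (\<forall>A\<in>algebras V S Sg. satisfies A eq \<longleftrightarrow> satisfies (to_ff Sg A) eq')"
proof -
  obtain ss s P where ty: "op_type V S ss s P"
    and op: "algebraic_operation V S Sg ss s P (fst eq)" "algebraic_operation V S Sg ss s P (snd eq)"
    using assms unfolding algebraic_equation_def by blast
  let ?eq = "(ff_operation ss s P (fst eq), ff_operation ss s P (snd eq))"
  have "diagrammatic_equation V S (ff_sig Sg) ?eq"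
    unfolding diagrammatic_equation_def
    using natural_operation_ff[OF ty op(1)] natural_operation_ff[OF ty op(2)]
      arity_in_finitary param_PiE[OF op_typeD(3)[OF ty]]
    by (intro bexI[of _ "arity ss"] bexI[of _ "param s P"]) simp_all
  moreover have "satisfies A eq \<longleftrightarrow> satisfies (to_ff Sg A) ?eq" if A: "A \<in> algebras V S Sg" for A
  proof -
    have h: "fst eq A \<in> hom V (P \<otimes> sorts_power V ss (fst A)) (fst A s)"
      "snd eq A \<in> hom V (P \<otimes> sorts_power V ss (fst A)) (fst A s)"
      using op A unfolding algebraic_operation_def by (auto simp: PiE_mem)
    have "ff_operation ss s P \<omega> (to_ff Sg A) = spread ss s P (fst A) (\<omega> A)" for \<omega>
      using to_ff_in[OF A] of_ff_to_ff[OF A] unfolding ff_operation_def by (simp add: to_ff_def)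
    then show ?thesis
      using unspread_spread[OF ty algebra_carrier(2)[OF A] h(1)]
        unspread_spread[OF ty algebra_carrier(2)[OF A] h(2)]
      unfolding satisfies_def by (metis fst_conv snd_conv)
  qed
  ultimately show ?thesis
    by blast
qed

end

end

theorem proposition6p5:
  fixes V :: "('o, 'm) smccat"
    and U :: "('o, 'm, 'u::set_universe) setfunctor"
    and S :: "'u set"
  assumes "symmetric_monoidal_closed V"
    and "topological V U"
    and "strict_symmetric_monoidal V Set_cat U"
    and "represented_by V U (Unit V)"
    and "small S"
  shows
    "(\<forall>Sg. is_signature V S Sg \<longrightarrow>
        (\<exists>Sg' F. is_ff_signature V S Sg' \<and>
           slice_iso V (pow_vcat V S)
             (Alg_vcat V S Sg) (Alg_forget V S Sg) (ff_Alg_vcat V S Sg') (ff_Alg_forget V S Sg') F \<and>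
           (\<forall>eq. algebraic_equation V S Sg eq \<longrightarrow>
              (\<exists>eq'. diagrammatic_equation V S Sg' eq' \<and>
                 (\<forall>A\<in>algebras V S Sg. satisfies A eq \<longleftrightarrow> satisfies (VFob F A) eq'))))) \<and>
     (\<forall>T. is_equational_theory V S T \<longrightarrow>
        (\<exists>T'. is_presentation V S T' \<and>
           (\<exists>F. slice_iso V (pow_vcat V S)
              (Theory_Alg_vcat V S T) (Alg_forget V S (fst T))
              (Pres_Alg_vcat V S T') (ff_Alg_forget V S (fst T')) F)))"
proof -
  interpret sorted_smcc V U S
    by unfold_locales (fact assms)+
  show ?thesis
  proof (intro conjI allI impI)
    fix Sg :: "('u, 'o) signature" assume Sg: "is_signature V S Sg"
    obtain F where F: "VFob F = to_ff Sg" and iso: "slice_iso V (pow_vcat V S) (Alg_vcat V S Sg)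
        (Alg_forget V S Sg) (ff_Alg_vcat V S (ff_sig Sg)) (ff_Alg_forget V S (ff_sig Sg)) F"
      using slice_iso_Alg[OF Sg] by blast
    show "\<exists>Sg' F. is_ff_signature V S Sg' \<and>
        slice_iso V (pow_vcat V S)
          (Alg_vcat V S Sg) (Alg_forget V S Sg) (ff_Alg_vcat V S Sg') (ff_Alg_forget V S Sg') F \<and>
        (\<forall>eq. algebraic_equation V S Sg eq \<longrightarrow>
           (\<exists>eq'. diagrammatic_equation V S Sg' eq' \<and>
              (\<forall>A\<in>algebras V S Sg. satisfies A eq \<longleftrightarrow> satisfies (VFob F A) eq')))"
      using is_ff_signature_ff_sig[OF Sg] iso diagrammatic_equation_ex[OF Sg] F
      by (intro exI[of _ "ff_sig Sg"] exI[of _ F]) simp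
  next
    fix T :: "('u, 'o, 'm) equational_theory" assume T: "is_equational_theory V S T"
    let ?Sg = "fst T"
    have Sg: "is_signature V S ?Sg" and small: "small_collection TYPE('u) (snd T)"
      and eqs: "\<And>eq. eq \<in> snd T \<Longrightarrow> algebraic_equation V S ?Sg eq"
      using T unfolding is_equational_theory_def by auto
    obtain F where F: "VFob F = to_ff ?Sg" and iso: "slice_iso V (pow_vcat V S) (Alg_vcat V S ?Sg)
        (Alg_forget V S ?Sg) (ff_Alg_vcat V S (ff_sig ?Sg)) (ff_Alg_forget V S (ff_sig ?Sg)) F"
      using slice_iso_Alg[OF Sg] by blast
    have "\<forall>eq\<in>snd T. \<exists>eq'. diagrammatic_equation V S (ff_sig ?Sg) eq' \<and>
        (\<forall>A\<in>algebras V S ?Sg. satisfies A eq \<longleftrightarrow> satisfies (to_ff ?Sg A) eq')"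
      using diagrammatic_equation_ex[OF Sg eqs] by blast
    \<comment> \<open>A translation is only known to exist, as it depends on a type of the equation,
      so one is chosen for each equation; the translations then form an image of a small
      collection.\<close>
    then obtain g where g: "\<forall>eq\<in>snd T. diagrammatic_equation V S (ff_sig ?Sg) (g eq) \<and>
        (\<forall>A\<in>algebras V S ?Sg. satisfies A eq \<longleftrightarrow> satisfies (to_ff ?Sg A) (g eq))"
      by (rule bchoice[THEN exE])
    let ?T = "(ff_sig ?Sg, g ` snd T)"
    have "small_collection TYPE('u) (g ` snd T)"
      using small unfolding small_collection_def by (metis image_image)
    then have "is_presentation V S ?T"
      unfolding is_presentation_def using is_ff_signature_ff_sig[OF Sg] g by simp
    \<comment> \<open>Equations cut out full subcategories on both sides, and the object map
      preserves and reflects satisfaction.\<close>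
    moreover have "slice_iso V (pow_vcat V S) (Theory_Alg_vcat V S T) (Alg_forget V S ?Sg)
        (Pres_Alg_vcat V S ?T) (ff_Alg_forget V S (ff_sig ?Sg)) F"
      unfolding Theory_Alg_vcat_def Pres_Alg_vcat_def fst_conv snd_conv
    proof (rule slice_iso_full_on[OF iso])
      fix A assume "A \<in> VObj (Alg_vcat V S ?Sg)"
      then have "A \<in> algebras V S ?Sg"
        unfolding Alg_vcat_def induced_vcat_def by simp
      then show "A \<in> {A \<in> algebras V S ?Sg. \<forall>eq\<in>snd T. satisfies A eq} \<longleftrightarrow>
          VFob F A \<in> {A \<in> ff_algebras V S (ff_sig ?Sg). \<forall>eq\<in>g ` snd T. satisfies A eq}"
        using g to_ff_in[OF Sg] F by simp
    qed (auto simp: Alg_vcat_def ff_Alg_vcat_def induced_vcat_def)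
    ultimately show "\<exists>T'. is_presentation V S T' \<and>
        (\<exists>F. slice_iso V (pow_vcat V S) (Theory_Alg_vcat V S T) (Alg_forget V S ?Sg)
           (Pres_Alg_vcat V S T') (ff_Alg_forget V S (fst T')) F)"
      by (intro exI[of _ ?T]) auto
  qed
qed

end
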